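(* Let $f=U''(U^{-1}(\cdot))$, $g=U'(U^{-1}(\cdot))\in W^{2,\infty}([0,1])$ with $g^2>c>0$. Let $\omega_0|_{y=0,1}\equiv0$ and let $W$ be the solution, for a fixed frequency $k$, of $$\partial_t W=\frac{i f(y)}{k}\Phi,\qquad \Big(-1+\big(g(y)(\tfrac{\partial_y}{k}-it)\big)^2\Big)\Phi=W,\qquad \Phi|_{y=0,1}=0,\qquad W|_{t=0}=\omega_0,\qquad y\in[0,1].$$ Suppose further that the limits $\lim_{t\to\infty}f(y)\partial_yW(t,y)|_{y=0}$ and $\lim_{t\to\infty}f(y)\partial_yW(t,y)|_{y=1}$ exist and are non-trivial (i.e. not both zero). Then for any $s>5/2$, $$\sup_{t\ge0}\|W(t)\|_{H^s([0,1])}=\infty.$$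
   Context: Setting: $L>0$, and $U:[a,b]\to\mathbb R$ is a strictly monotone shear profile, normalized so that $U([a,b])=[0,1]$; $f$ and $g$ are functions on $[0,1]$. The displayed system is the linearized 2D Euler equation around $(U(y),0)$ in the periodic channel of period $L$ in $x$, in coordinates moving with the flow, after a Fourier transform in $x$ and the change of variables $y\mapsto U(y)$. The system decouples in the frequency $k\in\frac{2\pi}{L}(\mathbb Z\setminus\{0\})$; $k$ is fixed, and $W(t)=W(t,k,\cdot)$, $\omega_0=\omega_0(k,\cdot)$ are functions of $y\in[0,1]$. For $0<s<1$, $H^s([0,1])$ has norm squared $\|u\|_{L^2}^2+\iint_{[0,1]^2}\frac{|u(x)-u(y)|^2}{|x-y|^{1+2s}}\,dx\,dy$; for non-integer $s>1$, $u\in H^s$ iff $u,\partial_yu\in H^{s-1}$; for integer $s$ it is the usual Sobolev space. A norm is $\infty$ if the function is not in the space. *)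

theory Defs
  imports "HOL-Analysis.Analysis"
begin

text \<open>Elements of the Sobolev spaces on the unit interval are represented by functions on the real line; only their values on
  \<open>[0,1]\<close>, up to null sets, matter.\<close>

definition test_function_deriv :: "(real \<Rightarrow> real) \<Rightarrow> (real \<Rightarrow> real) \<Rightarrow> bool" where
  "test_function_deriv \<phi> \<phi>' \<longleftrightarrow>
     (\<forall>x. (\<phi> has_real_derivative \<phi>' x) (at x)) \<and> continuous_on UNIV \<phi>' \<and>
     (\<exists>K. compact K \<and> K \<subseteq> {0<..<1} \<and> (\<forall>x. x \<notin> K \<longrightarrow> \<phi> x = 0))"

text \<open>Weak derivative on \<open>(0,1)\<close>, tested against compactly supported \<open>C\<^sup>1\<close> functions.\<close>

definition has_weak_deriv ::
    "(real \<Rightarrow> 'a::{banach, second_countable_topology}) \<Rightarrow> (real \<Rightarrow> 'a) \<Rightarrow> bool" where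
  "has_weak_deriv u v \<longleftrightarrow>
     integrable (lebesgue_on {0..1}) u \<and> integrable (lebesgue_on {0..1}) v \<and>
     (\<forall>\<phi> \<phi>'. test_function_deriv \<phi> \<phi>' \<longrightarrow>
        (\<integral>x. \<phi>' x *\<^sub>R u x \<partial>lebesgue_on {0..1}) = - (\<integral>x. \<phi> x *\<^sub>R v x \<partial>lebesgue_on {0..1}))"

definition in_Linf :: "(real \<Rightarrow> 'a::{banach, second_countable_topology}) \<Rightarrow> bool" where
  "in_Linf u \<longleftrightarrow> u \<in> borel_measurable (lebesgue_on {0..1}) \<and>
     (\<exists>C. AE x in lebesgue_on {0..1}. norm (u x) \<le> C)"

primrec in_Winf :: "nat \<Rightarrow> (real \<Rightarrow> 'a::{banach, second_countable_topology}) \<Rightarrow> bool" where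
  "in_Winf 0 u \<longleftrightarrow> in_Linf u"
| "in_Winf (Suc m) u \<longleftrightarrow> in_Linf u \<and> (\<exists>v. has_weak_deriv u v \<and> in_Winf m v)"

definition L2_norm_sq :: "(real \<Rightarrow> complex) \<Rightarrow> ennreal" where
  "L2_norm_sq u =
     (if u \<in> borel_measurable (lebesgue_on {0..1})
      then \<integral>\<^sup>+x. ennreal ((norm (u x))\<^sup>2) \<partial>lebesgue_on {0..1} else \<infinity>)"

definition gagliardo_sq :: "real \<Rightarrow> (real \<Rightarrow> complex) \<Rightarrow> ennreal" where
  "gagliardo_sq \<sigma> u =
     (\<integral>\<^sup>+x. (\<integral>\<^sup>+y. ennreal ((norm (u x - u y))\<^sup>2 / \<bar>x - y\<bar> powr (1 + 2 * \<sigma>))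
        \<partial>lebesgue_on {0..1}) \<partial>lebesgue_on {0..1})"

text \<open>The squared norm of \<open>H\<^sup>s\<close> for \<open>s = n + \<sigma>\<close>, \<open>0 \<le> \<sigma> < 1\<close>, is the sum over \<open>j \<le> n\<close> of the squared
  \<open>H\<^sup>\<sigma>\<close> norms of the \<open>j\<close>-th weak derivatives, where \<open>H\<^sup>0 = L\<^sup>2\<close>.
  The weak derivative \<open>v\<close> is unique up to null sets, so the infimum is over equal values; if there is
  no weak derivative, it is the infimum of the empty set, which is \<open>\<infinity>\<close>.\<close>

definition frac_norm_sq :: "real \<Rightarrow> (real \<Rightarrow> complex) \<Rightarrow> ennreal" where
  "frac_norm_sq \<sigma> u = L2_norm_sq u + (if \<sigma> = 0 then 0 else gagliardo_sq \<sigma> u)"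

primrec sobolev_norm_sq :: "nat \<Rightarrow> real \<Rightarrow> (real \<Rightarrow> complex) \<Rightarrow> ennreal" where
  "sobolev_norm_sq 0 = frac_norm_sq"
| "sobolev_norm_sq (Suc n) =
     (\<lambda>\<sigma> u. frac_norm_sq \<sigma> u + (INF v\<in>{v. has_weak_deriv u v}. sobolev_norm_sq n \<sigma> v))"

definition Hs_norm :: "real \<Rightarrow> (real \<Rightarrow> complex) \<Rightarrow> ennreal" where
  "Hs_norm s u =
     (let N = sobolev_norm_sq (nat \<lfloor>s\<rfloor>) (frac s) u
      in if N = \<infinity> then \<infinity> else ennreal (sqrt (enn2real N)))"

text \<open>\<open>v = g (\<partial>\<^sub>y / k - i t) u\<close>\<close>

definition shifted_deriv ::
    "(real \<Rightarrow> real) \<Rightarrow> real \<Rightarrow> real \<Rightarrow> (real \<Rightarrow> complex) \<Rightarrow> (real \<Rightarrow> complex) \<Rightarrow> bool" where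
  "shifted_deriv g k t u v \<longleftrightarrow>
     (\<exists>u'. has_weak_deriv u u' \<and>
        (AE y in lebesgue_on {0..1}.
           v y = of_real (g y) * (u' y / of_real k - \<i> * of_real t * u y)))"

text \<open>The Dirichlet problem \<open>(-1 + (g (\<partial>\<^sub>y / k - i t))\<^sup>2) \<Phi> = w\<close>. A function \<open>\<Phi>\<close> with a weak derivative
  has a continuous representative; \<open>\<Phi>\<close> is that representative, so its boundary values make sense.\<close>

definition stream_function ::
    "(real \<Rightarrow> real) \<Rightarrow> real \<Rightarrow> real \<Rightarrow> (real \<Rightarrow> complex) \<Rightarrow> (real \<Rightarrow> complex) \<Rightarrow> bool" where
  "stream_function g k t w \<Phi> \<longleftrightarrow>
     continuous_on {0..1} \<Phi> \<and> \<Phi> 0 = 0 \<and> \<Phi> 1 = 0 \<and>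
     (\<exists>\<Psi> X. shifted_deriv g k t \<Phi> \<Psi> \<and> shifted_deriv g k t \<Psi> X \<and>
        (AE y in lebesgue_on {0..1}. - \<Phi> y + X y = w y))"

text \<open>Differentiability in time of an \<open>L\<^sup>2\<close>-valued function on \<open>[0,\<infinity>)\<close> (one-sided at \<open>t = 0\<close>).\<close>

definition has_L2_time_derivative ::
    "(real \<Rightarrow> real \<Rightarrow> complex) \<Rightarrow> (real \<Rightarrow> complex) \<Rightarrow> real \<Rightarrow> bool" where
  "has_L2_time_derivative W V t \<longleftrightarrow>
     ((\<lambda>\<tau>. L2_norm_sq (\<lambda>y. (W \<tau> y - W t y) / of_real (\<tau> - t) - V y)) \<longlongrightarrow> 0) (at t within {0..})"

definition euler_solution ::
    "(real \<Rightarrow> real) \<Rightarrow> (real \<Rightarrow> real) \<Rightarrow> real \<Rightarrow> (real \<Rightarrow> complex) \<Rightarrow>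
     (real \<Rightarrow> real \<Rightarrow> complex) \<Rightarrow> (real \<Rightarrow> real \<Rightarrow> complex) \<Rightarrow> bool" where
  "euler_solution f g k \<omega>\<^sub>0 W \<Phi> \<longleftrightarrow>
     (\<forall>t\<ge>0. L2_norm_sq (W t) < \<infinity> \<and>
        stream_function g k t (W t) (\<Phi> t) \<and>
        has_L2_time_derivative W (\<lambda>y. \<i> * of_real (f y) / of_real k * \<Phi> t y) t) \<and>
     (\<forall>y\<in>{0..1}. W 0 y = \<omega>\<^sub>0 y)"

end

theory Submission
  imports Defs
begin

text \<open>
  Put \<open>\<Psi> = g (\<partial>\<^sub>y / k - i t) \<Phi>\<close>. The boundary values of \<open>\<Psi>\<close> are integrals of \<open>e\<^bsup>- i k t y\<^esup> W\<close> against an explicit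
  homogeneous solution. As \<open>W\<close> stays zero at the boundary, two integrations by parts and the Riemann--Lebesgue lemma
  give \<open>\<partial>\<^sub>y \<Phi> (t, 0) = t\<^sup>-\<^sup>2 (\<partial>\<^sub>y W (t, 0) / g (0)\<^sup>2 + o(1))\<close>, and the equation for \<open>\<Phi>\<close> then gives
  \<open>\<partial>\<^sub>t \<partial>\<^sub>y\<^sup>2 W (t, 0) = - t\<^sup>-\<^sup>1 (2 f (0) \<partial>\<^sub>y W (t, 0) / g (0)\<^sup>2 + o(1))\<close>. So \<open>\<partial>\<^sub>y\<^sup>2 W (t, 0)\<close> grows logarithmically
  unless \<open>f \<partial>\<^sub>y W\<close> tends to zero there, whereas \<open>H\<^sup>s\<close> with \<open>s > 5/2\<close> controls \<open>\<partial>\<^sub>y\<^sup>2 W\<close> uniformly, with a Hoelder modulus.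
  The other end follows from the reflection \<open>y \<mapsto> 1 - y\<close>, \<open>k \<mapsto> - k\<close>, \<open>f \<mapsto> - f\<close>.
\<close>

subsection \<open>Weak derivatives on the unit interval\<close>

text \<open>\<open>W\<close> is differentiable in time only as an L2-valued function, so its
  derivatives at an end point cannot be differentiated in time. Integrals over \<open>[0,h]\<close>
  replace them: plain ones to show that \<open>W\<close> stays zero there, and integrals against
  \<open>3 * y / h - 2\<close>, divided by \<open>h ^ 3\<close>, in place of the second derivative.
  The weight has to be orthogonal to \<open>y\<close>, because first order terms would otherwise
  diverge like 1/h. The approximation for small h is uniform only on bounded time intervals, since
  the bounds for the y-derivatives of \<Phi> contain powers of t. Logarithmic growth, however,
  already shows on a finite window, so the window is fixed first and h afterwards. In the
  Riemann--Lebesgue step the integrand varies with t together with the frequency. Decay therefore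
  needs a modulus of continuity of the second derivative common to all times. This is where s > 5/2
  is used: it gives Hoelder continuity with constants depending only on s and the norm bound. Weak
  derivatives and the L2 equations determine functions up to null sets, whereas the argument is
  pointwise at the boundary; hence the passage to continuous representatives.\<close>

abbreviation unit_measure :: "real measure" ("\<M>") where "\<M> \<equiv> lebesgue_on {0..1}"

lemma sets_unit: "{0..1::real} \<in> sets lebesgue" by simp

interpretation unit: finite_measure \<M>
  by (rule finite_measure_lebesgue_on) simp

lemma space_unit [simp]: "space \<M> = {0..1}" by (simp add: space_restrict_space)

lemma continuous_on_borel_unit:
  fixes u :: "real \<Rightarrow> 'b::{second_countable_topology, t2_space, real_normed_vector}"
  shows "continuous_on {0..1} u \<Longrightarrow> u \<in> borel_measurable \<M>"
  by (rule continuous_imp_measurable_on_sets_lebesgue) auto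

lemma continuous_on_bounded_unit:
  fixes u :: "real \<Rightarrow> 'b::real_normed_vector"
  assumes "continuous_on {0..1} u"
  obtains C where "\<And>x. x \<in> {0..1} \<Longrightarrow> norm (u x) \<le> C"
  using compact_imp_bounded[OF compact_continuous_image[OF assms compact_Icc]] bounded_iff by (metis imageI)

lemma integrable_mult_continuous:
  fixes v :: "real \<Rightarrow> real"
  assumes "integrable \<M> v" "continuous_on {0..1} \<psi>"
  shows "integrable \<M> (\<lambda>x. \<psi> x * v x)"
proof -
  obtain C where C: "\<And>x. x \<in> {0..1} \<Longrightarrow> norm (\<psi> x) \<le> C"
    using continuous_on_bounded_unit[OF assms(2)] by blast
  show ?thesis
  proof (rule Bochner_Integration.integrable_bound)
    show "integrable \<M> (\<lambda>x. C * v x)" using assms by simp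
    show "(\<lambda>x. \<psi> x * v x) \<in> borel_measurable \<M>"
      using assms continuous_on_borel_unit[OF assms(2)] by simp
    show "AE x in \<M>. norm (\<psi> x * v x) \<le> norm (C * v x)"
    proof (rule AE_I2)
      fix x assume "x \<in> space \<M>"
      then have "\<bar>\<psi> x\<bar> \<le> \<bar>C\<bar>" using C[of x] by simp
      then show "norm (\<psi> x * v x) \<le> norm (C * v x)" by (simp add: abs_mult mult_right_mono)
    qed
  qed
qed

lemma integrable_continuous_unit:
  fixes u :: "real \<Rightarrow> real"
  shows "continuous_on {0..1} u \<Longrightarrow> integrable \<M> u"
  using integrable_mult_continuous[of "\<lambda>x. 1" u] by simp

text \<open>These functions are the candidates for the derivative \<open>\<phi>'\<close> of a test
  function; mean zero is the one further condition, see \<open>test_function_of_mean_zero\<close>.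
  The support lies in a closed interval inside (0,1), so that an antiderivative is constant near
  both ends.\<close>

definition compactly_supported :: "(real \<Rightarrow> real) \<Rightarrow> bool" where
  "compactly_supported \<psi> \<longleftrightarrow> continuous_on UNIV \<psi> \<and> (\<exists>\<alpha> \<beta>. 0 < \<alpha> \<and> \<beta> < 1 \<and> (\<forall>x. x \<notin> {\<alpha>..\<beta>} \<longrightarrow> \<psi> x = 0))"

lemma compactly_supported_cont: "compactly_supported \<psi> \<Longrightarrow> continuous_on S \<psi>"
  unfolding compactly_supported_def using continuous_on_subset by blast

text \<open>Testing against \<open>sgn z\<close> would give the integral of
  \<open>\<bar>z x\<bar>\<close> at once. As \<open>sgn z\<close> is measurable, it is the limit,
  off a null set, of continuous functions. Clipped to [-1,1] and cut off near the ends these become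
  admissible, and dominated convergence shows that the integral of \<open>\<bar>z x\<bar>\<close> is
  0.\<close>

lemma orthogonal_compactly_supported_imp_AE_zero:
  fixes z :: "real \<Rightarrow> real"
  assumes z: "integrable \<M> z"
    and orth: "\<And>\<psi>. compactly_supported \<psi> \<Longrightarrow> (\<integral>x. \<psi> x * z x \<partial>\<M>) = 0"
  shows "AE x in \<M>. z x = 0"
proof -
  have zm: "z \<in> borel_measurable \<M>" using z by simp
  have "(\<lambda>x. sgn (z x)) \<in> borel_measurable \<M>" using zm by measurable
  then have "(\<lambda>x. sgn (z x)) measurable_on {0..1}"
    by (subst measurable_on_iff_borel_measurable) auto
  then obtain N G where N: "negligible N" and Gc: "\<And>n. continuous_on UNIV (G n)"
    and G: "\<And>x. x \<notin> N \<Longrightarrow> (\<lambda>n. G n x) \<longlonglongrightarrow> (if x \<in> {0..1} then sgn (z x) else 0)"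
    unfolding measurable_on_def by blast
  \<comment> \<open>Cutoff: 0 within distance 1/(n+1) of the end points, 1 from distance 2/(n+1)
    on.\<close>
  define \<theta> :: "nat \<Rightarrow> real \<Rightarrow> real" where "\<theta> n x = max 0 (min 1 (real (n + 1) * min x (1 - x) - 1))" for n x
  define \<psi> where "\<psi> n x = \<theta> n x * max (-1) (min 1 (G n x))" for n x
  have \<psi>_cs: "compactly_supported (\<psi> n)" for n
    unfolding compactly_supported_def
  proof (intro conjI exI allI impI)
    show "continuous_on UNIV (\<psi> n)"
      unfolding \<psi>_def \<theta>_def by (intro continuous_intros Gc)
    show "0 < 1 / real (n + 1)" "1 - 1 / real (n + 1) < 1" by auto
    fix x assume "x \<notin> {1 / real (n + 1)..1 - 1 / real (n + 1)}"
    then have "min x (1 - x) \<le> 1 / real (n + 1)" by auto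
    then have "real (n + 1) * min x (1 - x) \<le> real (n + 1) * (1 / real (n + 1))" by (intro mult_left_mono) auto
    then show "\<psi> n x = 0" by (simp add: \<psi>_def \<theta>_def)
  qed
  have \<psi>_le: "\<bar>\<psi> n x\<bar> \<le> 1" for n x
    unfolding \<psi>_def abs_mult by (rule mult_le_one) (auto simp: \<theta>_def)
  have N0: "AE x in \<M>. x \<notin> N \<union> {0, 1}"
  proof -
    have "negligible (N \<union> {0, 1})" using N by (auto intro: negligible_Un)
    then have "AE x in lebesgue. x \<notin> N \<union> {0, 1}" by (simp only: negligible_iff_null_sets AE_not_in)
    then show ?thesis by (subst AE_restrict_space_iff) (auto elim: eventually_mono)
  qed
  have lim: "(\<lambda>n. \<integral>x. \<psi> n x * z x \<partial>\<M>) \<longlonglongrightarrow> (\<integral>x. \<bar>z x\<bar> \<partial>\<M>)"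
  proof (rule integral_dominated_convergence[where w = "\<lambda>x. \<bar>z x\<bar>"])
    show "(\<lambda>x. \<bar>z x\<bar>) \<in> borel_measurable \<M>" using zm by measurable
    show "(\<lambda>x. \<psi> n x * z x) \<in> borel_measurable \<M>" for n
      using integrable_mult_continuous[OF z compactly_supported_cont[OF \<psi>_cs]] by simp
    show "integrable \<M> (\<lambda>x. \<bar>z x\<bar>)" using z by simp
    show "AE x in \<M>. norm (\<psi> n x * z x) \<le> \<bar>z x\<bar>" for n
      using \<psi>_le by (intro AE_I2) (simp add: abs_mult mult_left_le_one_le)
    show "AE x in \<M>. (\<lambda>n. \<psi> n x * z x) \<longlonglongrightarrow> \<bar>z x\<bar>"
      using N0 AE_space
    proof eventually_elim
      case (elim x)
      then have x: "0 < x" "x < 1" "x \<notin> N" by auto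
      have "eventually (\<lambda>n. real n \<ge> 2 / min x (1 - x)) sequentially"
        by (rule filterlim_at_top[THEN iffD1, OF filterlim_real_sequentially, rule_format])
      then have "eventually (\<lambda>n. \<theta> n x = 1) sequentially"
      proof eventually_elim
        case (elim n)
        have m: "min x (1 - x) > 0" using x by simp
        have "2 \<le> real n * min x (1 - x)" using elim m by (simp only: pos_divide_le_eq)
        also have "\<dots> \<le> real (n + 1) * min x (1 - x)" using m by (intro mult_right_mono) auto
        finally show ?case by (simp add: \<theta>_def)
      qed
      then have 1: "(\<lambda>n. \<theta> n x) \<longlonglongrightarrow> 1" by (rule tendsto_eventually)
      have "(\<lambda>n. max (-1) (min 1 (G n x))) \<longlonglongrightarrow> max (-1) (min 1 (sgn (z x)))"
        using G[OF x(3)] x by (intro tendsto_intros) simp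
      moreover have "max (-1) (min 1 (sgn (z x))) = sgn (z x)" by (simp add: sgn_if)
      ultimately have "(\<lambda>n. \<psi> n x * z x) \<longlonglongrightarrow> 1 * sgn (z x) * z x"
        unfolding \<psi>_def by (intro tendsto_intros 1) simp
      then show ?case by (simp add: abs_sgn mult.commute)
    qed
  qed
  have "(\<integral>x. \<bar>z x\<bar> \<partial>\<M>) = 0"
    using lim orth[OF \<psi>_cs] by (simp add: LIMSEQ_const_iff)
  then have "AE x in \<M>. \<bar>z x\<bar> = 0"
    using z by (subst (asm) integral_nonneg_eq_0_iff_AE) auto
  then show ?thesis by simp
qed

text \<open>The lemma of du Bois-Reymond. A fixed bump \<open>p\<close> with nonzero integral
  \<open>c\<close> turns any \<open>\<psi>\<close> into the mean-zero function
  \<open>\<psi> x - d * p x\<close>. Orthogonality to it says that \<open>z x - C\<close> is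
  orthogonal to \<open>\<psi>\<close>, where \<open>C\<close> is the \<open>p\<close>-weighted mean
  of \<open>z\<close>.\<close>

lemma orthogonal_mean_zero_imp_AE_const:
  fixes z :: "real \<Rightarrow> real"
  assumes z: "integrable \<M> z"
    and orth: "\<And>\<psi>. compactly_supported \<psi> \<Longrightarrow> (\<integral>x. \<psi> x \<partial>\<M>) = 0 \<Longrightarrow> (\<integral>x. \<psi> x * z x \<partial>\<M>) = 0"
  shows "\<exists>C. AE x in \<M>. z x = C"
proof -
  define p where "p x = max 0 (min (x - 1/4) (3/4 - x))" for x :: real
  have p_cs: "compactly_supported p"
    unfolding compactly_supported_def
  proof (intro conjI exI allI impI)
    show "continuous_on UNIV p" unfolding p_def by (intro continuous_intros)
    show "(0::real) < 1/4" "3/4 < (1::real)" by auto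
    show "p x = 0" if "x \<notin> {1/4..3/4}" for x using that by (auto simp: p_def)
  qed
  define c where "c = (\<integral>x. p x \<partial>\<M>)"
  have pint: "integrable \<M> p" by (rule integrable_continuous_unit[OF compactly_supported_cont[OF p_cs]])
  have c: "c \<noteq> 0"
  proof
    assume "c = 0"
    then have "(p has_integral 0) (cbox 0 1)"
      using has_integral_integral_lebesgue_on[OF pint sets_unit] by (simp add: c_def)
    then have "p (1/2) = 0"
      by (rule has_integral_0_cbox_imp_0[rotated 2]) (auto simp: p_def intro!: compactly_supported_cont[OF p_cs] continuous_intros)
    then show False by (simp add: p_def)
  qed
  define C where "C = (\<integral>x. p x * z x \<partial>\<M>) / c"
  have "AE x in \<M>. z x - C = 0"
  proof (rule orthogonal_compactly_supported_imp_AE_zero)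
    show "integrable \<M> (\<lambda>x. z x - C)" using z by simp
    fix \<psi> assume \<psi>: "compactly_supported \<psi>"
    define d where "d = (\<integral>x. \<psi> x \<partial>\<M>) / c"
    have \<psi>int: "integrable \<M> \<psi>" by (rule integrable_continuous_unit[OF compactly_supported_cont[OF \<psi>]])
    have i1: "integrable \<M> (\<lambda>x. \<psi> x * z x)" "integrable \<M> (\<lambda>x. p x * z x)"
      by (intro integrable_mult_continuous z compactly_supported_cont \<psi> p_cs)+
    have "compactly_supported (\<lambda>x. \<psi> x - d * p x)"
    proof -
      obtain a b a' b' where "0 < a" "b < 1" "\<forall>x. x \<notin> {a..b} \<longrightarrow> \<psi> x = 0" "0 < a'" "b' < 1" "\<forall>x. x \<notin> {a'..b'} \<longrightarrow> p x = 0"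
        using \<psi> p_cs unfolding compactly_supported_def by blast
      then have "0 < min a a'" "max b b' < 1" "\<psi> x - d * p x = 0" if "x \<notin> {min a a'..max b b'}" for x
        using that by (auto simp: min_le_iff_disj le_max_iff_disj)
      moreover have "continuous_on UNIV (\<lambda>x. \<psi> x - d * p x)"
        by (intro continuous_intros compactly_supported_cont \<psi> p_cs)
      moreover have "0 < min a a'" "max b b' < 1" using \<open>0 < a\<close> \<open>0 < a'\<close> \<open>b < 1\<close> \<open>b' < 1\<close> by auto
      ultimately show ?thesis
        unfolding compactly_supported_def by blast
    qed
    moreover have "(\<integral>x. \<psi> x - d * p x \<partial>\<M>) = 0"
      using \<psi>int pint c by (simp add: d_def c_def[symmetric])
    ultimately have "(\<integral>x. (\<psi> x - d * p x) * z x \<partial>\<M>) = 0" by (rule orth)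
    then have "(\<integral>x. \<psi> x * z x - d * (p x * z x) \<partial>\<M>) = 0" by (simp add: algebra_simps)
    then have "(\<integral>x. \<psi> x * z x \<partial>\<M>) = d * (\<integral>x. p x * z x \<partial>\<M>)" using i1 by simp
    also have "\<dots> = C * (\<integral>x. \<psi> x \<partial>\<M>)" using c by (simp add: d_def C_def)
    finally have "(\<integral>x. \<psi> x * z x \<partial>\<M>) - C * (\<integral>x. \<psi> x \<partial>\<M>) = 0" by simp
    then have "(\<integral>x. \<psi> x * z x - C * \<psi> x \<partial>\<M>) = 0" using i1 \<psi>int by simp
    then show "(\<integral>x. \<psi> x * (z x - C) \<partial>\<M>) = 0" by (simp add: algebra_simps)
  qed
  then show ?thesis by auto
qed

lemma integrable_on_Icc_of_unit:
  fixes v :: "real \<Rightarrow> 'b::euclidean_space"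
  assumes "integrable \<M> v" "0 \<le> a" "b \<le> 1"
  shows "v absolutely_integrable_on {a..b}" "v integrable_on {a..b}"
proof -
  have "set_integrable lebesgue {0..1} v"
    using assms(1) by (simp add: set_integrable_def integrable_restrict_space)
  then show "v absolutely_integrable_on {a..b}"
    by (rule absolutely_integrable_on_subinterval) (use assms in auto)
  then show "v integrable_on {a..b}" by (rule set_lebesgue_integral_eq_integral(1))
qed

lemma indefinite_integral_continuous_unit:
  fixes v :: "real \<Rightarrow> 'b::euclidean_space"
  assumes "integrable \<M> v"
  shows "continuous_on {0..1} (\<lambda>x. integral {0..x} v)"
  by (rule indefinite_integral_continuous_1) (rule integrable_on_Icc_of_unit[OF assms], auto)

text \<open>As \<open>v\<close> is merely integrable, its indefinite integral need not be
  differentiable everywhere. Instead, both sides are iterated integrals of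
  \<open>\<phi>' x * v y\<close> over the triangle y <= x, and Fubini exchanges the order. No
  boundary term appears because the indefinite integral is 0 at 0 and \<open>\<phi>\<close> is 0 at
  1.\<close>

lemma integral_by_parts_test_function:
  fixes v :: "real \<Rightarrow> real"
  assumes v: "integrable \<M> v"
    and \<phi>: "\<And>x. x \<in> {0..1} \<Longrightarrow> (\<phi> has_real_derivative \<phi>' x) (at x within {0..1})"
    and \<phi>': "continuous_on {0..1} \<phi>'" and "\<phi> 1 = 0"
  shows "(\<integral>x. \<phi>' x * integral {0..x} v \<partial>\<M>) = - (\<integral>x. \<phi> x * v x \<partial>\<M>)"
proof -
  interpret pair_sigma_finite \<M> \<M> ..
  obtain C where C: "\<And>x. x \<in> {0..1} \<Longrightarrow> norm (\<phi>' x) \<le> C" using continuous_on_bounded_unit[OF \<phi>'] by blast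
  let ?k = "\<lambda>x y. \<phi>' x * (indicat_real {..x} y * v y)"
  have vm [measurable]: "v \<in> borel_measurable \<M>" using v by simp
  have pm [measurable]: "\<phi>' \<in> borel_measurable \<M>" by (rule continuous_on_borel_unit[OF \<phi>'])
  have idm [measurable]: "(\<lambda>x. x) \<in> borel_measurable \<M>" by (rule continuous_on_borel_unit) (intro continuous_intros)
  have [measurable]: "(\<lambda>p. fst p) \<in> borel_measurable (\<M> \<Otimes>\<^sub>M \<M>)" "(\<lambda>p. snd p) \<in> borel_measurable (\<M> \<Otimes>\<^sub>M \<M>)"
    using measurable_compose[OF measurable_fst idm] measurable_compose[OF measurable_snd idm] by simp_all
  have ind: "(\<lambda>p. indicat_real {..fst p} (snd p)) \<in> borel_measurable (\<M> \<Otimes>\<^sub>M \<M>)"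
  proof -
    have "(\<lambda>p. if snd p \<le> fst p then 1 else 0 :: real) \<in> borel_measurable (\<M> \<Otimes>\<^sub>M \<M>)" by measurable
    then show ?thesis by (simp add: indicator_def of_bool_def if_distrib cong: if_cong)
  qed
  have vint2: "integrable (\<M> \<Otimes>\<^sub>M \<M>) (\<lambda>(x, y). C * v y)"
    by (rule Fubini_integrable) (use v in \<open>auto simp: split_beta'\<close>)
  have kint: "integrable (\<M> \<Otimes>\<^sub>M \<M>) (\<lambda>(x, y). ?k x y)"
  proof (rule Bochner_Integration.integrable_bound[OF vint2])
    show "(\<lambda>(x, y). ?k x y) \<in> borel_measurable (\<M> \<Otimes>\<^sub>M \<M>)"
      using ind by (simp add: split_beta')
    show "AE p in \<M> \<Otimes>\<^sub>M \<M>. norm (case p of (x, y) \<Rightarrow> ?k x y) \<le> norm (case p of (x, y) \<Rightarrow> C * v y)"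
    proof (rule AE_I2)
      fix p assume "p \<in> space (\<M> \<Otimes>\<^sub>M \<M>)"
      then have "\<bar>\<phi>' (fst p)\<bar> \<le> \<bar>C\<bar>" using C[of "fst p"] by (auto simp: space_pair_measure)
      then have "\<bar>\<phi>' (fst p)\<bar> * (indicat_real {..fst p} (snd p) * \<bar>v (snd p)\<bar>) \<le> \<bar>C\<bar> * \<bar>v (snd p)\<bar>"
        by (intro mult_mono) (auto simp: indicator_def)
      then show "norm (case p of (x, y) \<Rightarrow> ?k x y) \<le> norm (case p of (x, y) \<Rightarrow> C * v y)"
        by (simp add: split_beta' abs_mult)
    qed
  qed
  have inner1: "(\<integral>y. ?k x y \<partial>\<M>) = \<phi>' x * integral {0..x} v" if x: "x \<in> {0..1}" for x
  proof -
    have i: "integrable \<M> (\<lambda>y. indicat_real {..x} y * v y)"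
      using v by (intro Bochner_Integration.integrable_bound[OF v]) (auto simp: indicator_def split_beta')
    have "(\<integral>y. indicat_real {..x} y * v y \<partial>\<M>) = integral {0..1} (\<lambda>y. indicat_real {..x} y * v y)"
      by (rule lebesgue_integral_eq_integral[OF i]) simp
    also have "\<dots> = integral {0..1} (\<lambda>y. if y \<in> {0..x} then v y else 0)"
      by (rule Henstock_Kurzweil_Integration.integral_cong) (auto simp: indicator_def)
    also have "\<dots> = integral {0..x} v"
      using x by (subst integral_restrict_Int) (auto intro!: arg_cong2[where f = integral])
    finally show ?thesis by simp
  qed
  have inner2: "(\<integral>x. ?k x y \<partial>\<M>) = - (\<phi> y * v y)" if y: "y \<in> {0..1}" for y
  proof -
    have i: "integrable \<M> (\<lambda>x. indicat_real {y..} x * \<phi>' x)"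
      using integrable_continuous_unit[OF \<phi>']
      by (intro Bochner_Integration.integrable_bound[OF integrable_continuous_unit[OF \<phi>']]) (auto simp: indicator_def)
    have "(\<integral>x. indicat_real {y..} x * \<phi>' x \<partial>\<M>) = integral {0..1} (\<lambda>x. indicat_real {y..} x * \<phi>' x)"
      by (rule lebesgue_integral_eq_integral[OF i]) simp
    also have "\<dots> = integral {0..1} (\<lambda>x. if x \<in> {y..1} then \<phi>' x else 0)"
      by (rule Henstock_Kurzweil_Integration.integral_cong) (auto simp: indicator_def)
    also have "\<dots> = integral {y..1} \<phi>'"
      using y by (subst integral_restrict_Int) (auto intro!: arg_cong2[where f = integral])
    also have "\<dots> = \<phi> 1 - \<phi> y"
      using y by (intro integral_unique fundamental_theorem_of_calculus)
        (auto simp: has_real_derivative_iff_has_vector_derivative[symmetric] intro!: DERIV_subset[OF \<phi>])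
    finally have *: "(\<integral>x. indicat_real {y..} x * \<phi>' x \<partial>\<M>) = - \<phi> y" using \<open>\<phi> 1 = 0\<close> by simp
    have "(\<integral>x. ?k x y \<partial>\<M>) = (\<integral>x. (indicat_real {y..} x * \<phi>' x) * v y \<partial>\<M>)"
      by (rule Bochner_Integration.integral_cong) (auto simp: indicator_def)
    also have "\<dots> = - \<phi> y * v y" using * by simp
    finally show ?thesis by simp
  qed
  have "(\<integral>x. \<phi>' x * integral {0..x} v \<partial>\<M>) = (\<integral>x. (\<integral>y. ?k x y \<partial>\<M>) \<partial>\<M>)"
    by (rule Bochner_Integration.integral_cong[OF refl inner1[symmetric]]) simp
  also have "\<dots> = (\<integral>y. (\<integral>x. ?k x y \<partial>\<M>) \<partial>\<M>)"
    by (rule Fubini_integral[symmetric]) (use kint in simp)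
  also have "\<dots> = (\<integral>y. - (\<phi> y * v y) \<partial>\<M>)"
    by (rule Bochner_Integration.integral_cong[OF refl inner2]) simp
  finally show ?thesis by simp
qed

text \<open>The antiderivative is constant on each side of the support of \<open>\<psi>\<close>, and
  mean zero makes the two constants agree; subtracting the common value leaves a compactly supported
  function.\<close>

lemma test_function_of_mean_zero:
  assumes \<psi>: "compactly_supported \<psi>" and mean: "(\<integral>x. \<psi> x \<partial>\<M>) = 0"
  obtains \<phi> where "test_function_deriv \<phi> \<psi>" "\<phi> 1 = 0"
proof -
  obtain \<alpha> \<beta> where ab: "0 < \<alpha>" "\<beta> < 1" and supp: "\<And>x. x \<notin> {\<alpha>..\<beta>} \<Longrightarrow> \<psi> x = 0"
    using \<psi> unfolding compactly_supported_def by blast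
  have cont: "continuous_on UNIV \<psi>" using \<psi> unfolding compactly_supported_def by blast
  have "\<exists>F. \<forall>x :: real. -\<infinity> < ereal x \<longrightarrow> ereal x < \<infinity> \<longrightarrow> (F has_vector_derivative \<psi> x) (at x)"
    by (rule einterval_antiderivative) (use cont in \<open>auto simp: continuous_on_eq_continuous_at\<close>)
  then obtain F where F: "\<And>x. (F has_real_derivative \<psi> x) (at x)"
    by (auto simp: has_real_derivative_iff_has_vector_derivative)
  have "(\<psi> has_integral (F 1 - F 0)) {0..1}"
    by (rule fundamental_theorem_of_calculus)
      (auto simp: has_real_derivative_iff_has_vector_derivative[symmetric] intro: DERIV_subset[OF F])
  moreover have "(\<psi> has_integral 0) {0..1}"
    using has_integral_integral_lebesgue_on[OF integrable_continuous_unit[OF compactly_supported_cont[OF \<psi>]] sets_unit] mean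
    by simp
  ultimately have "F 1 - F 0 = 0" by (rule has_integral_unique)
  then have F10: "F 1 = F 0" by simp
  have cst: "F x = F y" if "x \<le> y" "\<And>z. x \<le> z \<Longrightarrow> z \<le> y \<Longrightarrow> z \<notin> {\<alpha>..\<beta>}" for x y
  proof (cases "x = y")
    case False
    then have "x < y" using that by simp
    then obtain z where "x < z" "z < y" "F y - F x = (y - x) * \<psi> z" using MVT2[of x y F \<psi>] F by blast
    then show ?thesis using supp that(2)[of z] by simp
  qed simp
  show ?thesis
  proof (rule that[of "\<lambda>x. F x - F 0"])
    show "test_function_deriv (\<lambda>x. F x - F 0) \<psi>"
      unfolding test_function_deriv_def
    proof (intro conjI exI allI impI)
      show "((\<lambda>x. F x - F 0) has_real_derivative \<psi> x) (at x)" for x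
        using DERIV_diff[OF F DERIV_const] by simp
      show "continuous_on UNIV \<psi>" by (rule cont)
      show "compact {\<alpha>..\<beta>}" by simp
      show "{\<alpha>..\<beta>} \<subseteq> {0<..<1}" using ab by auto
      fix x assume x: "x \<notin> {\<alpha>..\<beta>}"
      consider "x < \<alpha>" | "x > \<beta>" using x by fastforce
      then show "F x - F 0 = 0"
      proof cases
        case 1
        then show ?thesis using cst[of x 0] cst[of 0 x] ab by (cases "x \<le> 0") auto
      next
        case 2
        then show ?thesis using cst[of x 1] cst[of 1 x] ab F10 by (cases "x \<le> 1") auto
      qed
    qed
    show "F 1 - F 0 = 0" using F10 by simp
  qed
qed

text \<open>Every mean-zero \<open>\<psi>\<close> is the derivative of a test function. The weak
  derivative and integration by parts therefore make the difference of \<open>u\<close> and the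
  indefinite integral of \<open>v\<close> orthogonal to all such \<open>\<psi>\<close>, and the
  difference is constant almost everywhere.\<close>

lemma weak_deriv_imp_AE_indefinite_integral_real:
  fixes u v :: "real \<Rightarrow> real"
  assumes "has_weak_deriv u v"
  shows "\<exists>C. AE x in \<M>. u x = C + integral {0..x} v"
proof -
  have u: "integrable \<M> u" and v: "integrable \<M> v" using assms by (auto simp: has_weak_deriv_def)
  have V: "integrable \<M> (\<lambda>x. integral {0..x} v)"
    by (rule integrable_continuous_unit[OF indefinite_integral_continuous_unit[OF v]])
  have "\<exists>C. AE x in \<M>. u x - integral {0..x} v = C"
  proof (rule orthogonal_mean_zero_imp_AE_const)
    show "integrable \<M> (\<lambda>x. u x - integral {0..x} v)" using u V by simp
    fix \<psi> assume \<psi>: "compactly_supported \<psi>" "(\<integral>x. \<psi> x \<partial>\<M>) = 0"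
    obtain \<phi> where \<phi>: "test_function_deriv \<phi> \<psi>" "\<phi> 1 = 0" using test_function_of_mean_zero[OF \<psi>] by blast
    have d: "(\<phi> has_real_derivative \<psi> x) (at x)" for x using \<phi>(1) by (auto simp: test_function_deriv_def)
    have "(\<integral>x. \<psi> x * u x \<partial>\<M>) = - (\<integral>x. \<phi> x * v x \<partial>\<M>)"
      using assms \<phi>(1) by (auto simp: has_weak_deriv_def)
    also have "\<dots> = (\<integral>x. \<psi> x * integral {0..x} v \<partial>\<M>)"
      using compactly_supported_cont[OF \<psi>(1)]
      by (intro integral_by_parts_test_function[symmetric] v \<phi>(2)) (auto intro: DERIV_subset[OF d])
    finally show "(\<integral>x. \<psi> x * (u x - integral {0..x} v) \<partial>\<M>) = 0"
      using integrable_mult_continuous[OF u compactly_supported_cont[OF \<psi>(1)]]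
        integrable_mult_continuous[OF V compactly_supported_cont[OF \<psi>(1)]]
      by (simp add: right_diff_distrib)
  qed
  then obtain C where "AE x in \<M>. u x - integral {0..x} v = C" ..
  then show ?thesis by (intro exI[of _ C]) (auto elim: eventually_mono)
qed

lemma weak_deriv_bounded_linear:
  assumes "has_weak_deriv u v" "bounded_linear T"
  shows "has_weak_deriv (\<lambda>x. T (u x)) (\<lambda>x. T (v x))"
proof -
  interpret T: bounded_linear T by fact
  have u: "integrable \<M> u" and v: "integrable \<M> v" using assms by (auto simp: has_weak_deriv_def)
  have *: "(\<integral>x. \<psi> x *\<^sub>R T (w x) \<partial>\<M>) = T (\<integral>x. \<psi> x *\<^sub>R w x \<partial>\<M>)"
    if "continuous_on UNIV \<psi>" and w: "integrable \<M> w" for \<psi> w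
  proof -
    have c: "continuous_on {0..1} \<psi>" using that continuous_on_subset by blast
    obtain C where C: "\<And>x. x \<in> {0..1} \<Longrightarrow> norm (\<psi> x) \<le> C" using continuous_on_bounded_unit[OF c] by blast
    have "integrable \<M> (\<lambda>x. \<psi> x *\<^sub>R w x)"
    proof (rule Bochner_Integration.integrable_bound)
      show "integrable \<M> (\<lambda>x. C *\<^sub>R w x)" using w by simp
      show "(\<lambda>x. \<psi> x *\<^sub>R w x) \<in> borel_measurable \<M>"
        using w continuous_on_borel_unit[OF c] by simp
      show "AE x in \<M>. norm (\<psi> x *\<^sub>R w x) \<le> norm (C *\<^sub>R w x)"
      proof (rule AE_I2)
        fix x assume "x \<in> space \<M>"
        then have "\<bar>\<psi> x\<bar> \<le> \<bar>C\<bar>" using C[of x] by simp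
        then show "norm (\<psi> x *\<^sub>R w x) \<le> norm (C *\<^sub>R w x)" by (simp add: mult_right_mono)
      qed
    qed
    from integral_bounded_linear[OF assms(2) this] show ?thesis by (simp add: T.scaleR)
  qed
  show ?thesis
    unfolding has_weak_deriv_def
  proof (intro conjI allI impI)
    show "integrable \<M> (\<lambda>x. T (u x))" "integrable \<M> (\<lambda>x. T (v x))"
      using integrable_bounded_linear[OF assms(2)] u v by auto
    fix \<phi> \<phi>' assume t: "test_function_deriv \<phi> \<phi>'"
    then have "continuous_on UNIV \<phi>'" and "continuous_on UNIV \<phi>"
      by (auto simp: test_function_deriv_def continuous_on_eq_continuous_at intro: DERIV_isCont)
    then show "(\<integral>x. \<phi>' x *\<^sub>R T (u x) \<partial>\<M>) = - (\<integral>x. \<phi> x *\<^sub>R T (v x) \<partial>\<M>)"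
      using assms(1) t u v by (simp add: * has_weak_deriv_def linear_neg[OF bounded_linear.linear[OF assms(2)]])
  qed
qed

lemma weak_deriv_imp_AE_indefinite_integral:
  fixes u v :: "real \<Rightarrow> complex"
  assumes "has_weak_deriv u v"
  shows "\<exists>C. AE x in \<M>. u x = C + integral {0..x} v"
proof -
  have v: "integrable \<M> v" using assms by (auto simp: has_weak_deriv_def)
  obtain C where C: "AE x in \<M>. Re (u x) = C + integral {0..x} (\<lambda>x. Re (v x))"
    using weak_deriv_imp_AE_indefinite_integral_real[OF weak_deriv_bounded_linear[OF assms bounded_linear_Re]] ..
  obtain D where D: "AE x in \<M>. Im (u x) = D + integral {0..x} (\<lambda>x. Im (v x))"
    using weak_deriv_imp_AE_indefinite_integral_real[OF weak_deriv_bounded_linear[OF assms bounded_linear_Im]] ..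
  have "AE x in \<M>. u x = Complex C D + integral {0..x} v"
    using C D AE_space
  proof eventually_elim
    case (elim x)
    have "v integrable_on {0..x}" using elim by (intro integrable_on_Icc_of_unit[OF v]) auto
    from integral_linear[OF this bounded_linear_Re] integral_linear[OF this bounded_linear_Im] elim
    show ?case by (simp add: complex_eq_iff o_def)
  qed
  then show ?thesis ..
qed

subsection \<open>Uniformly equicontinuous families and the Riemann--Lebesgue lemma\<close>

text \<open>Bound and modulus of continuity are common to all parameters in \<open>X\<close>. Later
  \<open>X\<close> is \<open>{0..}\<close> for \<open>W\<close> and its derivatives, but
  \<open>{0..T}\<close> for the stream function.\<close>

definition bdd_equicontinuous :: "'i set \<Rightarrow> ('i \<Rightarrow> real \<Rightarrow> complex) \<Rightarrow> bool" where
  "bdd_equicontinuous X h \<longleftrightarrow>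
     (\<exists>C. \<forall>t\<in>X. \<forall>x\<in>{0..1}. norm (h t x) \<le> C) \<and>
     (\<forall>\<epsilon>>0. \<exists>\<delta>>0. \<forall>t\<in>X. \<forall>x\<in>{0..1}. \<forall>y\<in>{0..1}. \<bar>x - y\<bar> < \<delta> \<longrightarrow> norm (h t x - h t y) < \<epsilon>)"

lemma bdd_equicontinuousI:
  assumes "\<And>t x. t \<in> X \<Longrightarrow> x \<in> {0..1} \<Longrightarrow> norm (h t x) \<le> C"
    and "\<And>\<epsilon>. \<epsilon> > 0 \<Longrightarrow> \<exists>\<delta>>0. \<forall>t\<in>X. \<forall>x\<in>{0..1}. \<forall>y\<in>{0..1}. \<bar>x - y\<bar> < \<delta> \<longrightarrow> norm (h t x - h t y) < \<epsilon>"
  shows "bdd_equicontinuous X h"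
  using assms unfolding bdd_equicontinuous_def by blast

lemma bdd_equicontinuous_bound:
  assumes "bdd_equicontinuous X h"
  obtains C where "C > 0" "\<And>t x. t \<in> X \<Longrightarrow> x \<in> {0..1} \<Longrightarrow> norm (h t x) \<le> C"
proof -
  from assms obtain C where C: "\<forall>t\<in>X. \<forall>x\<in>{0..1}. norm (h t x) \<le> C"
    unfolding bdd_equicontinuous_def by blast
  show ?thesis
    by (rule that[of "max 1 C"]) (use C in \<open>auto simp: le_max_iff_disj\<close>)
qed

lemma bdd_equicontinuous_modulus:
  assumes "bdd_equicontinuous X h" "\<epsilon> > 0"
  obtains \<delta> where "\<delta> > 0" "\<And>t x y. t \<in> X \<Longrightarrow> x \<in> {0..1} \<Longrightarrow> y \<in> {0..1} \<Longrightarrow> \<bar>x - y\<bar> < \<delta>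
    \<Longrightarrow> norm (h t x - h t y) < \<epsilon>"
  using assms unfolding bdd_equicontinuous_def by metis

lemma bdd_equicontinuous_subset:
  "bdd_equicontinuous X h \<Longrightarrow> Y \<subseteq> X \<Longrightarrow> bdd_equicontinuous Y h"
  unfolding bdd_equicontinuous_def by (meson subsetD)

lemma bdd_equicontinuous_add:
  assumes u: "bdd_equicontinuous X u" and v: "bdd_equicontinuous X v"
  shows "bdd_equicontinuous X (\<lambda>t y. u t y + v t y)"
proof -
  obtain C where C: "C > 0" "\<And>t x. t \<in> X \<Longrightarrow> x \<in> {0..1} \<Longrightarrow> norm (u t x) \<le> C"
    using bdd_equicontinuous_bound[OF u] by blast
  obtain D where D: "D > 0" "\<And>t x. t \<in> X \<Longrightarrow> x \<in> {0..1} \<Longrightarrow> norm (v t x) \<le> D"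
    using bdd_equicontinuous_bound[OF v] by blast
  show ?thesis
  proof (rule bdd_equicontinuousI)
    show "norm (u t x + v t x) \<le> C + D" if "t \<in> X" "x \<in> {0..1}" for t x
      using C D that by (meson add_mono norm_triangle_le)
    fix \<epsilon> :: real assume "\<epsilon> > 0"
    then have "\<epsilon>/2 > 0" by simp
    obtain d where d: "d > 0" "\<And>t x y. t \<in> X \<Longrightarrow> x \<in> {0..1} \<Longrightarrow> y \<in> {0..1} \<Longrightarrow> \<bar>x - y\<bar> < d
        \<Longrightarrow> norm (u t x - u t y) < \<epsilon>/2"
      using bdd_equicontinuous_modulus[OF u \<open>\<epsilon>/2 > 0\<close>] by blast
    obtain e where e: "e > 0" "\<And>t x y. t \<in> X \<Longrightarrow> x \<in> {0..1} \<Longrightarrow> y \<in> {0..1} \<Longrightarrow> \<bar>x - y\<bar> < e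
        \<Longrightarrow> norm (v t x - v t y) < \<epsilon>/2"
      using bdd_equicontinuous_modulus[OF v \<open>\<epsilon>/2 > 0\<close>] by blast
    show "\<exists>\<delta>>0. \<forall>t\<in>X. \<forall>x\<in>{0..1}. \<forall>y\<in>{0..1}. \<bar>x - y\<bar> < \<delta> \<longrightarrow>
        norm (u t x + v t x - (u t y + v t y)) < \<epsilon>"
    proof (rule exI[of _ "min d e"], intro conjI ballI impI)
      fix t x y assume *: "t \<in> X" "x \<in> {0..1}" "y \<in> {0..1}" "\<bar>x - y\<bar> < min d e"
      have "norm (u t x - u t y) + norm (v t x - v t y) < \<epsilon>"
        using d(2)[of t x y] e(2)[of t x y] * by simp
      then show "norm (u t x + v t x - (u t y + v t y)) < \<epsilon>"
        by (smt (verit) add_diff_add norm_triangle_ineq)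
    qed (use d e in auto)
  qed
qed

lemma bdd_equicontinuous_mult:
  assumes u: "bdd_equicontinuous X u" and v: "bdd_equicontinuous X v"
  shows "bdd_equicontinuous X (\<lambda>t y. u t y * v t y)"
proof -
  obtain C where C: "C > 0" "\<And>t x. t \<in> X \<Longrightarrow> x \<in> {0..1} \<Longrightarrow> norm (u t x) \<le> C"
    using bdd_equicontinuous_bound[OF u] by blast
  obtain D where D: "D > 0" "\<And>t x. t \<in> X \<Longrightarrow> x \<in> {0..1} \<Longrightarrow> norm (v t x) \<le> D"
    using bdd_equicontinuous_bound[OF v] by blast
  show ?thesis
  proof (rule bdd_equicontinuousI)
    show "norm (u t x * v t x) \<le> C * D" if "t \<in> X" "x \<in> {0..1}" for t x
      using C D that by (auto simp: norm_mult intro!: mult_mono)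
    fix \<epsilon> :: real assume "\<epsilon> > 0"
    then have e1: "\<epsilon>/(2*D) > 0" and e2: "\<epsilon>/(2*C) > 0" using C D by auto
    obtain d where d: "d > 0" "\<And>t x y. t \<in> X \<Longrightarrow> x \<in> {0..1} \<Longrightarrow> y \<in> {0..1} \<Longrightarrow> \<bar>x - y\<bar> < d
        \<Longrightarrow> norm (u t x - u t y) < \<epsilon>/(2*D)"
      using bdd_equicontinuous_modulus[OF u e1] by blast
    obtain e where e: "e > 0" "\<And>t x y. t \<in> X \<Longrightarrow> x \<in> {0..1} \<Longrightarrow> y \<in> {0..1} \<Longrightarrow> \<bar>x - y\<bar> < e
        \<Longrightarrow> norm (v t x - v t y) < \<epsilon>/(2*C)"
      using bdd_equicontinuous_modulus[OF v e2] by blast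
    show "\<exists>\<delta>>0. \<forall>t\<in>X. \<forall>x\<in>{0..1}. \<forall>y\<in>{0..1}. \<bar>x - y\<bar> < \<delta> \<longrightarrow>
        norm (u t x * v t x - (u t y * v t y)) < \<epsilon>"
    proof (rule exI[of _ "min d e"], intro conjI ballI impI)
      fix t x y assume *: "t \<in> X" "x \<in> {0..1}" "y \<in> {0..1}" "\<bar>x - y\<bar> < min d e"
      have "u t x * v t x - (u t y * v t y) = u t x * (v t x - v t y) + (u t x - u t y) * v t y"
        by (simp add: algebra_simps)
      then have "norm (u t x * v t x - (u t y * v t y))
          \<le> norm (u t x) * norm (v t x - v t y) + norm (u t x - u t y) * norm (v t y)"
        by (metis norm_mult norm_triangle_ineq)
      also have "\<dots> \<le> C * norm (v t x - v t y) + norm (u t x - u t y) * D"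
        using C D * by (intro add_mono mult_right_mono mult_left_mono) auto
      also have "\<dots> < C * (\<epsilon>/(2*C)) + \<epsilon>/(2*D) * D"
        using C D d(2)[of t x y] e(2)[of t x y] * by (intro add_strict_mono mult_strict_left_mono mult_strict_right_mono) auto
      also have "\<dots> = \<epsilon>" using C D by simp
      finally show "norm (u t x * v t x - (u t y * v t y)) < \<epsilon>" .
    qed (use d e in auto)
  qed
qed

lemma bdd_equicontinuous_const:
  assumes "continuous_on {0..1} u"
  shows "bdd_equicontinuous X (\<lambda>t. u)"
proof -
  have "uniformly_continuous_on {0..1} u"
    using assms by (simp add: compact_uniformly_continuous)
  moreover obtain C where "\<forall>x\<in>{0..1}. norm (u x) \<le> C"
    using compact_imp_bounded[OF compact_continuous_image[OF assms compact_Icc]] bounded_iff by (metis imageI)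
  ultimately show ?thesis
    unfolding bdd_equicontinuous_def uniformly_continuous_on_def dist_norm
    by (metis norm_minus_commute real_norm_def)
qed

lemma bdd_equicontinuous_param:
  assumes "\<And>t. t \<in> X \<Longrightarrow> norm (u t) \<le> C"
  shows "bdd_equicontinuous X (\<lambda>t y. u t)"
  unfolding bdd_equicontinuous_def using assms by (auto intro: exI[of _ 1])

lemma norm_diff_le_of_vector_derivative:
  fixes h :: "real \<Rightarrow> complex"
  assumes "a \<le> b" and "\<And>x. x \<in> {a..b} \<Longrightarrow> (h has_vector_derivative h' x) (at x within {a..b})"
    and "\<And>x. x \<in> {a..b} \<Longrightarrow> norm (h' x) \<le> B"
  shows "norm (h b - h a) \<le> B * (b - a)"
proof (cases "a = b")
  case False
  have "norm (h b - h a) \<le> B * norm (b - a)"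
  proof (rule differentiable_bound[of "{a..b}" h "\<lambda>x d. d *\<^sub>R h' x" B b a])
    show "(h has_derivative (\<lambda>d. d *\<^sub>R h' x)) (at x within {a..b})" if "x \<in> {a..b}" for x
      using assms(2)[OF that] by (simp add: has_vector_derivative_def)
    show "onorm (\<lambda>d. d *\<^sub>R h' x) \<le> B" if "x \<in> {a..b}" for x
      using assms(3)[OF that] by (intro onorm_le) (metis mult.commute mult_right_mono norm_ge_zero norm_scaleR real_norm_def)
  qed (use assms in auto)
  then show ?thesis using assms(1) by simp
qed simp

lemma bdd_equicontinuous_of_derivative:
  assumes "\<And>t y. t \<in> X \<Longrightarrow> y \<in> {0..1} \<Longrightarrow> (h t has_vector_derivative h' t y) (at y within {0..1})"
    and "\<And>t y. t \<in> X \<Longrightarrow> y \<in> {0..1} \<Longrightarrow> norm (h t y) \<le> C"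
    and "\<And>t y. t \<in> X \<Longrightarrow> y \<in> {0..1} \<Longrightarrow> norm (h' t y) \<le> D"
  shows "bdd_equicontinuous X h"
proof -
  have *: "norm (h t y - h t x) \<le> D * (y - x)" if "t \<in> X" "0 \<le> x" "x \<le> y" "y \<le> 1" for t x y
    using that by (intro norm_diff_le_of_vector_derivative[of x y "h t" "h' t"])
      (auto intro!: assms(3) has_vector_derivative_within_subset[OF assms(1)])
  have **: "norm (h t x - h t y) \<le> \<bar>D\<bar> * \<bar>x - y\<bar>" if "t \<in> X" "x \<in> {0..1}" "y \<in> {0..1}" for t x y
    using *[of t x y] *[of t y x] that
    by (smt (verit) atLeastAtMost_iff norm_minus_commute mult_right_mono)
  show ?thesis
  proof (rule bdd_equicontinuousI[OF assms(2)])
    fix \<epsilon> :: real assume "\<epsilon> > 0"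
    show "\<exists>\<delta>>0. \<forall>t\<in>X. \<forall>x\<in>{0..1}. \<forall>y\<in>{0..1}. \<bar>x - y\<bar> < \<delta> \<longrightarrow> norm (h t x - h t y) < \<epsilon>"
    proof (rule exI[of _ "\<epsilon> / (\<bar>D\<bar> + 1)"], intro conjI ballI impI)
      show "\<epsilon> / (\<bar>D\<bar> + 1) > 0" using \<open>\<epsilon> > 0\<close> by simp
      fix t x y assume a: "t \<in> X" "x \<in> {0..1}" "y \<in> {0..1}" "\<bar>x - y\<bar> < \<epsilon> / (\<bar>D\<bar> + 1)"
      have "\<bar>x - y\<bar> * (\<bar>D\<bar> + 1) < \<epsilon>" using a(4) by (simp add: pos_less_divide_eq)
      then show "norm (h t x - h t y) < \<epsilon>" using **[OF a(1-3)] by (simp add: algebra_simps)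
    qed
  qed
qed

lemma bdd_equicontinuous_continuous_on:
  assumes "bdd_equicontinuous X h" "t \<in> X"
  shows "continuous_on {0..1} (h t)"
  unfolding continuous_on_iff dist_norm
proof (intro ballI allI impI)
  fix x :: real and e :: real assume x: "x \<in> {0..1}" "e > 0"
  obtain d where "d > 0" "\<And>t x y. t \<in> X \<Longrightarrow> x \<in> {0..1} \<Longrightarrow> y \<in> {0..1} \<Longrightarrow> \<bar>x - y\<bar> < d
        \<Longrightarrow> norm (h t x - h t y) < e"
    using bdd_equicontinuous_modulus[OF assms(1) x(2)] by blast
  then show "\<exists>d>0. \<forall>x'\<in>{0..1}. norm (x' - x) < d \<longrightarrow> norm (h t x' - h t x) < e"
    using x assms(2) by (metis real_norm_def)
qed

lemma has_vector_derivative_real: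
  "(u has_real_derivative u') (at y within S) \<Longrightarrow> ((\<lambda>y. complex_of_real (u y)) has_vector_derivative of_real u') (at y within S)"
  by (intro has_vector_derivative_of_real) (simp add: has_real_derivative_iff_has_vector_derivative)

definition phase :: "real \<Rightarrow> real \<Rightarrow> complex" where
  "phase \<mu> y = exp (- \<i> * of_real \<mu> * of_real y)"

lemma norm_phase [simp]: "norm (phase \<mu> y) = 1"
  by (simp add: phase_def norm_exp_eq_Re)

lemma phase_0 [simp]: "phase \<mu> 0 = 1"
  by (simp add: phase_def)

lemma phase_deriv:
  "((\<lambda>y. phase \<mu> y) has_vector_derivative (- \<i> * of_real \<mu> * phase \<mu> y)) (at y within S)"
  unfolding phase_def
  by (rule has_vector_derivative_real_field) (auto intro!: derivative_eq_intros)

lemma continuous_on_phase [continuous_intros]: "continuous_on S (phase \<mu>)"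
  unfolding phase_def by (intro continuous_intros)

lemma norm_integral_phase:
  assumes "a \<le> b" "\<mu> \<noteq> 0"
  shows "norm (integral {a..b} (phase \<mu>)) \<le> 2 / \<bar>\<mu>\<bar>"
proof -
  have "(phase \<mu> has_integral (\<i> / of_real \<mu> * phase \<mu> b - \<i> / of_real \<mu> * phase \<mu> a)) {a..b}"
    by (rule fundamental_theorem_of_calculus[OF assms(1)])
      (auto intro!: derivative_eq_intros phase_deriv simp: assms)
  then have "integral {a..b} (phase \<mu>) = \<i> / of_real \<mu> * (phase \<mu> b - phase \<mu> a)"
    by (simp add: integral_unique right_diff_distrib)
  moreover have "norm (phase \<mu> b - phase \<mu> a) \<le> 2"
    using norm_triangle_ineq4[of "phase \<mu> b" "phase \<mu> a"] by simp
  ultimately show ?thesis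
    by (simp add: norm_mult norm_divide divide_right_mono)
qed

text \<open>On each of \<open>n\<close> short intervals \<open>h t\<close> is replaced by its left
  end value, at a total cost of \<open>\<epsilon> / 2\<close> by equicontinuity; what remains are
  integrals of the phase alone, each at most \<open>2 / \<bar>\<mu>\<bar>\<close>. The threshold
  depends only on the common bound and modulus, so it serves all \<open>t\<close> at once, also when
  \<open>\<mu>\<close> and \<open>t\<close> are tied together as in
  \<open>J_tendsto_0\<close>.\<close>

lemma riemann_lebesgue_uniform:
  assumes h: "bdd_equicontinuous X h" and "\<epsilon> > 0"
  obtains \<Lambda> where "\<Lambda> > 0" "\<And>\<mu> t. \<bar>\<mu>\<bar> \<ge> \<Lambda> \<Longrightarrow> t \<in> X \<Longrightarrow>
    norm (integral {0..1} (\<lambda>y. phase \<mu> y * h t y)) \<le> \<epsilon>"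
proof -
  obtain C where C: "C > 0" "\<And>t x. t \<in> X \<Longrightarrow> x \<in> {0..1} \<Longrightarrow> norm (h t x) \<le> C"
    using bdd_equicontinuous_bound[OF h] by blast
  obtain d where d: "d > 0" "\<And>t x y. t \<in> X \<Longrightarrow> x \<in> {0..1} \<Longrightarrow> y \<in> {0..1} \<Longrightarrow> \<bar>x - y\<bar> < d
        \<Longrightarrow> norm (h t x - h t y) < \<epsilon>/2"
    using bdd_equicontinuous_modulus[OF h, of "\<epsilon>/2"] \<open>\<epsilon> > 0\<close> by auto
  obtain n :: nat where n: "n > 0" "1 / n < d"
    using real_arch_inverse[of d] d(1) by (auto simp: inverse_eq_divide)
  \<comment> \<open>With this threshold each of the \<open>n\<close> phase integrals contributes at
    most \<open>2 / \<Lambda> * C = \<epsilon> / (2 * n)\<close>.\<close>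
  define \<Lambda> where "\<Lambda> = 4 * C * n / \<epsilon>"
  have L: "\<Lambda> > 0" using C n \<open>\<epsilon> > 0\<close> by (simp add: \<Lambda>_def)
  show ?thesis
  proof (rule that[OF L])
    fix \<mu> t assume lam: "\<bar>\<mu>\<bar> \<ge> \<Lambda>" and t: "t \<in> X"
    have l0: "\<mu> \<noteq> 0" using L lam by auto
    have hc: "continuous_on {0..1} (h t)" using bdd_equicontinuous_continuous_on[OF h t] .
    let ?F = "\<lambda>y. phase \<mu> y * h t y"
    have Fc: "continuous_on {0..1} ?F" by (intro continuous_intros hc)
    have step: "norm (integral {0..real j / n} ?F) \<le> j * (\<epsilon> / n)" if "j \<le> n" for j
      using that
    proof (induction j)
      case 0
      then show ?case by simp
    next
      case (Suc j)
      let ?a = "real j / n" and ?b = "real (Suc j) / n"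
      have ab: "0 \<le> ?a" "?a \<le> ?b" "?b \<le> 1" using Suc.prems n by (auto simp: divide_simps)
      have sub: "{?a..?b} \<subseteq> {0..1}" using ab by auto
      have ha: "?a \<in> {0..1}" using ab by auto
      have ba: "?b - ?a = 1 / n" using n by (simp add: field_simps)
      have int1: "(\<lambda>y. phase \<mu> y * (h t y - h t ?a)) integrable_on {?a..?b}"
        by (intro integrable_continuous_real continuous_intros continuous_on_subset[OF hc sub])
      have int2: "(\<lambda>y. phase \<mu> y * h t ?a) integrable_on {?a..?b}"
        by (intro integrable_continuous_real continuous_intros)
      have "integral {?a..?b} ?F = integral {?a..?b} (\<lambda>y. phase \<mu> y * (h t y - h t ?a) + phase \<mu> y * h t ?a)"
        by (simp add: algebra_simps)
      also have "\<dots> = integral {?a..?b} (\<lambda>y. phase \<mu> y * (h t y - h t ?a))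
          + integral {?a..?b} (phase \<mu>) * h t ?a"
        by (subst integral_add[OF int1 int2]) simp
      finally have eq: "integral {?a..?b} ?F = \<dots>" .
      have "norm (integral {?a..?b} (\<lambda>y. phase \<mu> y * (h t y - h t ?a))) \<le> \<epsilon>/2 * (?b - ?a)"
      proof (rule integral_bound[OF ab(2)])
        fix y assume y: "y \<in> {?a..?b}"
        then have "\<bar>y - ?a\<bar> < d" using n ba by (auto simp: abs_le_iff)
        then have "norm (h t y - h t ?a) < \<epsilon>/2" using d(2)[of t y ?a] t y sub ha by blast
        then show "norm (phase \<mu> y * (h t y - h t ?a)) \<le> \<epsilon>/2" by (simp add: norm_mult)
      qed (intro continuous_intros continuous_on_subset[OF hc sub])
      moreover have "norm (integral {?a..?b} (phase \<mu>) * h t ?a) \<le> 2 / \<bar>\<mu>\<bar> * C"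
        unfolding norm_mult using norm_integral_phase[OF ab(2) l0] C ha t
        by (intro mult_mono) auto
      moreover have "2 / \<bar>\<mu>\<bar> * C \<le> 2 / \<Lambda> * C"
        using lam L C by (intro mult_right_mono divide_left_mono) auto
      moreover have "2 / \<Lambda> * C = \<epsilon> / (2 * n)"
        unfolding \<Lambda>_def using C n \<open>\<epsilon> > 0\<close> by (simp add: field_simps)
      ultimately have "norm (integral {?a..?b} ?F) \<le> \<epsilon>/2 * (1/n) + \<epsilon> / (2 * n)"
        unfolding eq ba by (smt (verit) norm_triangle_ineq)
      also have "\<dots> = \<epsilon> / n" by (simp add: field_simps)
      finally have piece: "norm (integral {?a..?b} ?F) \<le> \<epsilon> / n" .
      have "integral {0..?b} ?F = integral {0..?a} ?F + integral {?a..?b} ?F"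
        using ab by (intro Henstock_Kurzweil_Integration.integral_combine[symmetric] integrable_continuous_real
          continuous_on_subset[OF Fc]) auto
      then have "norm (integral {0..?b} ?F) \<le> j * (\<epsilon> / n) + \<epsilon> / n"
        using piece Suc by (smt (verit) Suc_leD norm_triangle_ineq)
      also have "\<dots> = Suc j * (\<epsilon> / n)" by (simp add: algebra_simps add_divide_distrib)
      finally show ?case .
    qed
    from step[of n] show "norm (integral {0..1} ?F) \<le> \<epsilon>" using n by simp
  qed
qed

subsection \<open>Sobolev regularity above the critical exponent\<close>

lemma has_vector_derivative_iff_slope:
  "(V has_vector_derivative w) (at x within S) \<longleftrightarrow> ((\<lambda>y. (V y - V x) /\<^sub>R (y - x)) \<longlongrightarrow> w) (at x within S)"
proof -
  have *: "norm ((1 / norm (y - x)) *\<^sub>R (V y - (V x + (y - x) *\<^sub>R w))) = norm ((V y - V x) /\<^sub>R (y - x) - w)"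
    if "y \<noteq> x" for y
  proof -
    have "V y - (V x + (y - x) *\<^sub>R w) = (y - x) *\<^sub>R ((V y - V x) /\<^sub>R (y - x) - w)"
      using that by (simp add: scaleR_right_diff_distrib)
    then show ?thesis using that by simp
  qed
  have "(V has_vector_derivative w) (at x within S) \<longleftrightarrow>
      ((\<lambda>y. norm ((1 / norm (y - x)) *\<^sub>R (V y - (V x + (y - x) *\<^sub>R w)))) \<longlongrightarrow> 0) (at x within S)"
    unfolding has_vector_derivative_def has_derivative_within
    by (simp only: bounded_linear_scaleR_left tendsto_norm_zero_iff simp_thms)
  also have "\<dots> \<longleftrightarrow> ((\<lambda>y. norm ((V y - V x) /\<^sub>R (y - x) - w)) \<longlongrightarrow> 0) (at x within S)"
    unfolding eventually_at_filter by (intro tendsto_cong) (use * in \<open>auto simp only: eventually_at_filter intro!: always_eventually\<close>)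
  also have "\<dots> \<longleftrightarrow> ((\<lambda>y. (V y - V x) /\<^sub>R (y - x)) \<longlongrightarrow> w) (at x within S)"
    by (simp only: tendsto_norm_zero_iff LIM_zero_iff)
  finally show ?thesis .
qed

text \<open>A criterion of Campanato type: the hypothesis makes the secant slopes over intervals
  shrinking to \<open>x\<close> a Cauchy sequence, at a rate uniform in \<open>x\<close>. The limit
  \<open>w\<close> is the derivative, one-sided at 0 and 1, and inherits the exponent
  \<open>\<alpha>\<close>. The last conclusion bounds its size through the slope over all of
  [0,1].\<close>

lemma nested_slopes_imp_differentiable:
  fixes V :: "real \<Rightarrow> complex"
  defines "S \<equiv> \<lambda>a b. (V b - V a) /\<^sub>R (b - a)"
  assumes \<alpha>: "\<alpha> > 0" and K: "K \<ge> 0"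
    and nested: "\<And>a b c d. 0 \<le> a \<Longrightarrow> a \<le> c \<Longrightarrow> c < d \<Longrightarrow> d \<le> b \<Longrightarrow> b \<le> 1 \<Longrightarrow> norm (S c d - S a b) \<le> K * (b - a) powr \<alpha>"
  obtains w where "\<And>x. x \<in> {0..1} \<Longrightarrow> (V has_vector_derivative w x) (at x within {0..1})"
    "\<And>x y. x \<in> {0..1} \<Longrightarrow> y \<in> {0..1} \<Longrightarrow> norm (w x - w y) \<le> 4 * K * \<bar>x - y\<bar> powr \<alpha>"
    "\<And>x. x \<in> {0..1} \<Longrightarrow> norm (w x - (V 1 - V 0)) \<le> 2 * K"
proof -
  \<comment> \<open>The intervals from \<open>l n x\<close> to \<open>r n x\<close> contain
    \<open>x\<close>, stay in [0,1] even if \<open>x\<close> is an end point, are nested in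
    \<open>n\<close>, and have length exactly \<open>1 / real (n + 1)\<close>.\<close>
  define l r where "l n x = x - x / real (n + 1)" and "r n x = x + (1 - x) / real (n + 1)" for n :: nat and x :: real
  have lr: "0 \<le> l n x" "l n x \<le> x" "x \<le> r n x" "r n x \<le> 1" "r n x - l n x = 1 / real (n + 1)" if "x \<in> {0..1}" for n x
    using that by (auto simp: l_def r_def field_simps mult_left_le_one_le)
  have lr_less: "l n x < r n x" if "x \<in> {0..1}" for n x
    using lr(5)[OF that, of n] by (smt (verit) of_nat_0_less_iff zero_less_divide_1_iff Suc_eq_plus1 zero_less_Suc)
  have lr_mono: "l n x \<le> l m x" "r m x \<le> r n x" if "n \<le> m" "x \<in> {0..1}" for n m x
    using that by (auto simp: l_def r_def intro!: divide_left_mono)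
  define s where "s n x = S (l n x) (r n x)" for n x
  have zero: "(\<lambda>n. K * (1 / real (n + 1)) powr \<alpha>) \<longlonglongrightarrow> K * 0"
  proof (intro tendsto_mult tendsto_const)
    have "(\<lambda>n. 1 / real (n + 1)) \<longlonglongrightarrow> 0" using LIMSEQ_inverse_real_of_nat by (simp add: inverse_eq_divide)
    then have "(\<lambda>n. (1 / real (n + 1)) powr \<alpha>) \<longlonglongrightarrow> 0 powr \<alpha>"
      by (rule tendsto_powr'[OF _ tendsto_const]) (use \<alpha> in auto)
    then show "(\<lambda>n. (1 / real (n + 1)) powr \<alpha>) \<longlonglongrightarrow> 0" by simp
  qed
  have conv: "convergent (\<lambda>n. s n x)" if x: "x \<in> {0..1}" for x
    unfolding Cauchy_convergent_iff[symmetric]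
  proof (rule CauchyI')
    fix e :: real assume "e > 0"
    have "eventually (\<lambda>n. K * (1 / real (n + 1)) powr \<alpha> < e) sequentially"
      using order_tendstoD(2)[OF zero, of e] \<open>e > 0\<close> by simp
    then obtain N where N: "K * (1 / real (n + 1)) powr \<alpha> < e" if "n \<ge> N" for n
      by (auto simp: eventually_sequentially)
    show "\<exists>M. \<forall>m\<ge>M. \<forall>n>m. dist (s m x) (s n x) < e"
    proof (intro exI[of _ N] allI impI)
      fix m n assume "m \<ge> N" "n > m"
      have "norm (s n x - s m x) \<le> K * (r m x - l m x) powr \<alpha>"
        unfolding s_def using \<open>n > m\<close> x lr_mono[of m n x] lr[OF x] lr_less[OF x] by (intro nested) auto
      also have "\<dots> < e" using lr(5)[OF x] N[OF \<open>m \<ge> N\<close>] by simp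
      finally show "dist (s m x) (s n x) < e" by (simp add: dist_norm norm_minus_commute)
    qed
  qed
  define w where "w x = lim (\<lambda>n. s n x)" for x
  have s_lim: "(\<lambda>n. s n x) \<longlonglongrightarrow> w x" if "x \<in> {0..1}" for x
    unfolding w_def using conv[OF that] by (simp add: convergent_LIMSEQ_iff)
  \<comment> \<open>The interval \<open>[a,b]\<close> and the standard interval around
    \<open>x\<close> need not be nested; both are compared with their convex hull, whence the factor
    2. The bound for the length of the hull tends to \<open>b - a\<close>.\<close>
  have main: "norm (S a b - w x) \<le> 2 * K * (b - a) powr \<alpha>"
    if ab: "0 \<le> a" "a \<le> x" "x \<le> b" "b \<le> 1" "a < b" for a b x
  proof -
    have x: "x \<in> {0..1}" using ab by auto
    have "norm (S a b - s n x) \<le> 2 * K * (b - a + 1 / real (n + 1)) powr \<alpha>" for n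
    proof -
      define a' b' where "a' = min a (l n x)" and "b' = max b (r n x)"
      have len: "b' - a' \<le> b - a + 1 / real (n + 1)" "b' - a' \<ge> 0"
        using lr[OF x, of n] ab by (auto simp: a'_def b'_def)
      have "norm (S a b - S a' b') \<le> K * (b' - a') powr \<alpha>"
        using ab lr[OF x, of n] by (intro nested) (auto simp: a'_def b'_def)
      moreover have "norm (s n x - S a' b') \<le> K * (b' - a') powr \<alpha>"
        unfolding s_def using ab lr[OF x, of n] lr_less[OF x, of n] by (intro nested) (auto simp: a'_def b'_def)
      moreover have "K * (b' - a') powr \<alpha> \<le> K * (b - a + 1 / real (n + 1)) powr \<alpha>"
        using len \<alpha> K by (intro mult_left_mono powr_mono2) auto
      ultimately show ?thesis
        using norm_triangle_ineq4[of "S a b - S a' b'" "s n x - S a' b'"] by simp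
    qed
    moreover have "(\<lambda>n. norm (S a b - s n x)) \<longlonglongrightarrow> norm (S a b - w x)"
      by (intro tendsto_intros s_lim x)
    moreover have "(\<lambda>n. 2 * K * (b - a + 1 / real (n + 1)) powr \<alpha>) \<longlonglongrightarrow> 2 * K * (b - a + 0) powr \<alpha>"
    proof -
      have "(\<lambda>n. 1 / real (n + 1)) \<longlonglongrightarrow> 0" using LIMSEQ_inverse_real_of_nat by (simp add: inverse_eq_divide)
      then show ?thesis using ab
        by (intro tendsto_mult tendsto_powr tendsto_add tendsto_const) auto
    qed
    ultimately have "norm (S a b - w x) \<le> 2 * K * (b - a + 0) powr \<alpha>"
      by (intro LIMSEQ_le[where X = "\<lambda>n. norm (S a b - s n x)" and Y = "\<lambda>n. 2 * K * (b - a + 1 / real (n + 1)) powr \<alpha>"]) auto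
    then show ?thesis by simp
  qed
  have slope: "norm ((V y - V x) /\<^sub>R (y - x) - w x) \<le> 2 * K * \<bar>y - x\<bar> powr \<alpha>"
    if "x \<in> {0..1}" "y \<in> {0..1}" "y \<noteq> x" for x y
  proof (cases "x < y")
    case True
    then show ?thesis using main[of x x y] that by (simp add: S_def)
  next
    case False
    then have "y < x" using that by simp
    moreover have "(V x - V y) /\<^sub>R (x - y) = (V y - V x) /\<^sub>R (y - x)"
      by (metis (no_types) minus_diff_eq inverse_minus_eq scaleR_minus_left scaleR_minus_right minus_minus)
    ultimately show ?thesis using main[of y x x] that by (simp add: S_def)
  qed
  show ?thesis
  proof (rule that[of w])
    fix x :: real assume x: "x \<in> {0..1}"
    show "norm (w x - (V 1 - V 0)) \<le> 2 * K"
      using main[of 0 x 1] x by (simp add: S_def norm_minus_commute)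
    have "((\<lambda>y. 2 * K * \<bar>y - x\<bar> powr \<alpha>) \<longlongrightarrow> 2 * K * 0) (at x within {0..1})"
    proof (intro tendsto_mult tendsto_const)
      have "((\<lambda>y. \<bar>y - x\<bar> powr \<alpha>) \<longlongrightarrow> \<bar>x - x\<bar> powr \<alpha>) (at x within {0..1})"
        using \<alpha> by (intro tendsto_powr' tendsto_intros) auto
      then show "((\<lambda>y. \<bar>y - x\<bar> powr \<alpha>) \<longlongrightarrow> 0) (at x within {0..1})" by simp
    qed
    then have lim0: "((\<lambda>y. 2 * K * \<bar>y - x\<bar> powr \<alpha>) \<longlongrightarrow> 0) (at x within {0..1})" by simp
    have "((\<lambda>y. (V y - V x) /\<^sub>R (y - x) - w x) \<longlongrightarrow> 0) (at x within {0..1})"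
      by (rule Lim_null_comparison[OF _ lim0]) (use slope x in \<open>auto simp: eventually_at_filter\<close>)
    then show "(V has_vector_derivative w x) (at x within {0..1})"
      by (simp only: has_vector_derivative_iff_slope LIM_zero_iff)
  next
    fix x y :: real assume xy: "x \<in> {0..1}" "y \<in> {0..1}"
    have *: "norm (w x - w y) \<le> 4 * K * \<bar>x - y\<bar> powr \<alpha>" if "x < y" "x \<in> {0..1}" "y \<in> {0..1}" for x y
      using main[of x x y] main[of x y y] that norm_triangle_ineq4[of "S x y - w x" "S x y - w y"]
      by (auto simp: norm_minus_commute)
    show "norm (w x - w y) \<le> 4 * K * \<bar>x - y\<bar> powr \<alpha>"
      using *[of x y] *[of y x] xy K by (cases x y rule: linorder_cases) (auto simp: norm_minus_commute abs_minus_commute)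
  qed
qed

text \<open>Any interval is reached from a larger one by halving the length in every step but the last, and
  the errors of the steps form a geometric series.\<close>

lemma nested_of_halving:
  fixes S :: "real \<Rightarrow> real \<Rightarrow> complex"
  assumes \<alpha>: "\<alpha> > 0" and K: "K \<ge> 0"
    and step: "\<And>a b c d. 0 \<le> a \<Longrightarrow> a \<le> c \<Longrightarrow> c < d \<Longrightarrow> d \<le> b \<Longrightarrow> b \<le> 1 \<Longrightarrow> b - a \<le> 2 * (d - c) \<Longrightarrow>
      norm (S c d - S a b) \<le> K * (b - a) powr \<alpha>"
    and "0 \<le> a" "a \<le> c" "c < d" "d \<le> b" "b \<le> 1"
  shows "norm (S c d - S a b) \<le> K / (1 - 2 powr (-\<alpha>)) * (b - a) powr \<alpha>"
proof -
  define q where "q = 2 powr (-\<alpha>)"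
  have q: "0 < q" "q < 1" using \<alpha> powr_less_mono[of "-\<alpha>" 0 2] by (auto simp: q_def)
  define K' where "K' = K / (1 - q)"
  have K': "K' * (1 - q) = K" using q by (simp add: K'_def)
  have KK': "K \<le> K'" using K q by (simp add: K'_def pos_le_divide_eq mult_left_le)
  have "norm (S c d - S a b) \<le> K' * (b - a) powr \<alpha>"
    if "0 \<le> a" "a \<le> c" "c < d" "d \<le> b" "b \<le> 1" "b - a \<le> 2 ^ n * (d - c)" for n a b
    using that
  proof (induction n arbitrary: a b)
    case 0
    then have "a = c" "b = d" by auto
    then show ?case using K KK' by simp
  next
    case (Suc n)
    show ?case
    proof (cases "b - a \<le> 2 * (d - c)")
      case True
      then have "norm (S c d - S a b) \<le> K * (b - a) powr \<alpha>" using Suc.prems by (intro step) auto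
      also have "\<dots> \<le> K' * (b - a) powr \<alpha>" using KK' by (intro mult_right_mono) auto
      finally show ?thesis .
    next
      case False
      \<comment> \<open>An interval of half the length that still contains \<open>[c,d]\<close>: it
        starts at \<open>c\<close>, unless it would then stick out beyond \<open>b\<close>.\<close>
      define m a1 b1 where "m = (b - a) / 2" and "a1 = min c (b - m)" and "b1 = a1 + m"
      have m2: "b - a = 2 * m" by (simp add: m_def)
      have 1: "0 \<le> a1" "a \<le> a1" "a1 \<le> c" "a1 < b1" "d \<le> b1" "b1 \<le> b" "b1 \<le> 1" "b1 - a1 = m"
        using Suc.prems False m2 by (auto simp: a1_def b1_def min_def)
      have "norm (S c d - S a1 b1) \<le> K' * (b1 - a1) powr \<alpha>"
        using 1 Suc.prems by (intro Suc.IH) (auto simp: m_def)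
      moreover have "norm (S a1 b1 - S a b) \<le> K * (b - a) powr \<alpha>"
        using 1 Suc.prems by (intro step) (auto simp: m_def)
      moreover have "m powr \<alpha> = q * (b - a) powr \<alpha>"
        using Suc.prems by (simp add: m_def q_def powr_divide powr_minus divide_simps)
      ultimately have "norm (S c d - S a b) \<le> K' * (q * (b - a) powr \<alpha>) + K * (b - a) powr \<alpha>"
        using norm_triangle_ineq[of "S c d - S a1 b1" "S a1 b1 - S a b"] 1(8) by simp
      also have "\<dots> = K' * (b - a) powr \<alpha>"
        unfolding K'[symmetric] by (simp add: algebra_simps)
      finally show ?thesis .
    qed
  qed
  moreover obtain n where "b - a \<le> 2 ^ n * (d - c)"
  proof -
    obtain n where "(b - a) / (d - c) < 2 ^ n" using real_arch_pow[of 2 "(b - a) / (d - c)"] by auto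
    then show ?thesis using that[of n] assms by (simp add: pos_divide_less_eq)
  qed
  ultimately show ?thesis using assms by (simp add: K'_def q_def)
qed

section \<open>Bounds for integrals and averages over subintervals\<close>

lemma norm_integral_le_nn_integral:
  fixes v :: "real \<Rightarrow> complex"
  assumes "integrable \<M> v" "0 \<le> c" "d \<le> 1"
  shows "ennreal (norm (integral {c..d} v)) \<le> (\<integral>\<^sup>+x. ennreal (norm (v x)) * indicator {c..d} x \<partial>\<M>)"
    and "integral {c..d} v = (\<integral>x. indicat_real {c..d} x *\<^sub>R v x \<partial>\<M>)"
proof -
  have [measurable]: "v \<in> borel_measurable \<M>" using assms by simp
  have [measurable]: "{c..d} \<in> sets \<M>" using assms by (auto simp: sets_restrict_space_iff)
  have i: "integrable \<M> (\<lambda>x. indicat_real {c..d} x *\<^sub>R v x)"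
  proof (rule Bochner_Integration.integrable_bound[OF assms(1)])
    show "(\<lambda>x. indicat_real {c..d} x *\<^sub>R v x) \<in> borel_measurable \<M>" by measurable
  qed (auto simp: indicator_def)
  have "(\<integral>x. indicat_real {c..d} x *\<^sub>R v x \<partial>\<M>) = integral {0..1} (\<lambda>x. indicat_real {c..d} x *\<^sub>R v x)"
    by (rule lebesgue_integral_eq_integral[OF i]) simp
  also have "\<dots> = integral {0..1} (\<lambda>x. if x \<in> {c..d} then v x else 0)"
    by (rule Henstock_Kurzweil_Integration.integral_cong) (auto simp: indicator_def)
  also have "\<dots> = integral {c..d} v"
    using assms by (subst integral_restrict_Int) (auto intro!: arg_cong2[where f = integral])
  finally show eq: "integral {c..d} v = (\<integral>x. indicat_real {c..d} x *\<^sub>R v x \<partial>\<M>)" ..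
  have "ennreal (norm (\<integral>x. indicat_real {c..d} x *\<^sub>R v x \<partial>\<M>)) \<le> (\<integral>\<^sup>+x. ennreal (norm (indicat_real {c..d} x *\<^sub>R v x)) \<partial>\<M>)"
    by (rule integral_norm_bound_ennreal[OF i])
  also have "\<dots> = (\<integral>\<^sup>+x. ennreal (norm (v x)) * indicator {c..d} x \<partial>\<M>)"
    by (intro nn_integral_cong) (auto simp: indicator_def)
  finally show "ennreal (norm (integral {c..d} v)) \<le> (\<integral>\<^sup>+x. ennreal (norm (v x)) * indicator {c..d} x \<partial>\<M>)"
    unfolding eq .
qed

lemma emeasure_unit_Icc: "0 \<le> c \<Longrightarrow> c \<le> d \<Longrightarrow> d \<le> 1 \<Longrightarrow> emeasure \<M> {c..d} = ennreal (d - c)"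
  by (subst emeasure_restrict_space) (auto simp: emeasure_completion)

lemma Icc_in_sets_unit [measurable]: "0 \<le> c \<Longrightarrow> d \<le> 1 \<Longrightarrow> {c..d} \<in> sets \<M>"
  by (auto simp: sets_restrict_space_iff)

text \<open>Instead of the Cauchy--Schwarz inequality, the weighted bound \<open>2 \<bar>v\<bar> \<le> \<theta> \<bar>v\<bar>\<^sup>2 + 1 / \<theta>\<close> is integrated.\<close>

lemma norm_integral_le_L2:
  fixes v :: "real \<Rightarrow> complex"
  assumes v: "integrable \<M> v" and L2: "L2_norm_sq v \<le> ennreal B" and "B \<ge> 0"
    and cd: "0 \<le> c" "c \<le> d" "d \<le> 1" and \<theta>: "\<theta> > 0"
  shows "norm (integral {c..d} v) \<le> (\<theta> * B + (d - c) / \<theta>) / 2"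
proof -
  have vm [measurable]: "v \<in> borel_measurable \<M>" using v by simp
  have [measurable]: "{c..d} \<in> sets \<M>" using cd by (intro Icc_in_sets_unit)
  have pt: "norm (v x) \<le> \<theta> / 2 * (norm (v x))\<^sup>2 + 1 / (2 * \<theta>)" for x
  proof -
    have "0 \<le> (\<theta> * norm (v x) - 1)\<^sup>2 / (2 * \<theta>)" using \<theta> by simp
    also have "\<dots> = \<theta> / 2 * (norm (v x))\<^sup>2 + 1 / (2 * \<theta>) - norm (v x)"
      using \<theta> by (simp add: field_simps power2_eq_square)
    finally show ?thesis by simp
  qed
  have "ennreal (norm (integral {c..d} v)) \<le> (\<integral>\<^sup>+x. ennreal (norm (v x)) * indicator {c..d} x \<partial>\<M>)"
    by (rule norm_integral_le_nn_integral[OF v]) (use cd in auto)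
  also have "\<dots> \<le> (\<integral>\<^sup>+x. ennreal (\<theta> / 2) * ennreal ((norm (v x))\<^sup>2) + ennreal (1 / (2 * \<theta>)) * indicator {c..d} x \<partial>\<M>)"
    using pt \<theta> by (intro nn_integral_mono)
      (auto simp: indicator_def ennreal_mult[symmetric] ennreal_plus[symmetric] simp del: ennreal_plus intro!: ennreal_leI)
  also have "\<dots> = ennreal (\<theta> / 2) * (\<integral>\<^sup>+x. ennreal ((norm (v x))\<^sup>2) \<partial>\<M>) + ennreal (1 / (2 * \<theta>)) * ennreal (d - c)"
    using cd by (simp add: nn_integral_add nn_integral_cmult emeasure_unit_Icc)
  also have "\<dots> \<le> ennreal (\<theta> / 2) * ennreal B + ennreal (1 / (2 * \<theta>)) * ennreal (d - c)"
    using L2 vm by (intro add_mono mult_left_mono) (auto simp: L2_norm_sq_def)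
  also have "\<dots> = ennreal ((\<theta> * B + (d - c) / \<theta>) / 2)"
    using \<theta> cd \<open>B \<ge> 0\<close> by (simp add: ennreal_mult[symmetric] ennreal_plus[symmetric] field_simps del: ennreal_plus)
  finally show ?thesis
    using \<theta> cd \<open>B \<ge> 0\<close> by (subst (asm) ennreal_le_iff) auto
qed

text \<open>The difference of the two averages is an average of \<open>u x - u y\<close> over
  \<open>[c,d]\<close> times \<open>[a,b]\<close>, and the inequality of arithmetic and geometric
  means trades this against the Gagliardo kernel. For \<sigma> > 1/2 the resulting power of the
  length is positive, which is the source of the Hoelder exponent. The assumption
  \<open>half\<close> bounds \<open>1 / (d - c)\<close> by \<open>2 / (b - a)\<close>;
  \<open>nested_of_halving\<close> later removes it.\<close>

lemma gagliardo_average_step: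
  fixes u :: "real \<Rightarrow> complex"
  assumes u: "integrable \<M> u" and gag: "gagliardo_sq \<sigma> u \<le> ennreal G" and "G \<ge> 0" and \<sigma>: "\<sigma> \<ge> 0"
    and sub: "0 \<le> a" "a \<le> c" "c < d" "d \<le> b" "b \<le> 1" and half: "b - a \<le> 2 * (d - c)"
  shows "norm (integral {c..d} u /\<^sub>R (d - c) - integral {a..b} u /\<^sub>R (b - a)) \<le> (G + 1/2) * (b - a) powr (\<sigma> - 1/2)"
proof -
  have um [measurable]: "u \<in> borel_measurable \<M>" using u by simp
  have idm [measurable]: "(\<lambda>x. x) \<in> borel_measurable \<M>" by (rule continuous_on_borel_unit) (intro continuous_intros)
  have [measurable]: "{c..d} \<in> sets \<M>" "{a..b} \<in> sets \<M>" using sub by (auto intro!: Icc_in_sets_unit)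
  define L where "L = b - a"
  have L: "L > 0" using sub by (simp add: L_def)
  define \<kappa> where "\<kappa> x y = (norm (u x - u y))\<^sup>2 / \<bar>x - y\<bar> powr (1 + 2 * \<sigma>)" for x y
  \<comment> \<open>The product \<open>4 * A * B\<close> is
    \<open>L powr (1 + 2 * \<sigma>)\<close>, which dominates the denominator of the kernel on
    \<open>[a,b]\<close>; this is what the arithmetic-geometric mean step needs. The split is such
    that \<open>A / L\<^sup>2\<close> and \<open>B\<close> scale alike, as
    \<open>L powr (\<sigma> - 1/2)\<close>.\<close>
  define A B where "A = L powr (\<sigma> + 3/2) / 2" and "B = L powr (\<sigma> - 1/2) / 2"
  have AB: "A > 0" "B > 0" using L by (auto simp: A_def B_def)
  have \<kappa>0: "\<kappa> x y \<ge> 0" for x y by (simp add: \<kappa>_def)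
  have AB4: "4 * A * B = L powr (1 + 2 * \<sigma>)"
  proof -
    have "4 * A * B = L powr (\<sigma> + 3/2) * L powr (\<sigma> - 1/2)" by (simp add: A_def B_def)
    also have "\<dots> = L powr (1 + 2 * \<sigma>)" by (simp add: powr_add[symmetric] add.commute)
    finally show ?thesis .
  qed
  have pt: "norm (u x - u y) \<le> A * \<kappa> x y + B" if xy: "x \<in> {a..b}" "y \<in> {a..b}" for x y
  proof (cases "x = y")
    case False
    define h where "h = \<bar>x - y\<bar> powr (1 + 2 * \<sigma>)"
    have h: "h > 0" using False by (simp add: h_def)
    have "\<bar>x - y\<bar> \<le> L" using xy by (auto simp: L_def)
    then have hL: "h \<le> 4 * A * B" unfolding AB4 h_def using \<sigma> by (intro powr_mono2) auto
    define n where "n = norm (u x - u y)"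
    have "0 \<le> (2 * A * n - h)\<^sup>2" by simp
    then have "4 * A * n * h \<le> 4 * A\<^sup>2 * n\<^sup>2 + h * h" by (simp add: power2_eq_square algebra_simps)
    also have "h * h \<le> (4 * A * B) * h" using hL h by (intro mult_right_mono) auto
    also have "4 * A\<^sup>2 * n\<^sup>2 + (4 * A * B) * h = 4 * A * h * (A * (n\<^sup>2 / h) + B)"
      using h by (simp add: field_simps power2_eq_square)
    finally have "4 * A * h * n \<le> 4 * A * h * (A * (n\<^sup>2 / h) + B)" by (simp only: mult_ac)
    then have "n \<le> A * (n\<^sup>2 / h) + B" using AB h by (subst (asm) mult_le_cancel_left_pos) auto
    then show ?thesis by (simp add: n_def h_def \<kappa>_def)
  qed (use AB in \<open>simp add: \<kappa>_def\<close>)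
  have \<kappa>m: "(\<lambda>y. ennreal (\<kappa> x y)) \<in> borel_measurable \<M>" for x
    unfolding \<kappa>_def by measurable
  have km [measurable]: "(\<lambda>x. \<integral>\<^sup>+y. ennreal (\<kappa> x y) \<partial>\<M>) \<in> borel_measurable \<M>"
  proof (rule unit.borel_measurable_nn_integral)
    have [measurable]: "(\<lambda>p. fst p) \<in> borel_measurable (\<M> \<Otimes>\<^sub>M \<M>)" "(\<lambda>p. snd p) \<in> borel_measurable (\<M> \<Otimes>\<^sub>M \<M>)"
      using measurable_compose[OF measurable_fst idm] measurable_compose[OF measurable_snd idm] by simp_all
    show "(\<lambda>(x, y). ennreal (\<kappa> x y)) \<in> borel_measurable (\<M> \<Otimes>\<^sub>M \<M>)"
      unfolding \<kappa>_def split_beta' by measurable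
  qed
  have gag': "(\<integral>\<^sup>+x. (\<integral>\<^sup>+y. ennreal (\<kappa> x y) \<partial>\<M>) \<partial>\<M>) \<le> ennreal G"
    using gag by (simp add: gagliardo_sq_def \<kappa>_def)
  \<comment> \<open>This is the integral of \<open>u x - u y\<close> over y in \<open>[a,b]\<close>;
    integrated over \<open>[c,d]\<close> and divided by \<open>L * (d - c)\<close> it gives the
    difference of the averages.\<close>
  define D where "D x = L *\<^sub>R u x - integral {a..b} u" for x
  have Dint: "integrable \<M> D" unfolding D_def using u by simp
  have D_bound: "ennreal (norm (D x)) \<le> ennreal A * (\<integral>\<^sup>+y. ennreal (\<kappa> x y) \<partial>\<M>) + ennreal (B * L)"
    if x: "x \<in> {a..b}" for x
  proof -
    have i: "integrable \<M> (\<lambda>y. u x - u y)" using u by simp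
    have "D x = integral {a..b} (\<lambda>y. u x - u y)"
      using sub integral_diff[OF integrable_const_ivl integrable_on_Icc_of_unit(2)[OF u], of a b "u x"]
      by (simp add: D_def L_def)
    then have "ennreal (norm (D x)) \<le> (\<integral>\<^sup>+y. ennreal (norm (u x - u y)) * indicator {a..b} y \<partial>\<M>)"
      using norm_integral_le_nn_integral(1)[OF i, of a b] sub by simp
    also have "\<dots> \<le> (\<integral>\<^sup>+y. ennreal A * ennreal (\<kappa> x y) + ennreal B * indicator {a..b} y \<partial>\<M>)"
      using pt[OF x] AB \<kappa>0 by (intro nn_integral_mono)
        (auto simp: indicator_def ennreal_mult[symmetric] ennreal_plus[symmetric] simp del: ennreal_plus intro!: ennreal_leI)
    also have "\<dots> = ennreal A * (\<integral>\<^sup>+y. ennreal (\<kappa> x y) \<partial>\<M>) + ennreal B * ennreal L"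
      using sub \<kappa>m by (simp add: nn_integral_add nn_integral_cmult emeasure_unit_Icc L_def)
    finally show ?thesis using AB L by (simp add: ennreal_mult)
  qed
  have "ennreal (norm (integral {c..d} D)) \<le> (\<integral>\<^sup>+x. ennreal (norm (D x)) * indicator {c..d} x \<partial>\<M>)"
    using sub by (intro norm_integral_le_nn_integral Dint) auto
  also have "\<dots> \<le> (\<integral>\<^sup>+x. ennreal A * (\<integral>\<^sup>+y. ennreal (\<kappa> x y) \<partial>\<M>) + ennreal (B * L) * indicator {c..d} x \<partial>\<M>)"
    using D_bound sub by (intro nn_integral_mono) (auto simp: indicator_def)
  also have "\<dots> = ennreal A * (\<integral>\<^sup>+x. (\<integral>\<^sup>+y. ennreal (\<kappa> x y) \<partial>\<M>) \<partial>\<M>) + ennreal (B * L) * ennreal (d - c)"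
    using sub km by (simp add: nn_integral_add nn_integral_cmult emeasure_unit_Icc)
  also have "\<dots> \<le> ennreal A * ennreal G + ennreal (B * L) * ennreal (d - c)"
    using gag' by (intro add_mono mult_left_mono) auto
  also have "\<dots> = ennreal (A * G + B * L * (d - c))"
    using AB L sub \<open>G \<ge> 0\<close> by (simp add: ennreal_mult[symmetric] ennreal_plus[symmetric] del: ennreal_plus)
  finally have main: "norm (integral {c..d} D) \<le> A * G + B * L * (d - c)"
    using AB L sub \<open>G \<ge> 0\<close> by (subst (asm) ennreal_le_iff) auto
  have iu: "u integrable_on {c..d}" using sub by (intro integrable_on_Icc_of_unit[OF u]) auto
  have "integral {c..d} D = L *\<^sub>R integral {c..d} u - (d - c) *\<^sub>R integral {a..b} u"
    unfolding D_def using sub integral_diff[OF integrable_cmul[OF iu] integrable_const_ivl] by simp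
  then have "integral {c..d} u /\<^sub>R (d - c) - integral {a..b} u /\<^sub>R (b - a) = integral {c..d} D /\<^sub>R (L * (d - c))"
  proof -
    have "inverse (L * (d - c)) * L = inverse (d - c)" "inverse (L * (d - c)) * (d - c) = inverse L"
      using sub L by (simp_all add: field_simps)
    then show ?thesis
      unfolding \<open>integral {c..d} D = _\<close> by (simp only: scaleR_right_diff_distrib scaleR_scaleR L_def[symmetric])
  qed
  then have "norm (integral {c..d} u /\<^sub>R (d - c) - integral {a..b} u /\<^sub>R (b - a)) = norm (integral {c..d} D) / (L * (d - c))"
    using sub L by (simp add: divide_inverse mult.commute)
  also have "\<dots> \<le> (A * G + B * L * (d - c)) / (L * (d - c))"
    using main sub L by (intro divide_right_mono) auto
  also have "\<dots> = A * G / (L * (d - c)) + B" using sub L by (simp add: add_divide_distrib)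
  also have "\<dots> \<le> A * G / (L * (L / 2)) + B"
    using half sub L AB \<open>G \<ge> 0\<close> by (intro add_right_mono divide_left_mono mult_left_mono mult_pos_pos mult_nonneg_nonneg) (auto simp: L_def)
  also have "A * G / (L * (L / 2)) = G * L powr (\<sigma> - 1/2)"
  proof -
    have "L powr (\<sigma> + 3/2) = L powr (\<sigma> - 1/2) * L powr 2" by (simp add: powr_add[symmetric] add.commute)
    also have "L powr 2 = L * L" using L by (simp add: power2_eq_square)
    finally show ?thesis using L by (simp add: A_def)
  qed
  finally show ?thesis by (simp add: B_def L_def algebra_simps)
qed

section \<open>Classical representatives with uniform bounds\<close>

lemma AE_unit_iff_negligible:
  "(AE x in \<M>. P x) \<longleftrightarrow> negligible {x \<in> {0..1}. \<not> P x}"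
proof -
  have "(AE x in \<M>. P x) \<longleftrightarrow> (AE x in lebesgue. x \<in> {0..1} \<longrightarrow> P x)"
    by (subst AE_restrict_space_iff) auto
  also have "\<dots> \<longleftrightarrow> (\<exists>N. negligible N \<and> {x \<in> {0..1}. \<not> P x} \<subseteq> N)"
    by (subst eventually_ae_filter_negligible) (auto intro!: arg_cong[where f = Ex])
  also have "\<dots> \<longleftrightarrow> negligible {x \<in> {0..1}. \<not> P x}"
    using negligible_subset by blast
  finally show ?thesis .
qed

lemma integral_cong_AE_unit:
  fixes v h :: "real \<Rightarrow> 'b::euclidean_space"
  assumes "AE x in \<M>. v x = h x" "0 \<le> a" "b \<le> 1"
  shows "integral {a..b} v = integral {a..b} h"
  using assms by (intro integral_spike[of "{x \<in> {0..1}. v x \<noteq> h x}"]) (auto simp: AE_unit_iff_negligible)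

text \<open>The first hypothesis has the shape of the conclusion of both the real and the complex
  representation of weak derivatives, so either can be plugged in. Continuity of \<open>h\<close>
  upgrades the indefinite integral to a classical antiderivative.\<close>

lemma AE_indefinite_integral_continuous:
  fixes u v :: "real \<Rightarrow> 'b::euclidean_space"
  assumes "\<exists>C. AE x in \<M>. u x = C + integral {0..x} v" "AE x in \<M>. v x = h x" "continuous_on {0..1} h"
  obtains w where "AE x in \<M>. u x = w x"
    "\<And>x. x \<in> {0..1} \<Longrightarrow> (w has_vector_derivative h x) (at x within {0..1})"
proof -
  obtain C where C: "AE x in \<M>. u x = C + integral {0..x} v" using assms(1) ..
  show ?thesis
  proof (rule that)
    show "AE x in \<M>. u x = C + integral {0..x} h"
      using C AE_space by eventually_elim (use integral_cong_AE_unit[OF assms(2)] in auto)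
    show "((\<lambda>x. C + integral {0..x} h) has_vector_derivative h x) (at x within {0..1})" if "x \<in> {0..1}" for x
      using has_vector_derivative_add[OF has_vector_derivative_const integral_has_vector_derivative[OF assms(3) that]]
      by simp
  qed
qed

lemmas weak_deriv_continuous_imp_classical =
  AE_indefinite_integral_continuous[OF weak_deriv_imp_AE_indefinite_integral]

text \<open>An infimum yields a witness only below a strict upper bound, which is why norm bounds
  are carried in strict form.\<close>

lemma sobolev_norm_sq_Suc_less:
  assumes "sobolev_norm_sq (Suc n) \<sigma> u < b"
  obtains v where "has_weak_deriv u v" "sobolev_norm_sq n \<sigma> v < b"
proof -
  have "(INF v\<in>{v. has_weak_deriv u v}. sobolev_norm_sq n \<sigma> v) \<le> sobolev_norm_sq (Suc n) \<sigma> u" by simp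
  then have "(INF v\<in>{v. has_weak_deriv u v}. sobolev_norm_sq n \<sigma> v) < b" using assms by (rule le_less_trans)
  then show ?thesis using that by (auto simp: INF_less_iff)
qed

lemma L2_norm_sq_le_sobolev: "L2_norm_sq u \<le> sobolev_norm_sq n \<sigma> u"
  by (cases n) (auto simp: frac_norm_sq_def intro: order_trans[OF le_add_same_cancel1[THEN iffD2]] add_increasing2)

text \<open>If \<open>h\<close> exceeded the bound at one point, the oscillation bound would keep
  \<open>norm (h y)\<close> above \<open>sqrt (B + 1)\<close> everywhere, and the squared L2 norm
  would be at least \<open>B + 1\<close>. This turns an L2 bound, together with a bound on the
  derivative, into a sup bound.\<close>

lemma norm_le_oscillation_plus_L2:
  assumes "AE x in \<M>. u x = h x" and L2: "L2_norm_sq u \<le> ennreal B" and "B \<ge> 0"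
    and osc: "\<And>x y. x \<in> {0..1} \<Longrightarrow> y \<in> {0..1} \<Longrightarrow> norm (h x - h y) \<le> D"
    and x: "x \<in> {0..1}"
  shows "norm (h x) \<le> D + sqrt (B + 1)"
proof (rule ccontr)
  assume neg: "\<not> norm (h x) \<le> D + sqrt (B + 1)"
  have um: "u \<in> borel_measurable \<M>" using L2 by (auto simp: L2_norm_sq_def top_unique split: if_splits)
  have "ennreal (B + 1) = (\<integral>\<^sup>+x. ennreal (B + 1) \<partial>\<M>)"
    using emeasure_unit_Icc[of 0 1] by simp
  also have "\<dots> \<le> (\<integral>\<^sup>+x. ennreal ((norm (u x))\<^sup>2) \<partial>\<M>)"
  proof (rule nn_integral_mono_AE)
    show "AE y in \<M>. ennreal (B + 1) \<le> ennreal ((norm (u y))\<^sup>2)"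
      using assms(1) AE_space
    proof eventually_elim
      case (elim y)
      have "norm (h x) \<le> norm (h x - h y) + norm (h y)" by (metis norm_triangle_sub add.commute)
      then have "sqrt (B + 1) \<le> norm (h y)" using osc[OF x, of y] neg elim by simp
      then have "(sqrt (B + 1))\<^sup>2 \<le> (norm (h y))\<^sup>2" using \<open>B \<ge> 0\<close> by (intro power_mono) auto
      then show ?case using elim \<open>B \<ge> 0\<close> by (intro ennreal_leI) simp
    qed
  qed
  also have "\<dots> \<le> ennreal B" using L2 um by (simp add: L2_norm_sq_def)
  finally show False using \<open>B \<ge> 0\<close> by simp
qed

lemma norm_diff_le_unit:
  fixes w :: "real \<Rightarrow> complex"
  assumes "\<And>x. x \<in> {0..1} \<Longrightarrow> (w has_vector_derivative w' x) (at x within {0..1})"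
    and "\<And>x. x \<in> {0..1} \<Longrightarrow> norm (w' x) \<le> M" and "x \<in> {0..1}" "y \<in> {0..1}"
  shows "norm (w x - w y) \<le> M"
proof -
  have M: "M \<ge> 0" using assms(2)[of 0] order_trans[OF norm_ge_zero] by auto
  have *: "norm (w b - w a) \<le> M" if "0 \<le> a" "a \<le> b" "b \<le> 1" for a b
  proof -
    have "norm (w b - w a) \<le> M * (b - a)"
      using that by (intro norm_diff_le_of_vector_derivative[of a b w w'] has_vector_derivative_within_subset[OF assms(1)] assms(2)) auto
    also have "\<dots> \<le> M" using that M by (simp add: mult_left_le)
    finally show ?thesis .
  qed
  show ?thesis using *[of x y] *[of y x] assms(3,4) by (cases "x \<le> y") (auto simp: norm_minus_commute)
qed

text \<open>A ball in the Hoelder space of order 2 + \<alpha>, with \<open>w1\<close> and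
  \<open>w2\<close> as the derivatives of \<open>w\<close>. One constant \<open>M\<close> bounds the
  function, its derivatives and the Hoelder seminorm. At 0 and 1 the derivatives are one-sided, and
  it is there that they are evaluated later.\<close>

definition C2_bounded :: "real \<Rightarrow> real \<Rightarrow> (real \<Rightarrow> complex) \<Rightarrow> (real \<Rightarrow> complex) \<Rightarrow> (real \<Rightarrow> complex) \<Rightarrow> bool" where
  "C2_bounded M \<alpha> w w1 w2 \<longleftrightarrow>
     (\<forall>x\<in>{0..1}. (w has_vector_derivative w1 x) (at x within {0..1}) \<and>
        (w1 has_vector_derivative w2 x) (at x within {0..1}) \<and>
        norm (w x) \<le> M \<and> norm (w1 x) \<le> M \<and> norm (w2 x) \<le> M) \<and>
     (\<forall>x\<in>{0..1}. \<forall>y\<in>{0..1}. norm (w2 x - w2 y) \<le> M * \<bar>x - y\<bar> powr \<alpha>)"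

text \<open>The bound descends from \<open>w2\<close> to \<open>w1\<close> and from
  \<open>w1\<close> to \<open>w\<close>: at each level the derivative bounds the oscillation and the
  L2 norm then bounds the size, at the price of one summand \<open>sqrt (B + 1)\<close>.\<close>

lemma weak_deriv_imp_C2_bounded:
  assumes weak: "has_weak_deriv u v" and AE_v: "AE x in \<M>. v x = w1 x"
    and L2: "L2_norm_sq u \<le> ennreal B" "L2_norm_sq v \<le> ennreal B" and "B \<ge> 0"
    and w1: "\<And>x. x \<in> {0..1} \<Longrightarrow> (w1 has_vector_derivative w2 x) (at x within {0..1})"
    and w2: "\<And>x. x \<in> {0..1} \<Longrightarrow> norm (w2 x) \<le> M"
    and hoelder: "\<And>x y. x \<in> {0..1} \<Longrightarrow> y \<in> {0..1} \<Longrightarrow> norm (w2 x - w2 y) \<le> H * \<bar>x - y\<bar> powr \<alpha>" and "H \<ge> 0"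
  shows "\<exists>w. (AE x in \<M>. u x = w x) \<and> C2_bounded (M + 2 * sqrt (B + 1) + H) \<alpha> w w1 w2"
proof -
  have M: "M \<ge> 0" using w2[of 0] order_trans[OF norm_ge_zero] by auto
  have "continuous_on {0..1} w1"
    by (rule continuous_on_vector_derivative[OF w1])
  then obtain w where w: "AE x in \<M>. u x = w x"
      "\<And>x. x \<in> {0..1} \<Longrightarrow> (w has_vector_derivative w1 x) (at x within {0..1})"
    using weak_deriv_continuous_imp_classical[OF weak AE_v] by blast
  have w1_le: "norm (w1 x) \<le> M + sqrt (B + 1)" if "x \<in> {0..1}" for x
    by (rule norm_le_oscillation_plus_L2[OF AE_v L2(2) \<open>B \<ge> 0\<close> norm_diff_le_unit[OF w1 w2] that])
  have w_le: "norm (w x) \<le> M + sqrt (B + 1) + sqrt (B + 1)" if "x \<in> {0..1}" for x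
    by (rule norm_le_oscillation_plus_L2[OF w(1) L2(1) \<open>B \<ge> 0\<close> norm_diff_le_unit[OF w(2) w1_le] that])
  define M' where "M' = M + 2 * sqrt (B + 1) + H"
  have M': "M \<le> M'" "M + sqrt (B + 1) \<le> M'" "M + sqrt (B + 1) + sqrt (B + 1) \<le> M'" "H \<le> M'"
    using \<open>B \<ge> 0\<close> \<open>H \<ge> 0\<close> M by (auto simp: M'_def)
  have "norm (w2 x - w2 y) \<le> M' * \<bar>x - y\<bar> powr \<alpha>" if "x \<in> {0..1}" "y \<in> {0..1}" for x y
    using hoelder[OF that] M'(4) by (meson mult_right_mono order_trans powr_ge_zero)
  then have "C2_bounded M' \<alpha> w w1 w2"
    unfolding C2_bounded_def using w(2) w1 w1_le w_le w2 M' by (meson order_trans)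
  then show ?thesis using w(1) by (auto simp: M'_def)
qed

text \<open>For s < 3 the second weak derivative has a finite Gagliardo seminorm of order
  \<open>frac s\<close>, which exceeds 1/2. Its averages are the secant slopes of the first
  derivative, and these converge with Hoelder exponent \<open>frac s - 1/2\<close>. For s >= 3 there
  is a third weak derivative in L2, which makes the second one Hoelder continuous with exponent 1/2.
  \<open>M\<close> and \<open>\<alpha>\<close> are chosen before \<open>u\<close>, so that the
  bounds become uniform in time.\<close>

lemma sobolev_imp_C2_bounded:
  assumes s: "s > 5/2" and B: "B \<ge> 0"
  shows "\<exists>M \<alpha>. \<alpha> > 0 \<and> (\<forall>u. sobolev_norm_sq (nat \<lfloor>s\<rfloor>) (frac s) u < ennreal B \<longrightarrow>
    (\<exists>w w1 w2. (AE x in \<M>. u x = w x) \<and> C2_bounded M \<alpha> w w1 w2))"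
proof (cases "s < 3")
  case True
  then have "\<lfloor>s\<rfloor> = 2" using s by (simp add: floor_eq_iff)
  then have n: "nat \<lfloor>s\<rfloor> = Suc (Suc 0)" and \<sigma>: "frac s = s - 2" by (simp_all add: frac_def)
  define \<alpha> where "\<alpha> = frac s - 1/2"
  have \<alpha>: "\<alpha> > 0" using s by (simp add: \<alpha>_def \<sigma>)
  define K where "K = (B + 1/2) / (1 - 2 powr (-\<alpha>))"
  have "2 powr (-\<alpha>) < (1::real)" using \<alpha> powr_less_mono[of "-\<alpha>" 0 2] by simp
  then have K: "K \<ge> 0" using B by (simp add: K_def)
  have "\<exists>w w1 w2. (AE x in \<M>. u x = w x) \<and> C2_bounded ((B + 1) / 2 + 2 * K + 2 * sqrt (B + 1) + 4 * K) \<alpha> w w1 w2"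
    if u: "sobolev_norm_sq (nat \<lfloor>s\<rfloor>) (frac s) u < ennreal B" for u
  proof -
    obtain v1 where v1: "has_weak_deriv u v1" "sobolev_norm_sq (Suc 0) (frac s) v1 < ennreal B"
      using sobolev_norm_sq_Suc_less[OF u[unfolded n]] by blast
    obtain v2 where v2: "has_weak_deriv v1 v2" "sobolev_norm_sq 0 (frac s) v2 < ennreal B"
      using sobolev_norm_sq_Suc_less[OF v1(2)] by blast
    have L2: "L2_norm_sq u \<le> ennreal B" "L2_norm_sq v1 \<le> ennreal B" "L2_norm_sq v2 \<le> ennreal B"
      using order_trans[OF L2_norm_sq_le_sobolev less_imp_le] u v1(2) v2(2) by blast+
    have gag: "gagliardo_sq (frac s) v2 \<le> ennreal B"
    proof -
      have "gagliardo_sq (frac s) v2 \<le> sobolev_norm_sq 0 (frac s) v2"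
      proof -
        have "frac s \<noteq> 0" using s by (simp add: \<sigma> del: frac_eq_0_iff)
        then show ?thesis by (simp add: frac_norm_sq_def del: frac_eq_0_iff)
      qed
      then show ?thesis using v2(2) by (meson less_imp_le order_trans)
    qed
    have v2i: "integrable \<M> v2" using v2(1) by (simp add: has_weak_deriv_def)
    obtain C where C: "AE x in \<M>. v1 x = C + integral {0..x} v2"
      using weak_deriv_imp_AE_indefinite_integral[OF v2(1)] ..
    define V where "V x = C + integral {0..x} v2" for x
    have diff: "V d - V c = integral {c..d} v2" if "0 \<le> c" "c \<le> d" "d \<le> 1" for c d
      using Henstock_Kurzweil_Integration.integral_combine[OF that(1,2) integrable_on_Icc_of_unit(2)[OF v2i order_refl that(3)]]
      by (simp add: V_def algebra_simps)
    \<comment> \<open>The slope of \<open>V\<close> over an interval is the average of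
      \<open>v2\<close> over it, so the averaging estimate applies.\<close>
    have nested: "norm ((V d - V c) /\<^sub>R (d - c) - (V b - V a) /\<^sub>R (b - a)) \<le> K * (b - a) powr \<alpha>"
      if "0 \<le> a" "a \<le> c" "c < d" "d \<le> b" "b \<le> 1" for a b c d
      unfolding K_def
    proof (rule nested_of_halving[OF \<alpha> _ _ that, of "B + 1/2" "\<lambda>a b. (V b - V a) /\<^sub>R (b - a)"])
      fix a b c d :: real assume *: "0 \<le> a" "a \<le> c" "c < d" "d \<le> b" "b \<le> 1" "b - a \<le> 2 * (d - c)"
      have "frac s \<ge> 0" by simp
      from gagliardo_average_step[OF v2i gag B this *]
      show "norm ((V d - V c) /\<^sub>R (d - c) - (V b - V a) /\<^sub>R (b - a)) \<le> (B + 1/2) * (b - a) powr \<alpha>"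
        using * by (simp add: diff \<alpha>_def)
    qed (use B in simp)
    obtain w2 where w2: "\<And>x. x \<in> {0..1} \<Longrightarrow> (V has_vector_derivative w2 x) (at x within {0..1})"
      "\<And>x y. x \<in> {0..1} \<Longrightarrow> y \<in> {0..1} \<Longrightarrow> norm (w2 x - w2 y) \<le> 4 * K * \<bar>x - y\<bar> powr \<alpha>"
      "\<And>x. x \<in> {0..1} \<Longrightarrow> norm (w2 x - (V 1 - V 0)) \<le> 2 * K"
      using nested_slopes_imp_differentiable[OF \<alpha> K nested] by blast
    have "norm (V 1 - V 0) \<le> (B + 1) / 2"
      using norm_integral_le_L2[OF v2i L2(3) B, of 0 1 1] diff[of 0 1] by simp
    then have "norm (w2 x) \<le> (B + 1) / 2 + 2 * K" if "x \<in> {0..1}" for x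
      using w2(3)[OF that] norm_triangle_sub[of "w2 x" "V 1 - V 0"] by linarith
    from weak_deriv_imp_C2_bounded[OF v1(1) C[folded V_def] L2(1,2) B w2(1) this w2(2)] K
    show ?thesis by auto
  qed
  then show ?thesis using \<alpha> by blast
next
  case False
  then have "\<lfloor>s\<rfloor> \<ge> 3" by (simp add: le_floor_iff)
  then obtain m where n: "nat \<lfloor>s\<rfloor> = Suc (Suc (Suc m))"
    by (metis Suc_nat_eq_nat_zadd1 numeral_3_eq_3 le_nat_iff nat_le_iff_add add_Suc add_0 of_nat_numeral order_trans zero_le_numeral)
  have "\<exists>w w1 w2. (AE x in \<M>. u x = w x) \<and> C2_bounded ((B + 1) / 2 + sqrt (B + 1) + 2 * sqrt (B + 1) + (B + 1) / 2) (1/2) w w1 w2"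
    if u: "sobolev_norm_sq (nat \<lfloor>s\<rfloor>) (frac s) u < ennreal B" for u
  proof -
    obtain v1 where v1: "has_weak_deriv u v1" "sobolev_norm_sq (Suc (Suc m)) (frac s) v1 < ennreal B"
      using sobolev_norm_sq_Suc_less[OF u[unfolded n]] by blast
    obtain v2 where v2: "has_weak_deriv v1 v2" "sobolev_norm_sq (Suc m) (frac s) v2 < ennreal B"
      using sobolev_norm_sq_Suc_less[OF v1(2)] by blast
    obtain v3 where v3: "has_weak_deriv v2 v3" "sobolev_norm_sq m (frac s) v3 < ennreal B"
      using sobolev_norm_sq_Suc_less[OF v2(2)] by blast
    have L2: "L2_norm_sq u \<le> ennreal B" "L2_norm_sq v1 \<le> ennreal B" "L2_norm_sq v2 \<le> ennreal B" "L2_norm_sq v3 \<le> ennreal B"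
      using order_trans[OF L2_norm_sq_le_sobolev less_imp_le] u v1(2) v2(2) v3(2) by blast+
    have v3i: "integrable \<M> v3" using v3(1) by (simp add: has_weak_deriv_def)
    obtain C where C: "AE x in \<M>. v2 x = C + integral {0..x} v3"
      using weak_deriv_imp_AE_indefinite_integral[OF v3(1)] ..
    define w2 where "w2 x = C + integral {0..x} v3" for x
    have *: "norm (w2 d - w2 c) \<le> (B + 1) / 2 * \<bar>d - c\<bar> powr (1/2)" if cd: "0 \<le> c" "c < d" "d \<le> 1" for c d
    proof -
      have "w2 d - w2 c = integral {c..d} v3"
        using Henstock_Kurzweil_Integration.integral_combine[OF cd(1) less_imp_le[OF cd(2)] integrable_on_Icc_of_unit(2)[OF v3i order_refl cd(3)]]
        by (simp add: w2_def algebra_simps)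
      \<comment> \<open>The parameter \<open>sqrt (d - c)\<close> gives both terms of the weighted
        bound the same power of \<open>d - c\<close> and so produces the exponent 1/2.\<close>
      also have "norm \<dots> \<le> (sqrt (d - c) * B + (d - c) / sqrt (d - c)) / 2"
        using cd by (intro norm_integral_le_L2[OF v3i L2(4) B]) auto
      also have "\<dots> = (B + 1) / 2 * sqrt (d - c)"
        using cd by (simp add: real_div_sqrt field_simps)
      also have "\<dots> = (B + 1) / 2 * \<bar>d - c\<bar> powr (1/2)" using cd by (simp add: powr_half_sqrt)
      finally show ?thesis .
    qed
    have hoelder: "norm (w2 x - w2 y) \<le> (B + 1) / 2 * \<bar>x - y\<bar> powr (1/2)" if "x \<in> {0..1}" "y \<in> {0..1}" for x y
      using *[of x y] *[of y x] that B by (cases x y rule: linorder_cases) (auto simp: norm_minus_commute abs_minus_commute)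
    have w2_cont: "continuous_on {0..1} w2"
      unfolding w2_def by (intro continuous_intros indefinite_integral_continuous_unit[OF v3i])
    have "norm (w2 x - w2 y) \<le> (B + 1) / 2" if "x \<in> {0..1}" "y \<in> {0..1}" for x y
    proof -
      have "\<bar>x - y\<bar> powr (1/2) \<le> 1" using that powr_mono2[of "1/2" "\<bar>x - y\<bar>" 1] by auto
      then have "(B + 1) / 2 * \<bar>x - y\<bar> powr (1/2) \<le> (B + 1) / 2" using B by (intro mult_left_le) auto
      then show ?thesis using hoelder[OF that] by linarith
    qed
    then have w2_le: "norm (w2 x) \<le> (B + 1) / 2 + sqrt (B + 1)" if "x \<in> {0..1}" for x
      using norm_le_oscillation_plus_L2[OF C[folded w2_def] L2(3) B _ that] by blast
    obtain w1 where w1: "AE x in \<M>. v1 x = w1 x"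
        "\<And>x. x \<in> {0..1} \<Longrightarrow> (w1 has_vector_derivative w2 x) (at x within {0..1})"
      using weak_deriv_continuous_imp_classical[OF v2(1) C[folded w2_def] w2_cont] by blast
    from weak_deriv_imp_C2_bounded[OF v1(1) w1(1) L2(1,2) B w1(2) w2_le hoelder] B
    show ?thesis by auto
  qed
  then show ?thesis by (intro exI[of _ "(B + 1) / 2 + sqrt (B + 1) + 2 * sqrt (B + 1) + (B + 1) / 2"] exI[of _ "1/2"]) auto
qed

lemma Hs_norm_le_imp_sobolev_less:
  assumes "Hs_norm s u \<le> ennreal M" "M \<ge> 0"
  shows "sobolev_norm_sq (nat \<lfloor>s\<rfloor>) (frac s) u < ennreal (M\<^sup>2 + 1)"
proof -
  define N where "N = sobolev_norm_sq (nat \<lfloor>s\<rfloor>) (frac s) u"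
  have N: "N \<noteq> \<infinity>" using assms by (auto simp: Hs_norm_def Let_def N_def top_unique split: if_splits)
  then have "sqrt (enn2real N) \<le> M" using assms by (simp add: Hs_norm_def Let_def N_def)
  then have "enn2real N \<le> M\<^sup>2" by (simp add: real_sqrt_le_iff real_le_lsqrt sqrt_le_D)
  then have "enn2real N < M\<^sup>2 + 1" by simp
  then have "ennreal (enn2real N) < ennreal (M\<^sup>2 + 1)" by (simp add: ennreal_less_iff del: ennreal_plus)
  then show ?thesis using N by (simp add: N_def[symmetric] less_top)
qed

subsection \<open>Growth of the second derivative at the boundary\<close>

text \<open>\<open>F h\<close> stands for a smoothed boundary value and \<open>G\<close> for the
  time derivative in the limit of small h. If \<open>t * G t\<close> tends to \<open>l\<close>, then
  \<open>F h\<close> changes by about \<open>l * ln (T1 / T0)\<close> between \<open>T0\<close> and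
  \<open>T1\<close>, which for nonzero \<open>l\<close> and large \<open>T1\<close> contradicts
  \<open>bound\<close>. The approximation is required only on \<open>{0..T}\<close> with
  \<open>h\<close> depending on \<open>T\<close>, as the window is fixed before
  \<open>h\<close>.\<close>

lemma logarithmic_growth_contradiction:
  fixes F D :: "real \<Rightarrow> real \<Rightarrow> complex" and G :: "real \<Rightarrow> complex"
  assumes bound: "\<And>h t. 0 < h \<Longrightarrow> h \<le> 1 \<Longrightarrow> t \<ge> 0 \<Longrightarrow> norm (F h t) \<le> C"
    and deriv: "\<And>h t. 0 < h \<Longrightarrow> h \<le> 1 \<Longrightarrow> t \<ge> 0 \<Longrightarrow> (F h has_vector_derivative D h t) (at t within {0..})"
    and approx: "\<And>T \<epsilon>. \<epsilon> > 0 \<Longrightarrow> \<exists>h>0. h \<le> 1 \<and> (\<forall>t\<in>{0..T}. norm (D h t - G t) \<le> \<epsilon>)"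
    and lim: "((\<lambda>t. of_real t * G t) \<longlongrightarrow> l) at_top"
  shows "l = 0"
proof (rule ccontr)
  assume "l \<noteq> 0"
  \<comment> \<open>A quarter leaves room for two errors of at most \<open>e / t\<close> each, from
    replacing \<open>D h t\<close> by \<open>G t\<close> and \<open>G t\<close> by
    \<open>l / t\<close>. Together they use up half of \<open>norm l = 4 * e\<close>.\<close>
  define e where "e = norm l / 4"
  have e: "e > 0" using \<open>l \<noteq> 0\<close> by (simp add: e_def)
  have "eventually (\<lambda>t. dist (of_real t * G t) l < e) at_top" using lim e by (rule tendstoD)
  then obtain N where N: "\<And>t. t \<ge> N \<Longrightarrow> dist (of_real t * G t) l < e"
    by (auto simp: eventually_at_top_linorder)
  define T0 where "T0 = max 1 N"
  have T0: "T0 \<ge> 1" and TN: "\<And>t. t \<ge> T0 \<Longrightarrow> norm (of_real t * G t - l) \<le> e"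
    using N by (auto simp: T0_def dist_norm less_imp_le)
  have "C \<ge> 0" using order_trans[OF norm_ge_zero bound[of 1 0]] by simp
  \<comment> \<open>This is \<open>ln T1 - ln T0\<close>. The estimates end in
    \<open>x * e \<le> C\<close>, which the choice of \<open>x\<close> violates.\<close>
  define x where "x = (C + 1) / e"
  have x: "x > 0" using \<open>C \<ge> 0\<close> e by (simp add: x_def)
  define T1 where "T1 = T0 * exp x"
  have T01: "T0 < T1" using T0 x by (simp add: T1_def)
  have T1: "T1 > 0" using T0 T01 by linarith
  have lnx: "ln T1 - ln T0 = x" using T0 by (simp add: T1_def ln_mult)
  obtain h where h: "h > 0" "h \<le> 1" "\<And>t. t \<in> {0..T1} \<Longrightarrow> norm (D h t - G t) \<le> e / T1"
    using approx[of "e / T1" T1] e T1 by auto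
  define H where "H t = F h t - of_real (ln t) * l" for t
  have Hd: "(H has_vector_derivative D h t - of_real (inverse t) * l) (at t within {T0..T1})"
    if t: "t \<in> {T0..T1}" for t
    unfolding H_def
    by (intro derivative_intros has_vector_derivative_within_subset[OF deriv[OF h(1,2)]] has_vector_derivative_of_real
        has_real_derivative_iff_has_vector_derivative[THEN iffD1] DERIV_subset[OF DERIV_ln])
      (use t T0 in auto)
  have "norm (H T1 - H T0) \<le> 2 * e * ln T1 - 2 * e * ln T0"
  proof (rule differentiable_bound_general[where f = H and \<phi> = "\<lambda>t. 2 * e * ln t" and f' = "\<lambda>t. D h t - of_real (inverse t) * l"
        and \<phi>' = "\<lambda>t. 2 * e * inverse t"])
    show "continuous_on {T0..T1} H"
      by (rule continuous_on_vector_derivative[OF Hd])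
    show "continuous_on {T0..T1} (\<lambda>t. 2 * e * ln t)"
      using T0 by (intro continuous_intros) auto
    fix t assume t: "T0 < t" "t < T1"
    have t0: "t > 0" using t T0 by auto
    show "(H has_vector_derivative D h t - of_real (inverse t) * l) (at t)"
      using Hd[of t] t at_within_interior[of t "{T0..T1}"] by simp
    show "((\<lambda>t. 2 * e * ln t) has_vector_derivative 2 * e * inverse t) (at t)"
      unfolding has_real_derivative_iff_has_vector_derivative[symmetric]
      using t0 by (auto intro!: derivative_eq_intros simp: divide_simps)
    have "G t - of_real (inverse t) * l = of_real (inverse t) * (of_real t * G t - l)"
      using t0 by (simp add: algebra_simps)
    then have "norm (G t - of_real (inverse t) * l) = inverse t * norm (of_real t * G t - l)"
      using t0 by (simp only: norm_mult norm_of_real) simp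
    also have "\<dots> \<le> inverse t * e" using TN[of t] t t0 by (intro mult_left_mono) auto
    finally have 1: "norm (G t - of_real (inverse t) * l) \<le> inverse t * e" .
    have "e / T1 \<le> inverse t * e" using t t0 e by (simp add: divide_simps)
    moreover have "norm (D h t - G t) \<le> e / T1" using h(3)[of t] t T0 by auto
    moreover have "norm (D h t - of_real (inverse t) * l) \<le> norm (D h t - G t) + norm (G t - of_real (inverse t) * l)"
      using norm_triangle_ineq[of "D h t - G t" "G t - of_real (inverse t) * l"] by simp
    ultimately show "norm (D h t - of_real (inverse t) * l) \<le> 2 * e * inverse t"
      using 1 mult_2[of "inverse t * e"] by (simp only: mult_ac)
  qed (rule T01)
  also have "\<dots> = 2 * e * x" by (simp add: lnx[symmetric] algebra_simps)
  finally have Hb: "norm (H T1 - H T0) \<le> 2 * e * x" .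
  have "of_real x * l = (F h T1 - F h T0) - (H T1 - H T0)"
    by (simp add: H_def lnx[symmetric] algebra_simps)
  then have "norm (of_real x * l) \<le> norm (F h T1 - F h T0) + norm (H T1 - H T0)"
    using norm_triangle_ineq4 by metis
  also have "\<dots> \<le> (C + C) + 2 * e * x"
    using Hb bound[OF h(1,2), of T1] bound[OF h(1,2), of T0] T0 T1 norm_triangle_ineq4[of "F h T1" "F h T0"] by simp
  finally have "x * (4 * e) \<le> 2 * C + 2 * e * x"
    using x by (simp add: norm_mult e_def)
  then have "x * e \<le> C" by (simp add: mult.commute)
  then show False using e by (simp add: x_def)
qed

section \<open>Second order coefficients from weighted integrals\<close>

lemma has_integral_moment1:
  fixes h :: real
  assumes "h > 0"
  shows "((\<lambda>y. (3 * y / h - 2) * y) has_integral 0) {0..h}"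
proof -
  have "((\<lambda>y. (3 * y / h - 2) * y) has_integral ((h ^ 3 / h - h ^ 2) - (0 ^ 3 / h - 0 ^ 2))) {0..h}"
    using assms by (intro fundamental_theorem_of_calculus)
      (auto intro!: derivative_eq_intros simp: has_real_derivative_iff_has_vector_derivative[symmetric] algebra_simps power2_eq_square)
  then show ?thesis using assms by (simp add: power3_eq_cube power2_eq_square)
qed

lemma has_integral_moment2:
  fixes h :: real
  assumes "h > 0"
  shows "((\<lambda>y. (3 * y / h - 2) * y\<^sup>2) has_integral (h ^ 3 / 12)) {0..h}"
proof -
  have "((\<lambda>y. (3 * y / h - 2) * y\<^sup>2) has_integral
      ((3 * h ^ 4 / (4 * h) - 2 * h ^ 3 / 3) - (3 * 0 ^ 4 / (4 * h) - 2 * 0 ^ 3 / 3))) {0..h}"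
    using assms by (intro fundamental_theorem_of_calculus)
      (auto intro!: derivative_eq_intros simp: has_real_derivative_iff_has_vector_derivative[symmetric]
        algebra_simps power2_eq_square power3_eq_cube)
  then show ?thesis using assms by (simp add: power_eq_if)
qed

text \<open>The weight \<open>3 y / h - 2\<close> annihilates \<open>y\<close>, so it extracts the second order coefficient at \<open>0\<close>
  of a function vanishing there.\<close>

lemma second_order_coefficient:
  fixes u :: "real \<Rightarrow> complex"
  assumes h: "h > 0" and u: "continuous_on {0..h} u"
    and est: "\<And>y. y \<in> {0..h} \<Longrightarrow> norm (u y - (of_real y * a + of_real (y\<^sup>2) * b)) \<le> \<epsilon> * y\<^sup>2"
  shows "norm (of_real (1 / h ^ 3) * integral {0..h} (\<lambda>y. of_real (3 * y / h - 2) * u y) - b / 12) \<le> 2 * \<epsilon>"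
proof -
  let ?w = "\<lambda>y. complex_of_real (3 * y / h - 2)"
  let ?p = "\<lambda>y. complex_of_real y * a + of_real (y\<^sup>2) * b"
  have "0 \<le> \<epsilon> * h\<^sup>2" using est[of h] h by (auto intro: order_trans[OF norm_ge_zero])
  then have eps: "\<epsilon> \<ge> 0" using h by (simp add: zero_le_mult_iff)
  have "((\<lambda>y. of_real ((3 * y / h - 2) * y) * a + of_real ((3 * y / h - 2) * y\<^sup>2) * b)
      has_integral (of_real 0 * a + of_real (h ^ 3 / 12) * b)) {0..h}"
    by (intro has_integral_add has_integral_mult_left has_integral_of_real has_integral_moment1 has_integral_moment2 h)
  then have p: "((\<lambda>y. ?w y * ?p y) has_integral (of_real (h ^ 3 / 12) * b)) {0..h}"
    by (simp add: algebra_simps)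
  have c: "continuous_on {0..h} (\<lambda>y. ?w y * (u y - ?p y))" "continuous_on {0..h} (\<lambda>y. ?w y * u y)"
    using h by (auto intro!: continuous_intros u)
  have "integral {0..h} (\<lambda>y. ?w y * (u y - ?p y)) = integral {0..h} (\<lambda>y. ?w y * u y - ?w y * ?p y)"
    by (simp add: right_diff_distrib)
  also have "\<dots> = integral {0..h} (\<lambda>y. ?w y * u y) - of_real (h ^ 3 / 12) * b"
    using integral_diff[OF integrable_continuous_real[OF c(2)] has_integral_integrable[OF p]] integral_unique[OF p] by simp
  finally have eq: "integral {0..h} (\<lambda>y. ?w y * u y) - of_real (h ^ 3 / 12) * b = integral {0..h} (\<lambda>y. ?w y * (u y - ?p y))" by simp
  have "norm (integral {0..h} (\<lambda>y. ?w y * (u y - ?p y))) \<le> (2 * (\<epsilon> * h\<^sup>2)) * (h - 0)"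
  proof (rule integral_bound[OF _ c(1)])
    fix y assume y: "y \<in> {0..h}"
    have "\<bar>3 * y / h - 2\<bar> \<le> 2" using y h by (auto simp: abs_le_iff divide_simps)
    then have w: "norm (?w y) \<le> 2" by (metis norm_of_real)
    have "y\<^sup>2 \<le> h\<^sup>2" using y by (intro power_mono) auto
    then have "norm (u y - ?p y) \<le> \<epsilon> * h\<^sup>2" using est[OF y] eps by (meson mult_left_mono order_trans)
    with w show "norm (?w y * (u y - ?p y)) \<le> 2 * (\<epsilon> * h\<^sup>2)"
      unfolding norm_mult by (intro mult_mono) auto
  qed (use h in auto)
  then have *: "norm (integral {0..h} (\<lambda>y. ?w y * u y) - of_real (h ^ 3 / 12) * b) \<le> 2 * \<epsilon> * h ^ 3"
    unfolding eq by (simp add: power2_eq_square power3_eq_cube mult_ac)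
  have "of_real (1 / h ^ 3) * integral {0..h} (\<lambda>y. ?w y * u y) - b / 12
      = of_real (1 / h ^ 3) * (integral {0..h} (\<lambda>y. ?w y * u y) - of_real (h ^ 3 / 12) * b)"
    using h by (simp add: right_diff_distrib)
  then have "norm (of_real (1 / h ^ 3) * integral {0..h} (\<lambda>y. ?w y * u y) - b / 12)
      = 1 / h ^ 3 * norm (integral {0..h} (\<lambda>y. ?w y * u y) - of_real (h ^ 3 / 12) * b)"
    using h by (simp only: norm_mult norm_of_real) simp
  also have "\<dots> \<le> 1 / h ^ 3 * (2 * \<epsilon> * h ^ 3)" using * h by (intro mult_left_mono) auto
  also have "\<dots> = 2 * \<epsilon>" using h by simp
  finally show ?thesis .
qed

lemma taylor_first_order:
  fixes u :: "real \<Rightarrow> complex"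
  assumes "h \<le> 1" and u: "\<And>y. y \<in> {0..1} \<Longrightarrow> (u has_vector_derivative u1 y) (at y within {0..1})"
    and est: "\<And>y. y \<in> {0..h} \<Longrightarrow> norm (u1 y - u1 0) \<le> \<epsilon>" and y: "y \<in> {0..h}"
  shows "norm (u y - u 0 - of_real y * u1 0) \<le> \<epsilon> * y"
proof -
  have "norm ((u y - of_real y * u1 0) - (u 0 - of_real 0 * u1 0)) \<le> \<epsilon> * (y - 0)"
  proof (rule norm_diff_le_of_vector_derivative)
    fix x assume x: "x \<in> {0..y}"
    have "((\<lambda>x. u x - of_real x * u1 0) has_vector_derivative u1 x - of_real 1 * u1 0) (at x within {0..y})"
      using x y assms(1)
      by (intro derivative_intros has_vector_derivative_within_subset[OF u] has_vector_derivative_of_real) auto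
    then show "((\<lambda>x. u x - of_real x * u1 0) has_vector_derivative u1 x - u1 0) (at x within {0..y})" by simp
    show "norm (u1 x - u1 0) \<le> \<epsilon>" using est x y by auto
  qed (use y in auto)
  then show ?thesis by (simp add: algebra_simps)
qed

lemma taylor_second_order:
  fixes u :: "real \<Rightarrow> complex"
  assumes h: "h \<le> 1" and u: "\<And>y. y \<in> {0..1} \<Longrightarrow> (u has_vector_derivative u1 y) (at y within {0..1})"
    and u1: "\<And>y. y \<in> {0..1} \<Longrightarrow> (u1 has_vector_derivative u2 y) (at y within {0..1})"
    and est: "\<And>y. y \<in> {0..h} \<Longrightarrow> norm (u2 y - u2 0) \<le> \<epsilon>" and y: "y \<in> {0..h}"
  shows "norm (u y - u 0 - of_real y * u1 0 - of_real (y\<^sup>2) * (u2 0 / 2)) \<le> \<epsilon> * y\<^sup>2"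
proof -
  have eps: "\<epsilon> \<ge> 0" using est[of y] y norm_ge_zero order_trans by blast
  let ?v = "\<lambda>x. u x - of_real x * u1 0 - of_real (x\<^sup>2) * (u2 0 / 2)"
  have "norm (?v y - ?v 0) \<le> (\<epsilon> * y) * (y - 0)"
  proof (rule norm_diff_le_of_vector_derivative)
    fix x assume x: "x \<in> {0..y}"
    have sq: "((\<lambda>x. complex_of_real (x\<^sup>2)) has_vector_derivative of_real (2 * x)) (at x within {0..y})"
      by (rule has_vector_derivative_real) (auto intro!: derivative_eq_intros)
    have "(?v has_vector_derivative u1 x - of_real 1 * u1 0 - of_real (2 * x) * (u2 0 / 2)) (at x within {0..y})"
      using x y h
      by (intro has_vector_derivative_diff has_vector_derivative_mult_left sq has_vector_derivative_within_subset[OF u]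
          has_vector_derivative_of_real has_vector_derivative_id) auto
    then show "(?v has_vector_derivative u1 x - u1 0 - of_real x * u2 0) (at x within {0..y})" by simp
    have "norm (u1 x - u1 0 - of_real x * u2 0) \<le> \<epsilon> * x"
      using taylor_first_order[OF h u1 est] x y by auto
    also have "\<dots> \<le> \<epsilon> * y" using eps x by (intro mult_left_mono) auto
    finally show "norm (u1 x - u1 0 - of_real x * u2 0) \<le> \<epsilon> * y" .
  qed (use y in auto)
  then show ?thesis by (simp add: algebra_simps power2_eq_square)
qed

text \<open>The problem in classical form, as it is available once the norms are bounded:
  \<open>W\<close> is the regular representative, and the stream function equation is a first order
  system for \<open>\<Phi>\<close> and \<open>\<Psi>\<close>. \<open>g_deriv\<close> is the chain
  rule for the shear profile. The evolution in time appears integrated against continuous weights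
  over subintervals, and the boundary values of \<open>W\<close> are prescribed at time 0. Neither
  \<open>k\<close> nor \<open>g\<close> has a fixed sign, so the reflected system is again an
  instance.\<close>

locale euler_channel =
  fixes k :: real and f f1 g :: "real \<Rightarrow> real" and W W1 W2 \<Phi> \<Psi> :: "real \<Rightarrow> real \<Rightarrow> complex"
  assumes k_nz: "k \<noteq> 0"
    and f_deriv: "\<And>y. y \<in> {0..1} \<Longrightarrow> (f has_real_derivative f1 y) (at y within {0..1})"
    and f1_cont: "continuous_on {0..1} f1"
    and g_nz: "\<And>y. y \<in> {0..1} \<Longrightarrow> g y \<noteq> 0"
    and g_deriv: "\<And>y. y \<in> {0..1} \<Longrightarrow> (g has_real_derivative f y / g y) (at y within {0..1})"
    and W_deriv: "\<And>t y. t \<ge> 0 \<Longrightarrow> y \<in> {0..1} \<Longrightarrow> (W t has_vector_derivative W1 t y) (at y within {0..1})"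
    and W1_deriv: "\<And>t y. t \<ge> 0 \<Longrightarrow> y \<in> {0..1} \<Longrightarrow> (W1 t has_vector_derivative W2 t y) (at y within {0..1})"
    and W_bound: "\<exists>M. \<forall>t\<ge>0. \<forall>y\<in>{0..1}. norm (W t y) \<le> M"
    and W1_bound: "\<exists>M. \<forall>t\<ge>0. \<forall>y\<in>{0..1}. norm (W1 t y) \<le> M"
    and W2_equi: "bdd_equicontinuous {0..} W2"
    and \<Phi>_deriv: "\<And>t y. t \<ge> 0 \<Longrightarrow> y \<in> {0..1} \<Longrightarrow>
      (\<Phi> t has_vector_derivative of_real k * (\<Psi> t y / of_real (g y) + \<i> * of_real t * \<Phi> t y)) (at y within {0..1})"
    and \<Psi>_deriv: "\<And>t y. t \<ge> 0 \<Longrightarrow> y \<in> {0..1} \<Longrightarrow>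
      (\<Psi> t has_vector_derivative of_real k * ((\<Phi> t y + W t y) / of_real (g y) + \<i> * of_real t * \<Psi> t y)) (at y within {0..1})"
    and \<Phi>_0: "\<And>t. t \<ge> 0 \<Longrightarrow> \<Phi> t 0 = 0"
    and \<Phi>_1: "\<And>t. t \<ge> 0 \<Longrightarrow> \<Phi> t 1 = 0"
    and time_deriv: "\<And>t c d \<rho>. t \<ge> 0 \<Longrightarrow> 0 \<le> c \<Longrightarrow> c \<le> d \<Longrightarrow> d \<le> 1 \<Longrightarrow> continuous_on UNIV \<rho> \<Longrightarrow>
      ((\<lambda>\<tau>. integral {c..d} (\<lambda>y. of_real (\<rho> y) * W \<tau> y)) has_vector_derivative
        \<i> / of_real k * integral {c..d} (\<lambda>y. of_real (\<rho> y) * (of_real (f y) * \<Phi> t y))) (at t within {0..})"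
    and W_init_0: "W 0 0 = 0" and W_init_1: "W 0 1 = 0"
begin

section \<open>Explicit homogeneous solutions and bounds uniform in time\<close>

lemma f_cont: "continuous_on {0..1} f"
  by (rule DERIV_continuous_on[OF f_deriv])

lemma g_cont: "continuous_on {0..1} g"
  by (rule DERIV_continuous_on[OF g_deriv])

definition r :: "real \<Rightarrow> real" where "r y = 1 / g y"

lemma r_deriv:
  assumes y: "y \<in> {0..1}"
  shows "(r has_real_derivative - f y * r y ^ 3) (at y within {0..1})"
proof -
  have "((\<lambda>y. 1 / g y) has_real_derivative (0 * g y - 1 * (f y / g y)) / (g y * g y)) (at y within {0..1})"
    using g_nz[OF y] by (intro DERIV_divide DERIV_const g_deriv y)
  moreover have "(\<lambda>y. 1 / g y) = r" by (simp add: fun_eq_iff r_def)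
  moreover have "(0 * g y - 1 * (f y / g y)) / (g y * g y) = - f y * r y ^ 3"
    by (simp add: r_def power3_eq_cube)
  ultimately show ?thesis by (simp only:)
qed

lemma r_cont: "continuous_on {0..1} r"
  by (rule DERIV_continuous_on[OF r_deriv])

text \<open>In the variable \<open>P\<close>, and after multiplication by
  \<open>phase (k * t)\<close>, the system has constant coefficients: the derivative of \<Phi> is
  \<Psi> and that of \<Psi> is \<Phi> + W. Hence the hyperbolic functions and exponentials of
  \<open>P\<close> below.\<close>

definition P :: "real \<Rightarrow> real" where "P y = integral {0..y} (\<lambda>x. k * r x)"

lemma P_deriv: "y \<in> {0..1} \<Longrightarrow> (P has_real_derivative k * r y) (at y within {0..1})"
  unfolding P_def[abs_def]
  by (rule integral_has_real_derivative) (auto intro!: continuous_intros r_cont)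

lemma P_cont: "continuous_on {0..1} P"
  by (rule DERIV_continuous_on[OF P_deriv])

lemma P_0: "P 0 = 0" by (simp add: P_def)

lemma P_1_nz: "P 1 \<noteq> 0"
proof
  assume "P 1 = 0"
  have "\<exists>z>0. z < 1 \<and> P 1 - P 0 = (1 - 0) * (k * r z)"
  proof (rule mvt)
    show "((P has_derivative (\<lambda>h. h * (k * r x))) (at x))" if "0 < x" "x < 1" for x
      using P_deriv[of x] that at_within_interior[of x "{0..1}"]
      by (simp add: has_field_derivative_def mult.commute[of "k * r x"] fun_eq_iff has_derivative_eq_rhs)
  qed (use P_cont in auto)
  then show False using \<open>P 1 = 0\<close> P_0 k_nz g_nz by (auto simp: r_def)
qed

text \<open>The homogeneous solution with value 1 at \<open>y = 0\<close> and 0 at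
  \<open>y = 1\<close>; \<open>B\<close> is minus its derivative with respect to \<open>P\<close>.
  As \<open>\<Phi>\<close> vanishes at both ends, these boundary values reduce
  \<open>B \<Phi> + A \<Psi>\<close> to \<open>\<Psi> t 0\<close> at 0 and to 0 at 1.\<close>

definition A :: "real \<Rightarrow> real" where "A y = sinh (P 1 - P y) / sinh (P 1)"
definition B :: "real \<Rightarrow> real" where "B y = cosh (P 1 - P y) / sinh (P 1)"

lemma A_deriv: "y \<in> {0..1} \<Longrightarrow> (A has_real_derivative - k * r y * B y) (at y within {0..1})"
  unfolding A_def[abs_def] B_def using P_1_nz
  by (auto intro!: derivative_eq_intros P_deriv)

lemma B_deriv: "y \<in> {0..1} \<Longrightarrow> (B has_real_derivative - k * r y * A y) (at y within {0..1})"
  unfolding B_def[abs_def] A_def using P_1_nz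
  by (auto intro!: derivative_eq_intros P_deriv)

lemma A_cont: "continuous_on {0..1} A" and B_cont: "continuous_on {0..1} B"
  by (rule DERIV_continuous_on[OF A_deriv] DERIV_continuous_on[OF B_deriv], assumption)+

lemma A_0: "A 0 = 1" and A_1: "A 1 = 0"
  using P_1_nz by (simp_all add: A_def P_0)

text \<open>The kernel against which \<open>W\<close> is integrated in \<open>\<Psi>_0_eq\<close>.
  Its derivatives \<open>q1\<close> and \<open>q2\<close> serve the two integrations by parts;
  \<open>q2\<close> contains \<open>f1\<close>, so the continuity of \<open>f1\<close> enters
  here.\<close>

definition q :: "real \<Rightarrow> real" where "q y = A y * r y"
definition q1 :: "real \<Rightarrow> real" where "q1 y = - k * B y * r y ^ 2 - A y * f y * r y ^ 3"
definition q2 :: "real \<Rightarrow> real" where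
  "q2 y = k\<^sup>2 * A y * r y ^ 3 + 3 * k * B y * f y * r y ^ 4 - A y * f1 y * r y ^ 3
     + 3 * A y * (f y)\<^sup>2 * r y ^ 5"

lemma q_deriv:
  assumes y: "y \<in> {0..1}"
  shows "(q has_real_derivative q1 y) (at y within {0..1})"
  unfolding q_def[abs_def]
  by (rule DERIV_cong, (rule derivative_intros A_deriv[OF y] r_deriv[OF y])+)
    (simp add: q1_def algebra_simps power_eq_if)

lemma q1_deriv:
  assumes y: "y \<in> {0..1}"
  shows "(q1 has_real_derivative q2 y) (at y within {0..1})"
  unfolding q1_def[abs_def]
  by (rule DERIV_cong, (rule derivative_intros A_deriv[OF y] B_deriv[OF y] r_deriv[OF y] f_deriv[OF y])+)
    (simp add: q2_def algebra_simps power_eq_if)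

lemma q_cont: "continuous_on {0..1} q" and q1_cont: "continuous_on {0..1} q1"
  and q2_cont: "continuous_on {0..1} q2"
  unfolding q_def[abs_def] q1_def[abs_def] q2_def[abs_def]
  by (intro continuous_intros A_cont B_cont r_cont f_cont f1_cont)+

lemma q_1: "q 1 = 0" and q_0: "q 0 = r 0"
  by (simp_all add: q_def A_0 A_1)

lemma \<Phi>_deriv': "t \<ge> 0 \<Longrightarrow> y \<in> {0..1} \<Longrightarrow>
    (\<Phi> t has_vector_derivative of_real k * (\<Psi> t y * of_real (r y) + \<i> * of_real t * \<Phi> t y)) (at y within {0..1})"
  using \<Phi>_deriv[of t y] by (simp add: r_def)

lemma \<Psi>_deriv': "t \<ge> 0 \<Longrightarrow> y \<in> {0..1} \<Longrightarrow>
    (\<Psi> t has_vector_derivative of_real k * ((\<Phi> t y + W t y) * of_real (r y) + \<i> * of_real t * \<Psi> t y)) (at y within {0..1})"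
  using \<Psi>_deriv[of t y] by (simp add: r_def)

lemma W_cont: "t \<ge> 0 \<Longrightarrow> continuous_on {0..1} (W t)"
  by (rule continuous_on_vector_derivative[OF W_deriv])
lemma \<Phi>_cont: "t \<ge> 0 \<Longrightarrow> continuous_on {0..1} (\<Phi> t)"
  by (rule continuous_on_vector_derivative[OF \<Phi>_deriv])
text \<open>The function \<open>B \<Phi> + A \<Psi>\<close>, unwound by the phase, satisfies an equation in which \<open>\<Phi>\<close> and \<open>\<Psi>\<close> do not occur.\<close>

lemma \<Psi>_0_eq:
  assumes t: "t \<ge> 0"
  shows "\<Psi> t 0 = - of_real k * integral {0..1} (\<lambda>y. phase (k * t) y * (W t y * of_real (q y)))"
proof -
  let ?Z = "\<lambda>y. phase (k * t) y * (of_real (B y) * \<Phi> t y + of_real (A y) * \<Psi> t y)"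
  have "((\<lambda>y. of_real k * (phase (k * t) y * (W t y * of_real (q y)))) has_integral (?Z 1 - ?Z 0)) {0..1}"
  proof (rule fundamental_theorem_of_calculus)
    fix y :: real assume y: "y \<in> {0..1}"
    show "(?Z has_vector_derivative of_real k * (phase (k * t) y * (W t y * of_real (q y)))) (at y within {0..1})"
      apply (rule has_vector_derivative_eq_rhs)
       apply (rule derivative_intros phase_deriv has_vector_derivative_real A_deriv[OF y] B_deriv[OF y] \<Phi>_deriv'[OF t y] \<Psi>_deriv'[OF t y])+
      by (simp add: q_def algebra_simps)
  qed simp
  then have "integral {0..1} (\<lambda>y. of_real k * (phase (k * t) y * (W t y * of_real (q y)))) = - \<Psi> t 0"
    using t \<Phi>_0 \<Phi>_1 A_0 A_1 by (simp only: integral_unique) simp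
  then show ?thesis by (simp add: minus_equation_iff)
qed

lemma W_equi: "bdd_equicontinuous {0..} W"
proof -
  obtain C D where "\<forall>t\<ge>0. \<forall>y\<in>{0..1}. norm (W t y) \<le> C" "\<forall>t\<ge>0. \<forall>y\<in>{0..1}. norm (W1 t y) \<le> D"
    using W_bound W1_bound by blast
  then show ?thesis
    using W_deriv by (intro bdd_equicontinuous_of_derivative[of _ W W1 C D]) auto
qed

lemma W1_equi: "bdd_equicontinuous {0..} W1"
proof -
  obtain C D where "\<And>t x. t \<in> {0..} \<Longrightarrow> x \<in> {0..1} \<Longrightarrow> norm (W2 t x) \<le> C"
      "\<forall>t\<ge>0. \<forall>y\<in>{0..1}. norm (W1 t y) \<le> D"
    using bdd_equicontinuous_bound[OF W2_equi] W1_bound by metis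
  then show ?thesis
    using W1_deriv by (intro bdd_equicontinuous_of_derivative[of _ W1 W2 D C]) auto
qed

lemma \<Psi>_0_bound: "\<exists>C. \<forall>t\<ge>0. norm (\<Psi> t 0) \<le> C"
proof -
  obtain M where M: "\<And>t y. t \<in> {0..} \<Longrightarrow> y \<in> {0..1} \<Longrightarrow> norm (W t y * of_real (q y)) \<le> M"
    using bdd_equicontinuous_bound[OF bdd_equicontinuous_mult[OF W_equi
      bdd_equicontinuous_const[OF continuous_on_of_real[OF q_cont]]]] by metis
  have "norm (\<Psi> t 0) \<le> \<bar>k\<bar> * M" if t: "t \<ge> 0" for t
  proof -
    have "norm (integral {0..1} (\<lambda>y. phase (k * t) y * (W t y * of_real (q y)))) \<le> M * (1 - 0)"
      using M t by (intro integral_bound continuous_intros W_cont q_cont) (auto simp: norm_mult)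
    then show ?thesis
      unfolding \<Psi>_0_eq[OF t] by (simp add: norm_mult mult_left_mono)
  qed
  then show ?thesis by blast
qed

text \<open>The sum and the difference of \<open>\<Phi>\<close> and \<open>\<Psi>\<close> decouple
  the system into scalar equations in \<open>P\<close>, solved with the integrating factor
  \<open>E\<close>. They start at 0 from \<open>\<Phi> t 0 = 0\<close> and the bounded value
  \<open>\<Psi> t 0\<close>. The phase has modulus 1, so the frequency does not enter the
  bound.\<close>

lemma \<Phi>\<Psi>_bound: "\<exists>K. \<forall>t\<ge>0. \<forall>y\<in>{0..1}. norm (\<Phi> t y) \<le> K \<and> norm (\<Psi> t y) \<le> K"
proof -
  obtain C where C: "\<And>t. t \<ge> 0 \<Longrightarrow> norm (\<Psi> t 0) \<le> C" using \<Psi>_0_bound by blast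
  have *: "\<exists>K. \<forall>t\<ge>0. \<forall>y\<in>{0..1}. norm (\<Phi> t y + of_real \<sigma> * \<Psi> t y) \<le> K" if \<sigma>: "\<sigma> = 1 \<or> \<sigma> = -1" for \<sigma> :: real
  proof -
    have a\<sigma>: "\<bar>\<sigma>\<bar> = 1" using \<sigma> by auto
    define E where "E y = exp (- \<sigma> * P y)" for y
    have E_deriv: "(E has_real_derivative - \<sigma> * (k * r y) * E y) (at y within {0..1})" if "y \<in> {0..1}" for y
      unfolding E_def[abs_def] using that by (auto intro!: derivative_eq_intros P_deriv)
    have E_cont: "continuous_on {0..1} E" unfolding E_def[abs_def] by (intro continuous_intros P_cont)
    have Ei_cont: "continuous_on {0..1} (\<lambda>y. complex_of_real (1 / E y))"
      unfolding E_def[abs_def] by (intro continuous_intros P_cont) auto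
    obtain D where D: "D > 0" "\<And>t x. t \<in> {0::real..} \<Longrightarrow> x \<in> {0..1} \<Longrightarrow>
        norm (of_real (\<sigma> * k * r x * E x) * W t x) \<le> D"
    proof -
      have "continuous_on {0..1} (\<lambda>x. complex_of_real (\<sigma> * k * r x * E x))"
        by (intro continuous_intros r_cont E_cont)
      from bdd_equicontinuous_bound[OF bdd_equicontinuous_mult[OF bdd_equicontinuous_const[OF this] W_equi]]
      show ?thesis using that by blast
    qed
    obtain F where F: "F > 0" "\<And>t x. t \<in> {0::real..} \<Longrightarrow> x \<in> {0..1} \<Longrightarrow> norm (complex_of_real (1 / E x)) \<le> F"
      by (rule bdd_equicontinuous_bound[OF bdd_equicontinuous_const[OF Ei_cont]]) blast
    have "norm (\<Phi> t y + of_real \<sigma> * \<Psi> t y) \<le> F * (C + D)" if t: "t \<ge> 0" and y: "y \<in> {0..1}" for t y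
    proof -
      let ?Z = "\<lambda>y. phase (k * t) y * (of_real (E y) * (\<Phi> t y + of_real \<sigma> * \<Psi> t y))"
      have Zd: "(?Z has_vector_derivative phase (k * t) x * (of_real (\<sigma> * k * r x * E x) * W t x)) (at x within {0..1})"
        if x: "x \<in> {0..1}" for x
        apply (rule has_vector_derivative_eq_rhs)
         apply (rule derivative_intros phase_deriv has_vector_derivative_real E_deriv[OF x] \<Phi>_deriv'[OF t x] \<Psi>_deriv'[OF t x])+
        using \<sigma> by (elim disjE) (simp_all add: algebra_simps)
      have "norm (?Z y - ?Z 0) \<le> D * (y - 0)"
      proof (rule norm_diff_le_of_vector_derivative)
        show "(?Z has_vector_derivative phase (k * t) x * (of_real (\<sigma> * k * r x * E x) * W t x)) (at x within {0..y})"
          if "x \<in> {0..y}" for x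
          by (rule has_vector_derivative_within_subset[OF Zd]) (use that y in auto)
        show "norm (phase (k * t) x * (of_real (\<sigma> * k * r x * E x) * W t x)) \<le> D" if "x \<in> {0..y}" for x
          using D(2)[of t x] that y t by (simp add: norm_mult)
      qed (use y in auto)
      also have "\<dots> \<le> D" using D y by simp
      finally have "norm (?Z y) \<le> norm (?Z 0) + D" by (smt (verit) norm_triangle_ineq2)
      moreover have "norm (?Z 0) \<le> C"
        using C[OF t] t a\<sigma> by (simp add: norm_mult E_def P_0 \<Phi>_0)
      ultimately have Z: "norm (?Z y) \<le> C + D" by simp
      have "\<Phi> t y + of_real \<sigma> * \<Psi> t y = of_real (1 / E y) * (of_real (E y) * (\<Phi> t y + of_real \<sigma> * \<Psi> t y))"
        by (simp add: E_def)
      then have "norm (\<Phi> t y + of_real \<sigma> * \<Psi> t y) = norm (complex_of_real (1 / E y)) * norm (?Z y)"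
        by (metis norm_mult norm_phase mult_1)
      also have "\<dots> \<le> F * (C + D)"
        using F(1) F(2)[of t y] Z y t by (intro mult_mono) auto
      finally show ?thesis .
    qed
    then show ?thesis by blast
  qed
  from *[of 1] *[of "- 1"] obtain K L where
    K: "\<forall>t\<ge>0. \<forall>y\<in>{0..1}. norm (\<Phi> t y + \<Psi> t y) \<le> K" and L: "\<forall>t\<ge>0. \<forall>y\<in>{0..1}. norm (\<Phi> t y - \<Psi> t y) \<le> L"
    by auto
  have aux: "norm p \<le> K + L \<and> norm q \<le> K + L" if "norm (p + q) \<le> K" "norm (p - q) \<le> L" for p q :: complex
  proof -
    have "norm (2 * p) = norm ((p + q) + (p - q))" "norm (2 * q) = norm ((p + q) - (p - q))" by simp_all
    then have "2 * norm p \<le> K + L" "2 * norm q \<le> K + L"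
      using that norm_triangle_ineq[of "p + q" "p - q"] norm_triangle_ineq4[of "p + q" "p - q"]
      by (simp_all only: norm_mult norm_numeral)
    then show ?thesis by (smt (verit) norm_ge_zero)
  qed
  show ?thesis
    using K L by (intro exI[of _ "K + L"] allI impI ballI aux) auto
qed

end

section \<open>Regularity in y on bounded time intervals, and vanishing of W at the boundary\<close>

context euler_channel begin

text \<open>\<open>\<Phi>1\<close>, \<open>\<Psi>1\<close> and \<open>\<Phi>2\<close> are
  y-derivatives with the system substituted. Because of the explicit factor \<open>t\<close>, their
  equicontinuity is claimed for bounded times.\<close>

definition \<Phi>1 :: "real \<Rightarrow> real \<Rightarrow> complex" where
  "\<Phi>1 t y = of_real k * (\<Psi> t y * of_real (r y) + of_real t * (\<i> * \<Phi> t y))"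
definition \<Psi>1 :: "real \<Rightarrow> real \<Rightarrow> complex" where
  "\<Psi>1 t y = of_real k * ((\<Phi> t y + W t y) * of_real (r y) + of_real t * (\<i> * \<Psi> t y))"
definition \<Phi>2 :: "real \<Rightarrow> real \<Rightarrow> complex" where
  "\<Phi>2 t y = of_real k * (\<Psi>1 t y * of_real (r y) + \<Psi> t y * of_real (- f y * r y ^ 3) + of_real t * (\<i> * \<Phi>1 t y))"

lemma \<Phi>_vder: "t \<ge> 0 \<Longrightarrow> y \<in> {0..1} \<Longrightarrow> (\<Phi> t has_vector_derivative \<Phi>1 t y) (at y within {0..1})"
  using \<Phi>_deriv'[of t y] by (simp add: \<Phi>1_def mult_ac)

lemma \<Psi>_vder: "t \<ge> 0 \<Longrightarrow> y \<in> {0..1} \<Longrightarrow> (\<Psi> t has_vector_derivative \<Psi>1 t y) (at y within {0..1})"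
  using \<Psi>_deriv'[of t y] by (simp add: \<Psi>1_def mult_ac)

lemma \<Phi>1_vder:
  assumes t: "t \<ge> 0" and y: "y \<in> {0..1}"
  shows "(\<Phi>1 t has_vector_derivative \<Phi>2 t y) (at y within {0..1})"
  unfolding \<Phi>1_def[abs_def]
  by (rule has_vector_derivative_eq_rhs,
      (rule derivative_intros has_vector_derivative_real r_deriv[OF y] \<Phi>_vder[OF t y] \<Psi>_vder[OF t y])+)
    (simp add: \<Phi>2_def algebra_simps)

lemma equi_time: "bdd_equicontinuous {0..T} (\<lambda>t y. complex_of_real t)"
  by (rule bdd_equicontinuous_param[of _ _ T]) auto

lemma equi_of_real:
  "continuous_on {0..1} u \<Longrightarrow> bdd_equicontinuous X (\<lambda>t y. complex_of_real (u y))"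
  by (intro bdd_equicontinuous_const continuous_intros)

lemma equi_const: "bdd_equicontinuous X (\<lambda>t y. c)"
  by (intro bdd_equicontinuous_const continuous_intros)

lemmas equi_intros = bdd_equicontinuous_add bdd_equicontinuous_mult equi_const equi_time

lemma equi_first:
  "bdd_equicontinuous {0..T} \<Phi>" "bdd_equicontinuous {0..T} \<Psi>"
proof -
  obtain K where K: "\<And>t y. t \<ge> 0 \<Longrightarrow> y \<in> {0..1} \<Longrightarrow> norm (\<Phi> t y) \<le> K \<and> norm (\<Psi> t y) \<le> K"
    using \<Phi>\<Psi>_bound by blast
  obtain M where M: "\<And>t y. t \<in> {0..} \<Longrightarrow> y \<in> {0..1} \<Longrightarrow> norm (W t y) \<le> M"
    using bdd_equicontinuous_bound[OF W_equi] by metis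
  obtain R where R: "\<And>t y. t \<in> {0::real..} \<Longrightarrow> y \<in> {0..1} \<Longrightarrow> norm (complex_of_real (r y)) \<le> R"
    using bdd_equicontinuous_bound[OF equi_of_real[OF r_cont]] by metis
  have aux: "norm (of_real k * (a * of_real (r y) + of_real t * (\<i> * b))) \<le> \<bar>k\<bar> * ((K + M) * R + T * K)"
    if "norm a \<le> K + M" "norm b \<le> K" "t \<in> {0..T}" "y \<in> {0..1}" for a b t y
  proof -
    have "norm (a * of_real (r y) + of_real t * (\<i> * b)) \<le> norm a * norm (complex_of_real (r y)) + \<bar>t\<bar> * norm b"
      using norm_triangle_ineq[of "a * of_real (r y)" "of_real t * (\<i> * b)"] by (simp add: norm_mult)
    also have "\<dots> \<le> (K + M) * R + T * K"
      using that R[of 0 y] order_trans[OF norm_ge_zero that(1)]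
      by (intro add_mono mult_mono) (auto simp del: norm_of_real)
    finally show ?thesis by (simp add: norm_mult mult_left_mono)
  qed
  have M0: "M \<ge> 0" using M[of 0 0] order_trans[OF norm_ge_zero] by auto
  show "bdd_equicontinuous {0..T} \<Phi>"
  proof (rule bdd_equicontinuous_of_derivative[of _ \<Phi> \<Phi>1])
    fix t y :: real assume *: "t \<in> {0..T}" "y \<in> {0..1}"
    have "norm (\<Psi> t y) \<le> K + M" using K[of t y] M0 * by auto
    then show "norm (\<Phi>1 t y) \<le> \<bar>k\<bar> * ((K + M) * R + T * K)"
      unfolding \<Phi>1_def using K[of t y] * by (intro aux) auto
  qed (use K \<Phi>_vder in auto)
  show "bdd_equicontinuous {0..T} \<Psi>"
  proof (rule bdd_equicontinuous_of_derivative[of _ \<Psi> \<Psi>1])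
    fix t y :: real assume *: "t \<in> {0..T}" "y \<in> {0..1}"
    have "norm (\<Phi> t y + W t y) \<le> K + M" using K[of t y] M[of t y] * by (auto intro!: norm_triangle_le add_mono)
    then show "norm (\<Psi>1 t y) \<le> \<bar>k\<bar> * ((K + M) * R + T * K)"
      unfolding \<Psi>1_def using K[of t y] * by (intro aux) auto
  qed (use K \<Psi>_vder in auto)
qed

lemma W_equi': "bdd_equicontinuous {0..T} W"
  by (rule bdd_equicontinuous_subset[OF W_equi]) auto

lemma equi_\<Phi>1: "bdd_equicontinuous {0..T} \<Phi>1"
  unfolding \<Phi>1_def[abs_def] by (intro equi_intros equi_first equi_of_real r_cont)

lemma equi_\<Psi>1: "bdd_equicontinuous {0..T} \<Psi>1"
  unfolding \<Psi>1_def[abs_def] by (intro equi_intros equi_first W_equi' equi_of_real r_cont)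

lemma equi_\<Phi>2: "bdd_equicontinuous {0..T} \<Phi>2"
  unfolding \<Phi>2_def[abs_def]
  by (intro equi_intros equi_first equi_\<Phi>1 equi_\<Psi>1 equi_of_real continuous_intros r_cont f_cont)

text \<open>The integral of \<open>W\<close> over \<open>[0,h]\<close> equals
  \<open>h * W t 0\<close> up to O(h^2), as \<open>W1\<close> is bounded. Its time derivative is
  O(h^2) as well, because \<open>\<Phi>\<close> vanishes at 0 and is Lipschitz uniformly on
  \<open>{0..T}\<close>. As \<open>W\<close> vanishes at 0 initially,
  \<open>h * norm (W T 0)\<close> is O(h^2), and dividing by h leaves O(h).\<close>

lemma W_0:
  assumes T: "T \<ge> 0"
  shows "W T 0 = 0"
proof -
  obtain K where K: "K > 0" "\<And>t y. t \<in> {0..T} \<Longrightarrow> y \<in> {0..1} \<Longrightarrow> norm (\<Phi>1 t y) \<le> K"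
    using bdd_equicontinuous_bound[OF equi_\<Phi>1] by metis
  obtain L where L: "L > 0" "\<And>t y. t \<in> {0::real..} \<Longrightarrow> y \<in> {0..1} \<Longrightarrow> norm (complex_of_real (f y)) \<le> L"
    using bdd_equicontinuous_bound[OF equi_of_real[OF f_cont]] by metis
  obtain M where M: "\<And>t y. t \<in> {0..} \<Longrightarrow> y \<in> {0..1} \<Longrightarrow> norm (W1 t y) \<le> M"
    using bdd_equicontinuous_bound[OF W1_equi] by metis
  have \<Phi>_lin: "norm (\<Phi> t y) \<le> K * y" if "t \<in> {0..T}" "y \<in> {0..1}" for t y
  proof -
    have "norm (\<Phi> t y - \<Phi> t 0) \<le> K * (y - 0)"
      using that K by (intro norm_diff_le_of_vector_derivative[of _ _ _ "\<Phi>1 t"] has_vector_derivative_within_subset[OF \<Phi>_vder]) auto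
    then show ?thesis using that \<Phi>_0 by simp
  qed
  have W_lin: "norm (W t y - W t 0) \<le> M * y" if "t \<ge> 0" "y \<in> {0..1}" for t y
  proof -
    have "norm (W t y - W t 0) \<le> M * (y - 0)"
      using that M by (intro norm_diff_le_of_vector_derivative[of _ _ _ "W1 t"] has_vector_derivative_within_subset[OF W_deriv]) auto
    then show ?thesis by simp
  qed
  have M0: "M \<ge> 0" using M[of 0 0] order_trans[OF norm_ge_zero] by auto
  define c where "c = 2 * M + L * K * T / \<bar>k\<bar>"
  have main: "norm (W T 0) \<le> c * h" if h: "0 < h" "h \<le> 1" for h
  proof -
    define I where "I t = integral {0..h} (\<lambda>y. of_real 1 * W t y)" for t
    have close: "norm (I t - of_real h * W t 0) \<le> M * h * h" if t: "t \<ge> 0" for t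
    proof -
      have Wc: "continuous_on {0..h} (W t)" by (rule continuous_on_subset[OF W_cont[OF t]]) (use h in auto)
      have "I t - of_real h * W t 0 = integral {0..h} (\<lambda>y. W t y - W t 0)"
        using h integral_diff[OF integrable_continuous_real[OF Wc] integrable_const_ivl, of "W t 0"]
        by (simp add: I_def scaleR_conv_of_real)
      also have "norm \<dots> \<le> (M * h) * (h - 0)"
      proof (rule integral_bound)
        show "norm (W t y - W t 0) \<le> M * h" if "y \<in> {0..h}" for y
          using W_lin[OF t, of y] that h M0 by (auto intro: order_trans mult_left_mono)
      qed (use h Wc in \<open>auto intro!: continuous_intros\<close>)
      finally show ?thesis by simp
    qed
    have "norm (I T - I 0) \<le> (L * K * h * h / \<bar>k\<bar>) * (T - 0)"
    proof (rule norm_diff_le_of_vector_derivative[OF T])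
      fix t assume t: "t \<in> {0..T}"
      show "(I has_vector_derivative \<i> / of_real k * integral {0..h} (\<lambda>y. of_real 1 * (of_real (f y) * \<Phi> t y))) (at t within {0..T})"
        unfolding I_def using t h
        by (intro has_vector_derivative_within_subset[OF time_deriv]) auto
      have c: "continuous_on {0..h} (\<Phi> t)" "continuous_on {0..h} f"
        using t h by (auto intro: continuous_on_subset[OF \<Phi>_cont] continuous_on_subset[OF f_cont])
      have "norm (integral {0..h} (\<lambda>y. of_real 1 * (of_real (f y) * \<Phi> t y))) \<le> (L * (K * h)) * (h - 0)"
      proof (rule integral_bound)
        show "norm (of_real 1 * (of_real (f y) * \<Phi> t y)) \<le> L * (K * h)" if y: "y \<in> {0..h}" for y
        proof -
          have "norm (\<Phi> t y) \<le> K * h" using \<Phi>_lin[of t y] t y h K(1) by (auto intro: order_trans mult_left_mono)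
          then show ?thesis using L(2)[of 0 y] L(1) y h by (simp add: norm_mult mult_mono)
        qed
      qed (use h c in \<open>auto intro!: continuous_intros\<close>)
      then have "norm (\<i> / complex_of_real k) * norm (integral {0..h} (\<lambda>y. of_real 1 * (of_real (f y) * \<Phi> t y)))
          \<le> (1 / \<bar>k\<bar>) * ((L * (K * h)) * (h - 0))"
        by (intro mult_mono) (auto simp: norm_divide)
      then show "norm (\<i> / of_real k * integral {0..h} (\<lambda>y. of_real 1 * (of_real (f y) * \<Phi> t y))) \<le> L * K * h * h / \<bar>k\<bar>"
        by (simp add: norm_mult norm_divide mult_ac)
    qed
    moreover have "norm (I 0) \<le> M * h * h" using close[of 0] W_init_0 by simp
    moreover have "norm (of_real h * W T 0) \<le> norm (I T - of_real h * W T 0) + norm (I T - I 0) + norm (I 0)"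
      by (smt (verit) norm_triangle_ineq2 norm_minus_commute norm_triangle_sub)
    ultimately have "h * norm (W T 0) \<le> M * h * h + (L * K * h * h / \<bar>k\<bar>) * T + M * h * h"
      using close[OF T] h by (simp add: norm_mult)
    also have "\<dots> = h * (c * h)" by (simp add: c_def algebra_simps)
    finally show ?thesis using h by simp
  qed
  have c0: "c \<ge> 0" using M0 K L T by (simp add: c_def)
  have "norm (W T 0) \<le> 0 + e" if "e > 0" for e :: real
  proof -
    have "c * min 1 (e / (c + 1)) \<le> c * (e / (c + 1))" using c0 by (intro mult_left_mono) auto
    also have "\<dots> \<le> e" using c0 that by (simp add: divide_simps)
    finally show ?thesis using main[of "min 1 (e / (c + 1))"] that c0 by simp
  qed
  then have "norm (W T 0) \<le> 0" by (rule field_le_epsilon)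
  then show ?thesis by simp
qed

end

section \<open>Expansion at the boundary and decay of the stream function\<close>

context euler_channel begin

lemma f_first_order:
  assumes "\<epsilon> > 0"
  obtains \<delta> where "\<delta> > 0" "\<And>y. y \<in> {0..1} \<Longrightarrow> y < \<delta> \<Longrightarrow>
    norm (complex_of_real (f y) - of_real (f 0) - of_real y * of_real (f1 0)) \<le> \<epsilon> * y"
proof -
  obtain \<delta> where \<delta>: "\<delta> > 0" "\<And>t x y. t \<in> {0::real} \<Longrightarrow> x \<in> {0..1} \<Longrightarrow> y \<in> {0..1} \<Longrightarrow> \<bar>x - y\<bar> < \<delta>
      \<Longrightarrow> norm (complex_of_real (f1 x) - of_real (f1 y)) < \<epsilon>"
    using bdd_equicontinuous_modulus[OF equi_of_real[OF f1_cont] assms, of "{0::real}"] by metis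
  show ?thesis
  proof (rule that[OF \<delta>(1)])
    fix y assume y: "y \<in> {0..1}" "y < \<delta>"
    show "norm (complex_of_real (f y) - of_real (f 0) - of_real y * of_real (f1 0)) \<le> \<epsilon> * y"
    proof (rule taylor_first_order[where h = y and ?u1.0 = "\<lambda>y. of_real (f1 y)"])
      show "norm (complex_of_real (f1 x) - of_real (f1 0)) \<le> \<epsilon>" if "x \<in> {0..y}" for x
        using \<delta>(2)[of 0 x 0] that y by (auto intro: less_imp_le)
    qed (use y in \<open>auto intro!: has_vector_derivative_real f_deriv\<close>)
  qed
qed

text \<open>The coefficient of \<open>y\<^sup>2\<close> in the product of
  \<open>f 0 + y * f1 0\<close> and
  \<open>y * \<Phi>1 t 0 + y\<^sup>2 * \<Phi>2 t 0 / 2\<close>.\<close>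

definition quad_coeff :: "real \<Rightarrow> complex" where
  "quad_coeff t = of_real (f 0) * \<Phi>2 t 0 / 2 + of_real (f1 0) * \<Phi>1 t 0"

text \<open>\<open>f\<close> comes with one derivative, but \<open>\<Phi>\<close> vanishes at 0, so
  a first order expansion of \<open>f\<close> determines the product to second order. Equicontinuity
  of \<open>\<Phi>2\<close> makes \<open>h\<close> uniform in \<open>t\<close> on
  \<open>{0..T}\<close>.\<close>

lemma f\<Phi>_second_order:
  assumes "\<epsilon> > 0"
  shows "\<exists>h>0. h \<le> 1 \<and> (\<forall>t\<in>{0..T}. \<forall>y\<in>{0..h}. norm (of_real (f y) * \<Phi> t y
      - (of_real y * (of_real (f 0) * \<Phi>1 t 0) + of_real (y\<^sup>2) * quad_coeff t)) \<le> \<epsilon> * y\<^sup>2)"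
proof -
  obtain K where K: "K > 0" "\<And>t y. t \<in> {0..T} \<Longrightarrow> y \<in> {0..1} \<Longrightarrow> norm (\<Phi>1 t y) \<le> K"
    using bdd_equicontinuous_bound[OF equi_\<Phi>1] by metis
  obtain K2 where K2: "K2 > 0" "\<And>t y. t \<in> {0..T} \<Longrightarrow> y \<in> {0..1} \<Longrightarrow> norm (\<Phi>2 t y) \<le> K2"
    using bdd_equicontinuous_bound[OF equi_\<Phi>2] by metis
  obtain L where L: "L > 0" "\<And>t y. t \<in> {0::real..} \<Longrightarrow> y \<in> {0..1} \<Longrightarrow> norm (complex_of_real (f y)) \<le> L"
    using bdd_equicontinuous_bound[OF equi_of_real[OF f_cont]] by metis
  \<comment> \<open>Half of \<open>\<epsilon>\<close> pays for the Taylor remainders of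
    \<open>f\<close> and \<open>\<Phi>\<close>, the other half for the cubic term, through
    \<open>h \<le> \<epsilon> / (2 * F)\<close>.\<close>
  define e where "e = \<epsilon> / (2 * (L + K + K2))"
  have e: "e > 0" using assms L K K2 by (simp add: e_def)
  have "L + K + K2 \<noteq> 0" using L(1) K(1) K2(1) by linarith
  then have e2: "e * (L + K + K2) = \<epsilon> / 2"
    unfolding e_def by (metis (no_types) divide_divide_eq_left nonzero_eq_divide_eq)
  obtain d1 where d1: "d1 > 0" "\<And>y. y \<in> {0..1} \<Longrightarrow> y < d1 \<Longrightarrow>
      norm (complex_of_real (f y) - of_real (f 0) - of_real y * of_real (f1 0)) \<le> e * y"
    using f_first_order[OF e] by blast
  obtain d2 where d2: "d2 > 0" "\<And>t x y. t \<in> {0..T} \<Longrightarrow> x \<in> {0..1} \<Longrightarrow> y \<in> {0..1} \<Longrightarrow> \<bar>x - y\<bar> < d2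
      \<Longrightarrow> norm (\<Phi>2 t x - \<Phi>2 t y) < e"
    using bdd_equicontinuous_modulus[OF equi_\<Phi>2 e] by metis
  define F where "F = \<bar>f1 0\<bar> * K2 + 1"
  have F: "F > 0" using K2 by (simp add: F_def add_nonneg_pos)
  define h where "h = Min {1, d1 / 2, d2 / 2, \<epsilon> / (2 * F)}"
  have h: "h > 0" "h \<le> 1" "h < d1" "h < d2" "h \<le> \<epsilon> / (2 * F)"
  proof -
    show "h > 0" using d1(1) d2(1) assms F by (simp add: h_def)
    have "h \<le> d1 / 2" "h \<le> d2 / 2" by (simp_all add: h_def)
    then show "h < d1" "h < d2" using d1(1) d2(1) by linarith+
    show "h \<le> 1" "h \<le> \<epsilon> / (2 * F)" by (simp_all add: h_def)
  qed
  have "norm (of_real (f y) * \<Phi> t y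
      - (of_real y * (of_real (f 0) * \<Phi>1 t 0) + of_real (y\<^sup>2) * quad_coeff t)) \<le> \<epsilon> * y\<^sup>2"
    if t: "t \<in> {0..T}" and y: "y \<in> {0..h}" for t y
  proof -
    have t0: "t \<ge> 0" and y1: "y \<in> {0..1}" and y0: "y \<ge> 0" using t y h by auto
    define \<eta> where "\<eta> = complex_of_real (f y) - of_real (f 0) - of_real y * of_real (f1 0)"
    define \<rho> where "\<rho> = \<Phi> t y - of_real y * \<Phi>1 t 0 - of_real (y\<^sup>2) * (\<Phi>2 t 0 / 2)"
    define p where "p = of_real y * \<Phi>1 t 0 + of_real (y\<^sup>2) * (\<Phi>2 t 0 / 2)"
    have \<eta>: "norm \<eta> \<le> e * y" unfolding \<eta>_def by (rule d1) (use y h in auto)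
    have "norm (\<Phi> t y - \<Phi> t 0 - of_real y * \<Phi>1 t 0 - of_real (y\<^sup>2) * (\<Phi>2 t 0 / 2)) \<le> e * y\<^sup>2"
    proof (rule taylor_second_order[OF h(2)])
      show "norm (\<Phi>2 t y - \<Phi>2 t 0) \<le> e" if "y \<in> {0..h}" for y
        using d2(2)[of t y 0] t that h by auto
    qed (use t0 y in \<open>auto intro!: \<Phi>_vder \<Phi>1_vder\<close>)
    then have \<rho>: "norm \<rho> \<le> e * y\<^sup>2" by (simp add: \<rho>_def \<Phi>_0[OF t0])
    have "norm p \<le> norm (of_real y * \<Phi>1 t 0) + norm (of_real (y\<^sup>2) * (\<Phi>2 t 0 / 2))"
      unfolding p_def by (rule norm_triangle_ineq)
    also have "\<dots> \<le> y * K + y * K2"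
    proof (rule add_mono)
      show "norm (of_real y * \<Phi>1 t 0) \<le> y * K" using K(2)[OF t, of 0] y0 by (simp add: norm_mult mult_left_mono)
      have "y\<^sup>2 \<le> y" using y1 by (simp add: power2_eq_square mult_left_le)
      moreover have "norm (\<Phi>2 t 0 / 2) \<le> K2" using K2(2)[OF t, of 0] by simp (smt (verit) norm_ge_zero)
      ultimately have "\<bar>y\<^sup>2\<bar> * norm (\<Phi>2 t 0 / 2) \<le> y * K2" using y0 by (intro mult_mono) simp_all
      then show "norm (of_real (y\<^sup>2) * (\<Phi>2 t 0 / 2)) \<le> y * K2" by (simp only: norm_mult norm_of_real)
    qed
    finally have p: "norm p \<le> y * K + y * K2" .
    have "of_real (f y) * \<Phi> t y - (of_real y * (of_real (f 0) * \<Phi>1 t 0) + of_real (y\<^sup>2) * quad_coeff t)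
        = of_real (f y) * \<rho> + \<eta> * p + of_real (y ^ 3) * (of_real (f1 0) * (\<Phi>2 t 0 / 2))"
      by (simp add: \<rho>_def \<eta>_def p_def quad_coeff_def field_simps power2_eq_square power3_eq_cube)
    then have "norm (of_real (f y) * \<Phi> t y - (of_real y * (of_real (f 0) * \<Phi>1 t 0) + of_real (y\<^sup>2) * quad_coeff t))
        \<le> norm (of_real (f y) * \<rho>) + norm (\<eta> * p) + norm (of_real (y ^ 3) * (of_real (f1 0) * (\<Phi>2 t 0 / 2)))"
      using norm_triangle_ineq[of "of_real (f y) * \<rho> + \<eta> * p" "of_real (y ^ 3) * (of_real (f1 0) * (\<Phi>2 t 0 / 2))"]
        norm_triangle_ineq[of "of_real (f y) * \<rho>" "\<eta> * p"] by simp
    also have "\<dots> \<le> L * (e * y\<^sup>2) + (e * y) * (y * K + y * K2) + y ^ 3 * F"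
    proof (intro add_mono)
      show "norm (of_real (f y) * \<rho>) \<le> L * (e * y\<^sup>2)"
        unfolding norm_mult using L(1) L(2)[of 0 y] y1 \<rho> by (intro mult_mono) auto
      show "norm (\<eta> * p) \<le> (e * y) * (y * K + y * K2)"
        unfolding norm_mult using \<eta> p e y0 by (intro mult_mono) auto
      have "norm (\<Phi>2 t 0 / 2) \<le> K2" using K2(2)[OF t, of 0] by simp (smt (verit) norm_ge_zero)
      then have "\<bar>f1 0\<bar> * norm (\<Phi>2 t 0 / 2) \<le> \<bar>f1 0\<bar> * K2" by (intro mult_left_mono) auto
      then have "\<bar>f1 0\<bar> * norm (\<Phi>2 t 0 / 2) \<le> F" by (simp add: F_def)
      then have "\<bar>y ^ 3\<bar> * (\<bar>f1 0\<bar> * norm (\<Phi>2 t 0 / 2)) \<le> y ^ 3 * F" using y0 by (intro mult_mono) simp_all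
      then show "norm (of_real (y ^ 3) * (of_real (f1 0) * (\<Phi>2 t 0 / 2))) \<le> y ^ 3 * F"
        by (simp only: norm_mult norm_of_real)
    qed
    also have "\<dots> = (e * (L + K + K2)) * y\<^sup>2 + y * F * y\<^sup>2"
      by (simp add: algebra_simps power2_eq_square power3_eq_cube)
    also have "\<dots> \<le> (\<epsilon> / 2) * y\<^sup>2 + (\<epsilon> / 2) * y\<^sup>2"
    proof -
      have "y \<le> \<epsilon> / (2 * F)" using y h(5) by simp
      then have "y * F \<le> \<epsilon> / (2 * F) * F" using F by (intro mult_right_mono) auto
      also have "\<dots> = \<epsilon> / 2" using F by simp
      finally have "y * F * y\<^sup>2 \<le> (\<epsilon> / 2) * y\<^sup>2" by (intro mult_right_mono) auto
      then show ?thesis by (simp only: e2)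
    qed
    also have "\<dots> = \<epsilon> * y\<^sup>2" by (simp add: field_simps)
    finally show ?thesis .
  qed
  then show ?thesis using h(1,2) by blast
qed

text \<open>Leibniz formula for the second derivative of the product of \<open>W t\<close> and
  \<open>q\<close>, the integrand left over after two integrations by parts.\<close>

definition Wq2 :: "real \<Rightarrow> real \<Rightarrow> complex" where
  "Wq2 t y = W2 t y * of_real (q y) + 2 * (W1 t y * of_real (q1 y)) + W t y * of_real (q2 y)"

lemma equi_Wq2: "bdd_equicontinuous {0..} Wq2"
  unfolding Wq2_def[abs_def]
  by (intro bdd_equicontinuous_add bdd_equicontinuous_mult equi_const equi_of_real
    W_equi W1_equi W2_equi q_cont q1_cont q2_cont)

definition J :: "real \<Rightarrow> complex" where
  "J t = integral {0..1} (\<lambda>y. phase (k * t) y * Wq2 t y)"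

text \<open>Time is both the frequency and the parameter of the integrand, so the threshold of the
  Riemann--Lebesgue lemma has to be independent of the parameter.\<close>

lemma J_tendsto_0: "(J \<longlongrightarrow> 0) at_top"
proof (rule tendstoI)
  fix e :: real assume e: "e > 0"
  then have "e / 2 > 0" by simp
  obtain \<Lambda> where \<Lambda>: "\<Lambda> > 0" "\<And>\<mu> t. \<bar>\<mu>\<bar> \<ge> \<Lambda> \<Longrightarrow> t \<in> {0..} \<Longrightarrow>
      norm (integral {0..1} (\<lambda>y. phase \<mu> y * Wq2 t y)) \<le> e / 2"
    using riemann_lebesgue_uniform[OF equi_Wq2 \<open>e / 2 > 0\<close>] by blast
  show "\<forall>\<^sub>F t in at_top. dist (J t) 0 < e"
    using eventually_ge_at_top[of "\<Lambda> / \<bar>k\<bar>"]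
  proof eventually_elim
    case (elim t)
    have "0 < \<Lambda> / \<bar>k\<bar>" using \<Lambda>(1) k_nz by simp
    then have "t \<ge> 0" using elim by linarith
    moreover have "\<bar>k * t\<bar> \<ge> \<Lambda>" using elim k_nz \<open>t \<ge> 0\<close> by (simp add: abs_mult field_simps)
    ultimately have "norm (J t) \<le> e / 2" unfolding J_def by (intro \<Lambda>(2)) auto
    then show ?case using e by simp
  qed
qed

text \<open>Two integrations by parts; since \<open>W\<close> vanishes at both ends and \<open>q\<close> at \<open>1\<close>, the only boundary term is
  the one with \<open>\<partial>\<^sub>y W\<close> at \<open>0\<close>.\<close>

lemma \<Psi>_0_asymptotics:
  assumes t: "t > 0" and W1_end: "W t 1 = 0"
  shows "of_real (t\<^sup>2) * \<Psi> t 0 = (W1 t 0 * of_real (r 0) + J t) / of_real k"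
proof -
  have t0: "t \<ge> 0" using t by simp
  define \<mu> where "\<mu> = complex_of_real (k * t)"
  have \<mu>: "\<mu> \<noteq> 0" using k_nz t by (simp add: \<mu>_def)
  define X where "X y = W t y * of_real (q y)" for y
  define X1 where "X1 y = W1 t y * of_real (q y) + W t y * of_real (q1 y)" for y
  \<comment> \<open>Both integrations by parts in one antiderivative: the phase differentiated in
    the first term gives \<open>phase (k * t) y * X y\<close>, the two terms with \<open>X1\<close>
    cancel, and \<open>Wq2\<close> with the factor \<open>1 / \<mu>\<^sup>2\<close> remains.\<close>
  let ?Z = "\<lambda>y. phase (k * t) y * (\<i> / \<mu> * X y + 1 / \<mu>\<^sup>2 * X1 y)"
  have Xd: "(X has_vector_derivative X1 y) (at y within {0..1})" if y: "y \<in> {0..1}" for y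
    unfolding X_def[abs_def]
    by (rule has_vector_derivative_eq_rhs, (rule derivative_intros W_deriv[OF t0 y] has_vector_derivative_real q_deriv[OF y])+)
      (simp add: X1_def)
  have X1d: "(X1 has_vector_derivative Wq2 t y) (at y within {0..1})" if y: "y \<in> {0..1}" for y
    unfolding X1_def[abs_def]
    by (rule has_vector_derivative_eq_rhs, (rule derivative_intros W_deriv[OF t0 y] W1_deriv[OF t0 y] has_vector_derivative_real q_deriv[OF y] q1_deriv[OF y])+)
      (simp add: Wq2_def)
  have phase': "(phase (k * t) has_vector_derivative - \<i> * \<mu> * phase (k * t) y) (at y within {0..1})" for y
    unfolding \<mu>_def by (rule phase_deriv)
  have "((\<lambda>y. phase (k * t) y * X y + 1 / \<mu>\<^sup>2 * (phase (k * t) y * Wq2 t y)) has_integral (?Z 1 - ?Z 0)) {0..1}"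
  proof (rule fundamental_theorem_of_calculus)
    fix y :: real assume y: "y \<in> {0..1}"
    show "(?Z has_vector_derivative phase (k * t) y * X y + 1 / \<mu>\<^sup>2 * (phase (k * t) y * Wq2 t y)) (at y within {0..1})"
      by (rule has_vector_derivative_eq_rhs, (rule derivative_intros phase' Xd[OF y] X1d[OF y])+)
        (use \<mu> in \<open>simp add: field_simps power2_eq_square\<close>)
  qed simp
  moreover have "?Z 1 - ?Z 0 = - (1 / \<mu>\<^sup>2 * (W1 t 0 * of_real (r 0)))"
    using W1_end W_0[OF t0] by (simp add: X_def X1_def q_1 q_0)
  ultimately have 1: "integral {0..1} (\<lambda>y. phase (k * t) y * X y + 1 / \<mu>\<^sup>2 * (phase (k * t) y * Wq2 t y))
      = - (1 / \<mu>\<^sup>2 * (W1 t 0 * of_real (r 0)))"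
    by (simp only: integral_unique)
  have c: "(\<lambda>y. phase (k * t) y * X y) integrable_on {0..1}" "(\<lambda>y. phase (k * t) y * Wq2 t y) integrable_on {0..1}"
    unfolding X_def[abs_def] using t0
    by (auto intro!: integrable_continuous_real continuous_intros W_cont q_cont bdd_equicontinuous_continuous_on[OF equi_Wq2])
  have "integral {0..1} (\<lambda>y. phase (k * t) y * X y + 1 / \<mu>\<^sup>2 * (phase (k * t) y * Wq2 t y))
      = integral {0..1} (\<lambda>y. phase (k * t) y * X y) + 1 / \<mu>\<^sup>2 * J t"
    using integral_add[OF c(1) integrable_on_mult_right[OF c(2), of "1 / \<mu>\<^sup>2"]] by (simp add: J_def)
  then have "integral {0..1} (\<lambda>y. phase (k * t) y * X y) = - (1 / \<mu>\<^sup>2 * (W1 t 0 * of_real (r 0) + J t))"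
    using 1 by (simp add: algebra_simps)
  then have "\<Psi> t 0 = of_real k * (1 / \<mu>\<^sup>2 * (W1 t 0 * of_real (r 0) + J t))"
    using \<Psi>_0_eq[OF t0] by (simp add: X_def)
  then show ?thesis using k_nz t by (simp add: \<mu>_def power2_eq_square)
qed

text \<open>The vanishing at the end 1 is assumed here and supplied by the reflected instance in
  \<open>boundary_limits_zero\<close>. The logarithmic growth argument is applied to weighted
  integrals of \<open>W\<close>; there \<open>t * G t\<close> tends to
  \<open>- l * (r 0)\<^sup>2 / 12\<close>, and \<open>r 0\<close> is nonzero.\<close>

lemma boundary_limit_zero:
  assumes W_1: "\<And>t. t \<ge> 0 \<Longrightarrow> W t 1 = 0"
    and lim: "((\<lambda>t. of_real (f 0) * W1 t 0) \<longlongrightarrow> l) at_top"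
  shows "l = 0"
proof -
  \<comment> \<open>For small h, \<open>F h t\<close> approximates \<open>W2 t 0 / 24\<close>, and
    its time derivative \<open>D h t\<close> approximates \<open>G t\<close>: the coefficients of
    \<open>y\<^sup>2\<close> are \<open>W2 t 0 / 2\<close> and \<open>quad_coeff t\<close>, and the
    weight contributes the factor 1/12.\<close>
  define F where "F h t = of_real (1 / h ^ 3) * integral {0..h} (\<lambda>y. of_real (3 * y / h - 2) * W t y)" for h t
  define D where "D h t = of_real (1 / h ^ 3) * (\<i> / of_real k *
      integral {0..h} (\<lambda>y. of_real (3 * y / h - 2) * (of_real (f y) * \<Phi> t y)))" for h t
  define G where "G t = \<i> / of_real k * (quad_coeff t / 12)" for t
  obtain M where M: "\<And>t y. t \<in> {0..} \<Longrightarrow> y \<in> {0..1} \<Longrightarrow> norm (W2 t y) \<le> M"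
    using bdd_equicontinuous_bound[OF W2_equi] by metis
  have bound: "norm (F h t) \<le> 5 * M" if h: "0 < h" "h \<le> 1" and t: "t \<ge> 0" for h t
  proof -
    have "norm (F h t - (W2 t 0 / 2) / 12) \<le> 2 * (2 * M)"
      unfolding F_def
    proof (rule second_order_coefficient[OF h(1)])
      show "continuous_on {0..h} (W t)" by (rule continuous_on_subset[OF W_cont[OF t]]) (use h in auto)
      fix y assume y: "y \<in> {0..h}"
      have "norm (W t y - W t 0 - of_real y * W1 t 0 - of_real (y\<^sup>2) * (W2 t 0 / 2)) \<le> (2 * M) * y\<^sup>2"
      proof (rule taylor_second_order[OF h(2)])
        show "norm (W2 t x - W2 t 0) \<le> 2 * M" if "x \<in> {0..h}" for x
          using M[of t x] M[of t 0] norm_triangle_ineq4[of "W2 t x" "W2 t 0"] t that h by auto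
      qed (use t y in \<open>auto intro!: W_deriv W1_deriv\<close>)
      then show "norm (W t y - (of_real y * W1 t 0 + of_real (y\<^sup>2) * (W2 t 0 / 2))) \<le> 2 * M * y\<^sup>2"
        using W_0[OF t] by (simp add: algebra_simps)
    qed
    moreover have "norm ((W2 t 0 / 2) / 12) \<le> M"
      using M[of t 0] t by (simp add: norm_divide) (smt (verit) norm_ge_zero)
    ultimately show ?thesis by (smt (verit) norm_triangle_sub)
  qed
  have deriv: "(F h has_vector_derivative D h t) (at t within {0..})" if h: "0 < h" "h \<le> 1" and t: "t \<ge> 0" for h t
    unfolding F_def[abs_def] D_def using h t
    by (intro has_vector_derivative_mult_right time_deriv continuous_intros) auto
  have approx: "\<exists>h>0. h \<le> 1 \<and> (\<forall>t\<in>{0..T}. norm (D h t - G t) \<le> \<epsilon>)" if "\<epsilon> > 0" for T \<epsilon>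
  proof -
    have "\<epsilon> * \<bar>k\<bar> / 2 > 0" using that k_nz by simp
    from f\<Phi>_second_order[OF this, of T] obtain h where h: "h > 0" "h \<le> 1"
      "\<And>t y. t \<in> {0..T} \<Longrightarrow> y \<in> {0..h} \<Longrightarrow> norm (of_real (f y) * \<Phi> t y
      - (of_real y * (of_real (f 0) * \<Phi>1 t 0) + of_real (y\<^sup>2) * quad_coeff t)) \<le> (\<epsilon> * \<bar>k\<bar> / 2) * y\<^sup>2"
      by blast
    have "norm (D h t - G t) \<le> \<epsilon>" if t: "t \<in> {0..T}" for t
    proof -
      have c: "continuous_on {0..h} (\<lambda>y. of_real (f y) * \<Phi> t y)"
        by (rule continuous_on_subset[of "{0..1}"]) (use h t in \<open>auto intro!: continuous_intros f_cont \<Phi>_cont\<close>)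
      have "D h t - G t = \<i> / of_real k * (of_real (1 / h ^ 3) *
          integral {0..h} (\<lambda>y. of_real (3 * y / h - 2) * (of_real (f y) * \<Phi> t y)) - quad_coeff t / 12)"
        by (simp add: D_def G_def algebra_simps)
      then have "norm (D h t - G t) = 1 / \<bar>k\<bar> * norm (of_real (1 / h ^ 3) *
          integral {0..h} (\<lambda>y. of_real (3 * y / h - 2) * (of_real (f y) * \<Phi> t y)) - quad_coeff t / 12)"
        by (simp only: norm_mult norm_divide norm_of_real norm_ii)
      also have "\<dots> \<le> 1 / \<bar>k\<bar> * (2 * (\<epsilon> * \<bar>k\<bar> / 2))"
        by (intro mult_left_mono second_order_coefficient[where a = "of_real (f 0) * \<Phi>1 t 0"] h(1) c h(3) t) auto
      also have "\<dots> = \<epsilon>" using k_nz by simp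
      finally show ?thesis .
    qed
    then show ?thesis using h by blast
  qed
  \<comment> \<open>At \<open>y = 0\<close> both \<open>\<Phi>\<close> and \<open>W\<close> vanish,
    so the system expresses \<open>\<Phi>1\<close> and \<open>\<Phi>2\<close> there through
    \<open>\<Psi> t 0\<close> alone. \<open>c0\<close> collects the part of
    \<open>quad_coeff t\<close> that lacks a factor \<open>t\<close> and is of lower order.\<close>
  define c0 where "c0 = complex_of_real (f1 0) - of_real ((f 0)\<^sup>2 * (r 0)\<^sup>2) / 2"
  define Y where "Y t = of_real (t\<^sup>2) * \<Psi> t 0" for t
  have bt: "quad_coeff t = of_real k * of_real (r 0) * \<Psi> t 0 * (of_real (f 0) * \<i> * of_real k * of_real t + c0)" if t: "t \<ge> 0" for t
    using W_0[OF t] \<Phi>_0[OF t]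
    by (simp add: quad_coeff_def \<Phi>2_def \<Phi>1_def \<Psi>1_def c0_def field_simps power2_eq_square power3_eq_cube)
  have G: "of_real t * G t = (\<i> * of_real (r 0) / 12) * (of_real (f 0) * Y t * (\<i> * of_real k) + Y t * (c0 / of_real t))"
    if t: "t > 0" for t
    using t k_nz by (simp add: G_def bt Y_def field_simps power2_eq_square)
  have Y: "Y t = (W1 t 0 * of_real (r 0) + J t) / of_real k" if "t > 0" for t
    unfolding Y_def using that by (intro \<Psi>_0_asymptotics W_1) auto
  have ev: "\<forall>\<^sub>F t in at_top. t > (0::real)" by (rule eventually_gt_at_top)
  have "((\<lambda>t. (of_real (f 0) * W1 t 0 * of_real (r 0) + of_real (f 0) * J t) / of_real k) \<longlongrightarrow>
      (l * of_real (r 0) + of_real (f 0) * 0) / of_real k) at_top"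
    using k_nz by (intro tendsto_intros lim J_tendsto_0) auto
  then have "((\<lambda>t. of_real (f 0) * Y t) \<longlongrightarrow> (l * of_real (r 0) + of_real (f 0) * 0) / of_real k) at_top"
    by (rule Lim_transform_eventually) (use ev in eventually_elim, simp add: Y algebra_simps)
  then have Ylim: "((\<lambda>t. of_real (f 0) * Y t) \<longlongrightarrow> l * of_real (r 0) / of_real k) at_top" by simp
  obtain M1 where M1: "\<And>t y. t \<in> {0..} \<Longrightarrow> y \<in> {0..1} \<Longrightarrow> norm (W1 t y) \<le> M1"
    using bdd_equicontinuous_bound[OF W1_equi] by metis
  \<comment> \<open>The hypothesis gives a limit for \<open>f 0 * Y t\<close>; if
    \<open>f 0 = 0\<close>, then \<open>Y\<close> itself need not converge. Its boundedness is
    enough for the term with \<open>c0 / of_real t\<close>.\<close>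
  have Ybound: "Bfun Y at_top"
  proof (rule BfunI)
    have "\<forall>\<^sub>F t in at_top. dist (J t) 0 < 1" using J_tendsto_0 by (rule tendstoD) simp
    then show "\<forall>\<^sub>F t in at_top. norm (Y t) \<le> (M1 * \<bar>r 0\<bar> + 1) / \<bar>k\<bar>"
      using ev
    proof eventually_elim
      case (elim t)
      have "norm (W1 t 0 * of_real (r 0) + J t) \<le> M1 * \<bar>r 0\<bar> + 1"
        using elim M1[of t 0] by (intro norm_triangle_le add_mono) (auto simp: norm_mult mult_right_mono)
      then show ?case using elim by (simp add: Y norm_divide divide_right_mono)
    qed
  qed
  have "((\<lambda>t. c0 / complex_of_real t) \<longlongrightarrow> 0) at_top"
    by (rule tendsto_divide_0[OF tendsto_const]) (simp add: filterlim_at_infinity_conv_norm_at_top filterlim_abs_real)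
  then have "((\<lambda>t. Y t * (c0 / of_real t)) \<longlongrightarrow> 0) at_top"
    using bounded_bilinear.Bfun_prod_Zfun[OF bounded_bilinear_mult Ybound] by (simp add: tendsto_Zfun_iff del: times_divide_eq_right)
  then have "((\<lambda>t. (\<i> * of_real (r 0) / 12) * (of_real (f 0) * Y t * (\<i> * of_real k) + Y t * (c0 / of_real t))) \<longlongrightarrow>
      (\<i> * of_real (r 0) / 12) * (l * of_real (r 0) / of_real k * (\<i> * of_real k) + 0)) at_top"
    using Ylim by (intro tendsto_intros)
  then have "((\<lambda>t. of_real t * G t) \<longlongrightarrow>
      (\<i> * of_real (r 0) / 12) * (l * of_real (r 0) / of_real k * (\<i> * of_real k) + 0)) at_top"
    by (rule Lim_transform_eventually) (use ev in eventually_elim, simp add: G)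
  from logarithmic_growth_contradiction[OF bound deriv approx this]
  have "(\<i> * of_real (r 0) / 12) * (l * of_real (r 0) / of_real k * (\<i> * of_real k) + 0) = 0" .
  then show ?thesis using k_nz g_nz[of 0] by (simp add: r_def)
qed

end

section \<open>Reflection to the other end of the channel\<close>

lemma bdd_equicontinuous_reflect:
  assumes "bdd_equicontinuous X h"
  shows "bdd_equicontinuous X (\<lambda>t y. h t (1 - y))"
proof -
  obtain C where C: "\<And>t x. t \<in> X \<Longrightarrow> x \<in> {0..1} \<Longrightarrow> norm (h t x) \<le> C"
    using bdd_equicontinuous_bound[OF assms] by blast
  show ?thesis
  proof (rule bdd_equicontinuousI)
    show "norm (h t (1 - x)) \<le> C" if "t \<in> X" "x \<in> {0..1}" for t x using C that by simp
  fix \<epsilon> :: real assume e: "\<epsilon> > 0"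
  obtain d where d: "d > 0" "\<And>t x y. t \<in> X \<Longrightarrow> x \<in> {0..1} \<Longrightarrow> y \<in> {0..1} \<Longrightarrow> \<bar>x - y\<bar> < d
        \<Longrightarrow> norm (h t x - h t y) < \<epsilon>"
    using bdd_equicontinuous_modulus[OF assms e] by blast
  show "\<exists>\<delta>>0. \<forall>t\<in>X. \<forall>x\<in>{0..1}. \<forall>y\<in>{0..1}. \<bar>x - y\<bar> < \<delta> \<longrightarrow> norm (h t (1 - x) - h t (1 - y)) < \<epsilon>"
    by (intro exI[of _ d] conjI ballI impI d) auto
  qed
qed

lemma has_vector_derivative_reflect:
  assumes "(u has_vector_derivative u') (at (1 - y) within {0..1})" "y \<in> {0..1}"
  shows "((\<lambda>x. u (1 - x)) has_vector_derivative - u') (at y within {0..1::real})"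
proof -
  have "((u \<circ> (\<lambda>x. 1 - x)) has_vector_derivative (-1) *\<^sub>R u') (at y within {0..1})"
  proof (rule vector_diff_chain_within)
    show "((\<lambda>x. 1 - x) has_vector_derivative - 1) (at y within {0..1::real})"
      by (auto intro!: derivative_eq_intros)
    show "(u has_vector_derivative u') (at (1 - y) within (\<lambda>x. 1 - x) ` {0..1})"
      using assms(1) by simp
  qed
  then show ?thesis by (simp add: o_def)
qed

lemma has_real_derivative_reflect:
  assumes "(u has_real_derivative u') (at (1 - y) within {0..1})" "y \<in> {0..1}"
  shows "((\<lambda>x. u (1 - x)) has_real_derivative - u') (at y within {0..1::real})"
  using has_vector_derivative_reflect[of u u' y] assms
  by (simp add: has_real_derivative_iff_has_vector_derivative)

lemma integral_reflect_unit:
  fixes u :: "real \<Rightarrow> complex"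
  shows "integral {c..d} (\<lambda>y. u (1 - y)) = integral {1 - d..1 - c} u"
proof -
  have "integral {c..d} (\<lambda>y. (u \<circ> (+) 1) (- y)) = integral {- d..- c} (u \<circ> (+) 1)"
    using Henstock_Kurzweil_Integration.integral_reflect_real[of "- c" "- d" "u \<circ> (+) 1"] by simp
  then show ?thesis
    by (simp add: integral_shift_Icc_real[of "- d" "- c" u 1] del: comp_apply) (simp add: o_def)
qed

context euler_channel begin

text \<open>The sign of \<open>- k\<close> absorbs that of the reflected y-derivative, so
  \<open>\<Psi>\<close> keeps its sign. The signs of \<open>- f\<close> and \<open>- k\<close>
  cancel in the time equation, and \<open>- f\<close> restores \<open>g_deriv\<close>. First
  derivatives of \<open>W\<close> change sign, second ones do not.\<close>

interpretation reflected: euler_channel "- k" "\<lambda>y. - f (1 - y)" "\<lambda>y. f1 (1 - y)" "\<lambda>y. g (1 - y)"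
  "\<lambda>t y. W t (1 - y)" "\<lambda>t y. - W1 t (1 - y)" "\<lambda>t y. W2 t (1 - y)" "\<lambda>t y. \<Phi> t (1 - y)" "\<lambda>t y. \<Psi> t (1 - y)"
proof
  have refl: "1 - y \<in> {0..1}" if "y \<in> {0..1}" for y :: real using that by auto
  show "- k \<noteq> 0" using k_nz by simp
  show "continuous_on {0..1} (\<lambda>y. f1 (1 - y))"
    by (rule continuous_on_compose2[OF f1_cont]) (auto intro!: continuous_intros)
  show "bdd_equicontinuous {0..} (\<lambda>t y. W2 t (1 - y))"
    by (rule bdd_equicontinuous_reflect[OF W2_equi])
  fix y :: real assume y: "y \<in> {0..1}"
  show "g (1 - y) \<noteq> 0" using g_nz refl[OF y] by blast
  show "((\<lambda>y. - f (1 - y)) has_real_derivative f1 (1 - y)) (at y within {0..1})"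
    using DERIV_minus[OF has_real_derivative_reflect[OF f_deriv[OF refl[OF y]] y]] by simp
  show "((\<lambda>y. g (1 - y)) has_real_derivative - f (1 - y) / g (1 - y)) (at y within {0..1})"
    using has_real_derivative_reflect[OF g_deriv[OF refl[OF y]] y] by simp
  fix t :: real assume t: "t \<ge> 0"
  show "((\<lambda>y. W t (1 - y)) has_vector_derivative - W1 t (1 - y)) (at y within {0..1})"
    by (rule has_vector_derivative_reflect[OF W_deriv[OF t refl[OF y]] y])
  show "((\<lambda>y. - W1 t (1 - y)) has_vector_derivative W2 t (1 - y)) (at y within {0..1})"
    using has_vector_derivative_minus[OF has_vector_derivative_reflect[OF W1_deriv[OF t refl[OF y]] y]] by simp
  show "((\<lambda>y. \<Phi> t (1 - y)) has_vector_derivative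
      of_real (- k) * (\<Psi> t (1 - y) / of_real (g (1 - y)) + \<i> * of_real t * \<Phi> t (1 - y))) (at y within {0..1})"
    using has_vector_derivative_reflect[OF \<Phi>_deriv[OF t refl[OF y]] y] by simp
  show "((\<lambda>y. \<Psi> t (1 - y)) has_vector_derivative
      of_real (- k) * ((\<Phi> t (1 - y) + W t (1 - y)) / of_real (g (1 - y)) + \<i> * of_real t * \<Psi> t (1 - y))) (at y within {0..1})"
    using has_vector_derivative_reflect[OF \<Psi>_deriv[OF t refl[OF y]] y] by simp
next
  show "\<exists>M. \<forall>t\<ge>0. \<forall>y\<in>{0..1}. norm (W t (1 - y)) \<le> M" using W_bound by fastforce
  show "\<exists>M. \<forall>t\<ge>0. \<forall>y\<in>{0..1}. norm (- W1 t (1 - y)) \<le> M" using W1_bound by fastforce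
next
  fix t :: real assume t: "t \<ge> 0"
  show "\<Phi> t (1 - 0) = 0" "\<Phi> t (1 - 1) = 0" using \<Phi>_0 \<Phi>_1 t by simp_all
next
  fix t c d :: real and \<rho> :: "real \<Rightarrow> real"
  assume *: "t \<ge> 0" "0 \<le> c" "c \<le> d" "d \<le> 1" and \<rho>: "continuous_on UNIV \<rho>"
  have "continuous_on UNIV (\<lambda>y. \<rho> (1 - y))"
    by (rule continuous_on_compose2[OF \<rho>]) (auto intro!: continuous_intros)
  from time_deriv[OF *(1) _ _ _ this]
  have "((\<lambda>\<tau>. integral {1 - d..1 - c} (\<lambda>y. of_real (\<rho> (1 - y)) * W \<tau> y)) has_vector_derivative
        \<i> / of_real k * integral {1 - d..1 - c} (\<lambda>y. of_real (\<rho> (1 - y)) * (of_real (f y) * \<Phi> t y))) (at t within {0..})"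
    using * by simp
  then show "((\<lambda>\<tau>. integral {c..d} (\<lambda>y. of_real (\<rho> y) * W \<tau> (1 - y))) has_vector_derivative
        \<i> / of_real (- k) * integral {c..d} (\<lambda>y. of_real (\<rho> y) * (of_real (- f (1 - y)) * \<Phi> t (1 - y)))) (at t within {0..})"
    using integral_reflect_unit[of c d "\<lambda>y. of_real (\<rho> (1 - y)) * W _ y"]
      integral_reflect_unit[of c d "\<lambda>y. of_real (\<rho> (1 - y)) * (of_real (f y) * \<Phi> t y)"]
    by simp
next
  show "W 0 (1 - 0) = 0" "W 0 (1 - 1) = 0" using W_init_0 W_init_1 by simp_all
qed

text \<open>The two ends exchange their results: \<open>reflected.W_0\<close> provides the vanishing
  at 1 for the original system, \<open>W_0\<close> provides it for the reflected one. In the second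
  claim the signs of \<open>f\<close> and \<open>W1\<close> under reflection cancel.\<close>

lemma boundary_limits_zero:
  shows "((\<lambda>t. of_real (f 0) * W1 t 0) \<longlongrightarrow> l) at_top \<Longrightarrow> l = 0"
    and "((\<lambda>t. of_real (f 1) * W1 t 1) \<longlongrightarrow> l) at_top \<Longrightarrow> l = 0"
  using boundary_limit_zero reflected.W_0 reflected.boundary_limit_zero[of l] W_0 by simp_all

end

subsection \<open>From the Euler system to classical solutions\<close>

text \<open>Since \<open>g\<close> at \<open>U x\<close> is \<open>U' x\<close>, the inverse of
  \<open>U\<close> has derivative \<open>1 / g\<close>, and the chain rule applied to
  \<open>U'\<close> composed with this inverse gives the quotient. Through this relation the shear
  profile enters the rest of the proof.\<close>

lemma shear_profile_deriv:
  fixes U U' U'' f g :: "real \<Rightarrow> real"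
  assumes mono: "strict_mono_on {a..b} U \<or> strict_antimono_on {a..b} U"
    and range: "U ` {a..b} = {0..1}"
    and U: "\<And>x. x \<in> {a..b} \<Longrightarrow> (U has_real_derivative U' x) (at x within {a..b})"
    and U': "\<And>x. x \<in> {a..b} \<Longrightarrow> (U' has_real_derivative U'' x) (at x within {a..b})"
    and f: "\<And>y. y \<in> {0..1} \<Longrightarrow> f y = U'' (the_inv_into {a..b} U y)"
    and g: "\<And>y. y \<in> {0..1} \<Longrightarrow> g y = U' (the_inv_into {a..b} U y)"
    and g_nz: "\<And>y. y \<in> {0..1} \<Longrightarrow> g y \<noteq> 0"
    and y: "y \<in> {0..1}"
  shows "(g has_real_derivative f y / g y) (at y within {0..1})"
proof -
  define G where "G = the_inv_into {a..b} U"
  have inj: "inj_on U {a..b}"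
  proof (rule linorder_inj_onI)
    show "U x \<noteq> U z" if "x < z" "x \<in> {a..b}" "z \<in> {a..b}" for x z
      using mono monotone_onD[of "{a..b}" "(<)" "(<)" U x z] monotone_onD[of "{a..b}" "(<)" "(>)" U x z] that by auto
  qed auto
  have GU: "G (U x) = x" if "x \<in> {a..b}" for x
    using that inj by (simp add: G_def the_inv_into_f_f)
  have Gin: "G z \<in> {a..b}" and UG: "U (G z) = z" if "z \<in> {0..1}" for z
    using that inj range the_inv_into_into[OF inj, of z "{a..b}"] f_the_inv_into_f[OF inj, of z]
    by (auto simp: G_def)
  have Gimg: "G ` {0..1} = {a..b}"
  proof
    show "G ` {0..1} \<subseteq> {a..b}" using Gin by blast
    show "{a..b} \<subseteq> G ` {0..1}" using GU range by (metis image_eqI imageI subsetI)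
  qed
  have U_cont: "continuous_on {a..b} U"
    by (rule DERIV_continuous_on[OF U])
  have G_cont: "continuous_on {0..1} G"
    using continuous_on_inv[OF U_cont compact_Icc, of G] GU range by simp
  have gy: "g y = U' (G y)" using g[OF y] by (simp add: G_def)
  have "(G has_derivative (*) (1 / g y)) (at (U (G y)) within U ` {a..b})"
  proof (rule has_derivative_inverse_within)
    show "(U has_derivative (*) (U' (G y))) (at (G y) within {a..b})"
      using U[OF Gin[OF y]] by (simp add: has_field_derivative_def)
    show "continuous (at (U (G y)) within U ` {a..b}) G"
      using G_cont y UG[OF y] range by (simp add: continuous_on_eq_continuous_within)
    show "linear ((*) (1 / g y))" by (rule linear_times)
    show "(*) (1 / g y) \<circ> (*) (U' (G y)) = id"
      using g_nz[OF y] gy by (simp add: fun_eq_iff)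
  qed (use Gin[OF y] GU in auto)
  then have "(G has_real_derivative 1 / g y) (at y within {0..1})"
    using UG[OF y] range by (simp add: has_field_derivative_def)
  moreover have "(U' has_real_derivative f y) (at (G y) within G ` {0..1})"
    using U'[OF Gin[OF y]] f[OF y] Gimg by (simp add: G_def)
  ultimately have "(U' \<circ> G has_real_derivative f y * (1 / g y)) (at y within {0..1})"
    by (rule DERIV_image_chain[rotated])
  then show ?thesis
    by (intro has_field_derivative_transform_within[of "U' \<circ> G" _ y "{0..1}" 1 g])
      (use y g in \<open>auto simp: G_def\<close>)
qed

text \<open>The essential regularity of \<open>f\<close> yields a classical derivative of a representative; that \<open>f\<close> equals the representative
  everywhere follows from \<open>g' = f / g\<close>, as \<open>f\<close> is determined by the derivative of \<open>g\<close>.\<close>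

lemma Winf_quotient_imp_C1:
  fixes f g :: "real \<Rightarrow> real"
  assumes "in_Winf 2 f" and g_nz: "\<And>y. y \<in> {0..1} \<Longrightarrow> g y \<noteq> 0"
    and g: "\<And>y. y \<in> {0..1} \<Longrightarrow> (g has_real_derivative f y / g y) (at y within {0..1})"
  obtains f1 where "continuous_on {0..1} f1"
    "\<And>y. y \<in> {0..1} \<Longrightarrow> (f has_real_derivative f1 y) (at y within {0..1})"
proof -
  obtain v1 v2 where v: "has_weak_deriv f v1" "has_weak_deriv v1 v2"
    using assms(1) by (auto simp: numeral_2_eq_2)
  obtain C where C: "AE x in \<M>. v1 x = C + integral {0..x} v2"
    using weak_deriv_imp_AE_indefinite_integral_real[OF v(2)] ..
  define f1 where "f1 x = C + integral {0..x} v2" for x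
  have f1_cont: "continuous_on {0..1} f1"
    unfolding f1_def using v(2) by (intro continuous_intros indefinite_integral_continuous_unit) (simp add: has_weak_deriv_def)
  obtain F where F: "AE x in \<M>. f x = F x" "\<And>x. x \<in> {0..1} \<Longrightarrow> (F has_vector_derivative f1 x) (at x within {0..1})"
    using AE_indefinite_integral_continuous[OF weak_deriv_imp_AE_indefinite_integral_real[OF v(1)] C[folded f1_def] f1_cont] by blast
  have F_cont: "continuous_on {0..1} F"
    by (rule continuous_on_vector_derivative[OF F(2)])
  have g_cont: "continuous_on {0..1} g"
    by (rule DERIV_continuous_on[OF g])
  have Fg_cont: "continuous_on {0..1} (\<lambda>y. F y / g y)"
    using g_nz by (intro continuous_intros F_cont g_cont) auto
  have AE_q: "AE x in \<M>. f x / g x = F x / g x" using F(1) by eventually_elim simp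
  have g_eq: "g 0 + integral {0..y} (\<lambda>y. F y / g y) = g y" if y: "y \<in> {0..1}" for y
  proof -
    have "((\<lambda>y. f y / g y) has_integral (g y - g 0)) {0..y}"
      using y by (intro fundamental_theorem_of_calculus)
        (auto simp: has_real_derivative_iff_has_vector_derivative[symmetric] intro!: DERIV_subset[OF g])
    then have "integral {0..y} (\<lambda>y. f y / g y) = g y - g 0" by (rule integral_unique)
    moreover have "integral {0..y} (\<lambda>y. f y / g y) = integral {0..y} (\<lambda>y. F y / g y)"
      using y by (intro integral_cong_AE_unit[OF AE_q]) auto
    ultimately show ?thesis by simp
  qed
  have eq: "f y = F y" if y: "y \<in> {0..1}" for y
  proof -
    have "((\<lambda>y. g 0 + integral {0..y} (\<lambda>y. F y / g y)) has_vector_derivative 0 + F y / g y) (at y within {0..1})"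
      by (intro has_vector_derivative_add has_vector_derivative_const integral_has_vector_derivative Fg_cont y)
    from has_vector_derivative_transform[OF y g_eq[symmetric] this]
    have "(g has_vector_derivative F y / g y) (at y within {0..1})" by simp
    then have "F y / g y = f y / g y"
      using g[OF y] y by (intro vector_derivative_unique_within_closed_interval[of 0 1 y g])
        (auto simp: has_real_derivative_iff_has_vector_derivative)
    then show ?thesis using g_nz[OF y] by simp
  qed
  show ?thesis
  proof (rule that[OF f1_cont])
    fix y :: real assume y: "y \<in> {0..1}"
    show "(f has_real_derivative f1 y) (at y within {0..1})"
      unfolding has_real_derivative_iff_has_vector_derivative
      by (rule has_vector_derivative_transform[OF y _ F(2)[OF y]]) (rule eq)
  qed
qed

section \<open>From identities almost everywhere to identities at points\<close>

lemma at_within_unit_diff_negligible: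
  assumes "negligible N" "x \<in> {0..1::real}"
  shows "at x within ({0..1} - N) \<noteq> bot"
proof -
  have "x islimpt ({0..1} - N)"
    unfolding islimpt_approachable
  proof (intro allI impI)
    fix e :: real assume e: "e > 0"
    define S where "S = {max 0 (x - e)<..<min 1 (x + e)} - {x}"
    have "open S" unfolding S_def by (intro open_Diff) auto
    moreover have "S \<noteq> {}"
    proof -
      have "infinite {max 0 (x - e)<..<min 1 (x + e)}" using assms(2) e by simp
      then show ?thesis unfolding S_def by (metis Diff_infinite_finite finite.emptyI finite.insertI)
    qed
    ultimately have "\<not> S \<subseteq> N" using open_not_negligible negligible_subset assms(1) by blast
    then obtain z where "z \<in> S" "z \<notin> N" by blast
    then show "\<exists>x'\<in>{0..1} - N. x' \<noteq> x \<and> dist x' x < e"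
      by (intro bexI[of _ z]) (auto simp: S_def dist_real_def)
  qed
  then show ?thesis by (simp add: trivial_limit_within)
qed

lemma AE_zero_imp_value_zero:
  fixes d :: "real \<Rightarrow> complex"
  assumes "AE x in \<M>. d x = 0" "x \<in> {0..1}" "continuous (at x within {0..1}) d"
  shows "d x = 0"
proof -
  define N where "N = {x \<in> {0..1}. d x \<noteq> 0}"
  have N: "negligible N" using assms(1) by (simp add: AE_unit_iff_negligible N_def)
  have "(d \<longlongrightarrow> d x) (at x within ({0..1} - N))"
    using assms(3) by (auto simp: continuous_within intro: tendsto_within_subset)
  moreover have "(d \<longlongrightarrow> 0) (at x within ({0..1} - N))"
    by (rule tendsto_eventually) (auto simp: eventually_at_filter N_def)
  ultimately show ?thesis
    using tendsto_unique at_within_unit_diff_negligible[OF N assms(2)] by blast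
qed

text \<open>The complement of a null set accumulates at every point of [0,1], end points included,
  so a derivative is determined by the values off the null set. This is for the end points, where
  the theorem speaks of the derivative of \<open>W t\<close> itself and the regularity theory of a
  representative.\<close>

lemma AE_zero_imp_derivative_zero:
  fixes d :: "real \<Rightarrow> complex"
  assumes "AE x in \<M>. d x = 0" "x \<in> {0..1}" "(d has_vector_derivative d') (at x within {0..1})"
  shows "d' = 0"
proof -
  define N where "N = {x \<in> {0..1}. d x \<noteq> 0}"
  have N: "negligible N" using assms(1) by (simp add: AE_unit_iff_negligible N_def)
  have dx: "d x = 0"
    using AE_zero_imp_value_zero[OF assms(1,2)] has_vector_derivative_continuous[OF assms(3)] by blast
  then have x: "x \<in> {0..1} - N" using assms(2) by (simp add: N_def)
  have "(d has_vector_derivative d') (at x within ({0..1} - N))"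
    by (rule has_vector_derivative_within_subset[OF assms(3)]) auto
  moreover have "(d has_vector_derivative 0) (at x within ({0..1} - N))"
    by (rule has_vector_derivative_transform[OF x _ has_vector_derivative_const[of 0]]) (auto simp: N_def)
  ultimately show ?thesis
    using vector_derivative_unique_within[OF at_within_unit_diff_negligible[OF N assms(2)]] by blast
qed

lemma AE_eq_continuous_imp_eq:
  fixes u w :: "real \<Rightarrow> complex"
  assumes "AE x in \<M>. u x = w x" "continuous_on {0..1} u" "continuous_on {0..1} w" "x \<in> {0..1}"
  shows "u x = w x"
proof -
  have "AE x in \<M>. u x - w x = 0" using assms(1) by eventually_elim simp
  moreover have "continuous (at x within {0..1}) (\<lambda>x. u x - w x)"
    using continuous_on_diff[OF assms(2,3)] assms(4) by (simp add: continuous_on_eq_continuous_within)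
  ultimately have "u x - w x = 0" using assms(4) by (intro AE_zero_imp_value_zero)
  then show ?thesis by simp
qed

text \<open>Solving the two halves of the equation for the weak derivatives expresses them almost
  everywhere through \<open>\<Phi>\<close>, \<open>w\<close> and the continuous representative of
  \<open>\<Psi>0\<close>. These expressions are continuous, so the derivatives are classical.
  \<open>\<Phi>\<close> is continuous and hence equal to its own representative everywhere, whereas
  \<open>\<Psi>\<close> is the representative just constructed.\<close>

lemma stream_function_classical:
  assumes stream: "stream_function g k t W \<Phi>" and "k \<noteq> 0"
    and g_cont: "continuous_on {0..1} g" and g_nz: "\<And>y. y \<in> {0..1} \<Longrightarrow> g y \<noteq> 0"
    and W: "AE y in \<M>. W y = w y" and w_cont: "continuous_on {0..1} w"
  obtains \<Psi> where
    "\<And>y. y \<in> {0..1} \<Longrightarrow> (\<Phi> has_vector_derivative of_real k * (\<Psi> y / of_real (g y) + \<i> * of_real t * \<Phi> y)) (at y within {0..1})"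
    "\<And>y. y \<in> {0..1} \<Longrightarrow> (\<Psi> has_vector_derivative of_real k * ((\<Phi> y + w y) / of_real (g y) + \<i> * of_real t * \<Psi> y)) (at y within {0..1})"
proof -
  from stream obtain \<Psi>0 X where \<Phi>_cont: "continuous_on {0..1} \<Phi>"
    and s1: "shifted_deriv g k t \<Phi> \<Psi>0" and s2: "shifted_deriv g k t \<Psi>0 X"
    and eq: "AE y in \<M>. - \<Phi> y + X y = W y"
    unfolding stream_function_def by blast
  obtain u' where u': "has_weak_deriv \<Phi> u'"
      "AE y in \<M>. \<Psi>0 y = of_real (g y) * (u' y / of_real k - \<i> * of_real t * \<Phi> y)"
    using s1 unfolding shifted_deriv_def by blast
  obtain p where p: "has_weak_deriv \<Psi>0 p"
      "AE y in \<M>. X y = of_real (g y) * (p y / of_real k - \<i> * of_real t * \<Psi>0 y)"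
    using s2 unfolding shifted_deriv_def by blast
  obtain C where C: "AE x in \<M>. \<Psi>0 x = C + integral {0..x} p"
    using weak_deriv_imp_AE_indefinite_integral[OF p(1)] ..
  define \<Psi> where "\<Psi> x = C + integral {0..x} p" for x
  have \<Psi>_cont: "continuous_on {0..1} \<Psi>"
    unfolding \<Psi>_def using p(1) by (intro continuous_intros indefinite_integral_continuous_unit) (simp add: has_weak_deriv_def)
  define h1 where "h1 y = of_real k * (\<Psi> y / of_real (g y) + \<i> * of_real t * \<Phi> y)" for y
  define h2 where "h2 y = of_real k * ((\<Phi> y + w y) / of_real (g y) + \<i> * of_real t * \<Psi> y)" for y
  have h_cont: "continuous_on {0..1} h1" "continuous_on {0..1} h2"
    unfolding h1_def h2_def using g_nz by (auto intro!: continuous_intros \<Phi>_cont \<Psi>_cont g_cont w_cont)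
  have "AE y in \<M>. u' y = h1 y"
    using u'(2) C AE_space
  proof eventually_elim
    case (elim y)
    then show ?case using g_nz[of y] \<open>k \<noteq> 0\<close> by (simp add: h1_def \<Psi>_def[symmetric] field_simps)
  qed
  then obtain \<Phi>' where \<Phi>': "AE x in \<M>. \<Phi> x = \<Phi>' x"
      "\<And>x. x \<in> {0..1} \<Longrightarrow> (\<Phi>' has_vector_derivative h1 x) (at x within {0..1})"
    using weak_deriv_continuous_imp_classical[OF u'(1) _ h_cont(1)] by blast
  have "continuous_on {0..1} \<Phi>'"
    by (rule continuous_on_vector_derivative[OF \<Phi>'(2)])
  then have \<Phi>_eq: "\<Phi> x = \<Phi>' x" if "x \<in> {0..1}" for x
    using AE_eq_continuous_imp_eq[OF \<Phi>'(1) \<Phi>_cont _ that] by blast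
  have AE_p: "AE y in \<M>. p y = h2 y"
    using p(2) C eq W AE_space
  proof eventually_elim
    case (elim y)
    have "of_real (g y) * (p y / of_real k - \<i> * of_real t * \<Psi> y) = \<Phi> y + w y"
      using elim by (simp add: \<Psi>_def[symmetric] algebra_simps)
    then show ?case using g_nz[of y] elim(5) \<open>k \<noteq> 0\<close> by (simp add: h2_def field_simps)
  qed
  show ?thesis
  proof (rule that[of \<Psi>])
    fix y :: real assume y: "y \<in> {0..1}"
    have "(\<Phi> has_vector_derivative h1 y) (at y within {0..1})"
      by (rule has_vector_derivative_transform[OF y _ \<Phi>'(2)[OF y]]) (rule \<Phi>_eq)
    then show "(\<Phi> has_vector_derivative of_real k * (\<Psi> y / of_real (g y) + \<i> * of_real t * \<Phi> y)) (at y within {0..1})"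
      by (simp only: h1_def)
    have "((\<lambda>x. C + integral {0..x} h2) has_vector_derivative 0 + h2 y) (at y within {0..1})"
      by (intro has_vector_derivative_add has_vector_derivative_const integral_has_vector_derivative h_cont y)
    moreover have "\<Psi> x = C + integral {0..x} h2" if "x \<in> {0..1}" for x
      using that by (simp add: \<Psi>_def integral_cong_AE_unit[OF AE_p])
    ultimately have "(\<Psi> has_vector_derivative 0 + h2 y) (at y within {0..1})"
      by (rule has_vector_derivative_transform[OF y, rotated])
    then have "(\<Psi> has_vector_derivative h2 y) (at y within {0..1})" by simp
    then show "(\<Psi> has_vector_derivative of_real k * ((\<Phi> y + w y) / of_real (g y) + \<i> * of_real t * \<Psi> y)) (at y within {0..1})"
      by (simp only: h2_def)
  qed
qed

text \<open>Integration against a bounded weight is a continuous functional on L2, so it carries an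
  L2 derivative to an ordinary one. The L2 norm of the difference quotient does not see the passage
  from \<open>W\<close> to the continuous \<open>w\<close>.\<close>

lemma L2_time_derivative_weighted:
  assumes deriv: "has_L2_time_derivative W V t" and t: "t \<ge> 0"
    and W: "\<And>\<tau>. \<tau> \<ge> 0 \<Longrightarrow> AE y in \<M>. W \<tau> y = w \<tau> y"
    and w: "\<And>\<tau>. \<tau> \<ge> 0 \<Longrightarrow> continuous_on {0..1} (w \<tau>)" and V: "continuous_on {0..1} V"
    and cd: "0 \<le> c" "c \<le> d" "d \<le> 1" and \<rho>: "continuous_on UNIV \<rho>"
  shows "((\<lambda>\<tau>. integral {c..d} (\<lambda>y. of_real (\<rho> y) * w \<tau> y)) has_vector_derivative
    integral {c..d} (\<lambda>y. of_real (\<rho> y) * V y)) (at t within {0..})"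
proof -
  define F where "F \<tau> = integral {c..d} (\<lambda>y. of_real (\<rho> y) * w \<tau> y)" for \<tau>
  define F' where "F' = integral {c..d} (\<lambda>y. of_real (\<rho> y) * V y)"
  define Q where "Q \<tau> y = (w \<tau> y - w t y) / of_real (\<tau> - t) - V y" for \<tau> y
  have sub: "{c..d} \<subseteq> {0..1}" using cd by auto
  have \<rho>S: "continuous_on S \<rho>" for S using \<rho> continuous_on_subset by blast
  obtain R where R: "\<And>y. y \<in> {0..1} \<Longrightarrow> norm (\<rho> y) \<le> R" using continuous_on_bounded_unit[OF \<rho>S] by blast
  have R0: "R \<ge> 0" using R[of 0] by simp
  have Q_cont: "continuous_on {0..1} (Q \<tau>)" if "\<tau> \<ge> 0" "\<tau> \<noteq> t" for \<tau>
    unfolding Q_def using that t by (intro continuous_intros w V) auto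
  have slope: "(F \<tau> - F t) /\<^sub>R (\<tau> - t) - F' = integral {c..d} (\<lambda>y. of_real (\<rho> y) * Q \<tau> y)"
    if \<tau>: "\<tau> \<ge> 0" "\<tau> \<noteq> t" for \<tau>
  proof -
    have i: "(\<lambda>y. of_real (\<rho> y) * w \<tau> y) integrable_on {c..d}" "(\<lambda>y. of_real (\<rho> y) * w t y) integrable_on {c..d}"
      "(\<lambda>y. of_real (\<rho> y) * V y) integrable_on {c..d}"
      using \<tau> t by (auto intro!: integrable_continuous_real continuous_intros \<rho>S continuous_on_subset[OF w sub] continuous_on_subset[OF V sub])
    have "((\<lambda>y. (of_real (\<rho> y) * w \<tau> y - of_real (\<rho> y) * w t y) /\<^sub>R (\<tau> - t) - of_real (\<rho> y) * V y)
        has_integral ((F \<tau> - F t) /\<^sub>R (\<tau> - t) - F')) {c..d}"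
      unfolding F_def F'_def
      by (intro has_integral_diff has_integral_cmul integrable_integral i)
    moreover have "(of_real (\<rho> y) * w \<tau> y - of_real (\<rho> y) * w t y) /\<^sub>R (\<tau> - t) - of_real (\<rho> y) * V y = of_real (\<rho> y) * Q \<tau> y" for y
      using \<tau> by (simp add: Q_def scaleR_conv_of_real field_simps)
    ultimately show ?thesis by (simp add: integral_unique)
  qed
  have bound: "norm ((F \<tau> - F t) /\<^sub>R (\<tau> - t) - F') \<le> (\<theta> * (R\<^sup>2 * \<epsilon>) + (d - c) / \<theta>) / 2"
    if \<tau>: "\<tau> \<ge> 0" "\<tau> \<noteq> t" and \<theta>: "\<theta> > 0" and \<epsilon>: "\<epsilon> \<ge> 0"
      and L2: "L2_norm_sq (\<lambda>y. (W \<tau> y - W t y) / of_real (\<tau> - t) - V y) \<le> ennreal \<epsilon>" for \<tau> \<theta> \<epsilon>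
  proof -
    let ?q = "\<lambda>y. (W \<tau> y - W t y) / of_real (\<tau> - t) - V y"
    let ?v = "\<lambda>y. of_real (\<rho> y) * Q \<tau> y"
    have v_cont: "continuous_on {0..1} ?v" by (intro continuous_intros \<rho>S Q_cont \<tau>)
    have vi: "integrable \<M> ?v"
      using continuous_imp_integrable_real[OF v_cont] by simp
    have qm: "?q \<in> borel_measurable \<M>" using L2 by (auto simp: L2_norm_sq_def top_unique split: if_splits)
    have Q_m: "Q \<tau> \<in> borel_measurable \<M>" by (rule continuous_on_borel_unit[OF Q_cont[OF \<tau>]])
    have AE_q: "AE y in \<M>. ?q y = Q \<tau> y"
      using W[OF \<tau>(1)] W[OF t] by eventually_elim (simp add: Q_def)
    have "L2_norm_sq ?v = (\<integral>\<^sup>+y. ennreal ((norm (?v y))\<^sup>2) \<partial>\<M>)"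
      using continuous_on_borel_unit[OF v_cont] by (simp add: L2_norm_sq_def)
    also have "\<dots> \<le> (\<integral>\<^sup>+y. ennreal (R\<^sup>2) * ennreal ((norm (Q \<tau> y))\<^sup>2) \<partial>\<M>)"
    proof (rule nn_integral_mono)
      fix y assume "y \<in> space \<M>"
      then have "(norm (\<rho> y))\<^sup>2 \<le> R\<^sup>2" using R[of y] by (intro power_mono) auto
      then have "(norm (?v y))\<^sup>2 \<le> R\<^sup>2 * (norm (Q \<tau> y))\<^sup>2"
        by (simp add: norm_mult power_mult_distrib mult_right_mono)
      then show "ennreal ((norm (?v y))\<^sup>2) \<le> ennreal (R\<^sup>2) * ennreal ((norm (Q \<tau> y))\<^sup>2)"
        by (simp add: ennreal_mult[symmetric] ennreal_leI)
    qed
    also have "\<dots> = ennreal (R\<^sup>2) * (\<integral>\<^sup>+y. ennreal ((norm (Q \<tau> y))\<^sup>2) \<partial>\<M>)"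
      using Q_m by (intro nn_integral_cmult) measurable
    also have "(\<integral>\<^sup>+y. ennreal ((norm (Q \<tau> y))\<^sup>2) \<partial>\<M>) = (\<integral>\<^sup>+y. ennreal ((norm (?q y))\<^sup>2) \<partial>\<M>)"
      using AE_q by (intro nn_integral_cong_AE) (auto elim!: eventually_mono)
    also have "\<dots> = L2_norm_sq ?q" using qm by (simp add: L2_norm_sq_def)
    also have "ennreal (R\<^sup>2) * \<dots> \<le> ennreal (R\<^sup>2) * ennreal \<epsilon>" using L2 by (rule mult_left_mono) simp
    also have "\<dots> = ennreal (R\<^sup>2 * \<epsilon>)" using \<epsilon> by (simp add: ennreal_mult)
    finally have "L2_norm_sq ?v \<le> ennreal (R\<^sup>2 * \<epsilon>)" .
    from norm_integral_le_L2[OF vi this _ cd \<theta>] \<epsilon> show ?thesis unfolding slope[OF \<tau>] by simp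
  qed
  have lim: "((\<lambda>\<tau>. (F \<tau> - F t) /\<^sub>R (\<tau> - t)) \<longlongrightarrow> F') (at t within {0..})"
  proof (rule tendstoI)
    fix e :: real assume e: "e > 0"
    \<comment> \<open>This makes \<open>(d - c) / \<theta>\<close> at most \<open>e / 2\<close>;
      \<open>\<epsilon>\<close> is then small enough to do the same for the other term. Adding 1 to
      \<open>R\<^sup>2\<close> avoids a division by zero.\<close>
    define \<theta> where "\<theta> = 2 / e"
    define \<epsilon> where "\<epsilon> = e\<^sup>2 / (4 * (R\<^sup>2 + 1))"
    have \<theta>: "\<theta> > 0" using e by (simp add: \<theta>_def)
    have R1: "R\<^sup>2 + 1 > 0" by (simp add: add_nonneg_pos)
    have \<epsilon>: "\<epsilon> > 0" using e R1 by (simp add: \<epsilon>_def)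
    have "R\<^sup>2 * \<epsilon> \<le> (R\<^sup>2 + 1) * \<epsilon>" using \<epsilon> by (intro mult_right_mono) auto
    also have "\<dots> = e\<^sup>2 / 4" using R1 by (simp add: \<epsilon>_def field_simps)
    finally have "\<theta> * (R\<^sup>2 * \<epsilon>) \<le> \<theta> * (e\<^sup>2 / 4)" using \<theta> by (intro mult_left_mono) auto
    also have "\<dots> = e / 2" using e by (simp add: \<theta>_def power2_eq_square)
    finally have 1: "\<theta> * (R\<^sup>2 * \<epsilon>) \<le> e / 2" .
    have "(d - c) / \<theta> \<le> 1 / \<theta>" using cd \<theta> by (intro divide_right_mono) auto
    then have 2: "(d - c) / \<theta> \<le> e / 2" by (simp add: \<theta>_def)
    have "eventually (\<lambda>\<tau>. L2_norm_sq (\<lambda>y. (W \<tau> y - W t y) / of_real (\<tau> - t) - V y) < ennreal \<epsilon>) (at t within {0..})"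
      using deriv \<epsilon> unfolding has_L2_time_derivative_def by (intro order_tendstoD) auto
    moreover have "eventually (\<lambda>\<tau>. \<tau> \<ge> 0 \<and> \<tau> \<noteq> t) (at t within {0..})"
      by (simp add: eventually_at_filter)
    ultimately show "eventually (\<lambda>\<tau>. dist ((F \<tau> - F t) /\<^sub>R (\<tau> - t)) F' < e) (at t within {0..})"
    proof eventually_elim
      case (elim \<tau>)
      have "norm ((F \<tau> - F t) /\<^sub>R (\<tau> - t) - F') \<le> (\<theta> * (R\<^sup>2 * \<epsilon>) + (d - c) / \<theta>) / 2"
        using elim \<theta> \<epsilon> by (intro bound) auto
      also have "\<dots> < e"
      proof -
        have "(p + q) / 2 < e" if "p \<le> e / 2" "q \<le> e / 2" for p q using that e by simp
        then show ?thesis using 1 2 by blast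
      qed
      finally show ?case by (simp add: dist_norm)
    qed
  qed
  show ?thesis using lim unfolding F_def[symmetric] F'_def[symmetric] has_vector_derivative_iff_slope .
qed

lemma C2_bounded_family_equicontinuous:
  assumes \<alpha>: "\<alpha> > 0" and C2: "\<And>t. t \<in> X \<Longrightarrow> C2_bounded M \<alpha> (w t) (w1 t) (w2 t)"
  shows "bdd_equicontinuous X w2"
proof (rule bdd_equicontinuousI)
  show "norm (w2 t x) \<le> M" if "t \<in> X" "x \<in> {0..1}" for t x
    using C2[OF that(1)] that(2) unfolding C2_bounded_def by blast
  fix \<epsilon> :: real assume \<epsilon>: "\<epsilon> > 0"
  \<comment> \<open>Inverts the Hoelder modulus:
    \<open>(\<bar>M\<bar> + 1) * \<delta> powr \<alpha> = \<epsilon>\<close>.\<close>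
  define \<delta> where "\<delta> = (\<epsilon> / (\<bar>M\<bar> + 1)) powr (1 / \<alpha>)"
  have \<delta>: "\<delta> powr \<alpha> = \<epsilon> / (\<bar>M\<bar> + 1)" "\<delta> > 0" using \<alpha> \<epsilon> by (auto simp: \<delta>_def powr_powr)
  show "\<exists>\<delta>>0. \<forall>t\<in>X. \<forall>x\<in>{0..1}. \<forall>y\<in>{0..1}. \<bar>x - y\<bar> < \<delta> \<longrightarrow> norm (w2 t x - w2 t y) < \<epsilon>"
  proof (intro exI[of _ \<delta>] conjI ballI impI \<delta>(2))
    fix t x y assume *: "t \<in> X" "x \<in> {0..1}" "y \<in> {0..1}" "\<bar>x - y\<bar> < \<delta>"
    have "norm (w2 t x - w2 t y) \<le> M * \<bar>x - y\<bar> powr \<alpha>" using C2[OF *(1)] *(2,3) unfolding C2_bounded_def by blast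
    also have "\<dots> \<le> \<bar>M\<bar> * \<delta> powr \<alpha>"
      using * \<alpha> by (intro mult_mono powr_mono2) auto
    also have "\<dots> < \<epsilon>" unfolding \<delta>(1) using \<epsilon> by (simp add: field_simps)
    finally show "norm (w2 t x - w2 t y) < \<epsilon>" .
  qed
qed

theorem corollary1p2:
  fixes L a b c k s :: real and m :: int
    and U U' U'' f g :: "real \<Rightarrow> real"
    and \<omega>\<^sub>0 :: "real \<Rightarrow> complex"
    and W \<Phi> :: "real \<Rightarrow> real \<Rightarrow> complex"
    and l\<^sub>0 l\<^sub>1 :: complex
  assumes "L > 0" and "m \<noteq> 0" and "k = 2 * pi / L * of_int m"
    and "a < b"
    and "strict_mono_on {a..b} U \<or> strict_antimono_on {a..b} U"
    and "U ` {a..b} = {0..1}"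
    and "\<And>x. x \<in> {a..b} \<Longrightarrow> (U has_real_derivative U' x) (at x within {a..b})"
    and "\<And>x. x \<in> {a..b} \<Longrightarrow> (U' has_real_derivative U'' x) (at x within {a..b})"
    and "\<And>y. y \<in> {0..1} \<Longrightarrow> f y = U'' (the_inv_into {a..b} U y)"
    and "\<And>y. y \<in> {0..1} \<Longrightarrow> g y = U' (the_inv_into {a..b} U y)"
    and "in_Winf 2 f" and "in_Winf 2 g"
    and "c > 0" and "\<And>y. y \<in> {0..1} \<Longrightarrow> (g y)\<^sup>2 > c"
    and "\<omega>\<^sub>0 0 = 0" and "\<omega>\<^sub>0 1 = 0"
    and "euler_solution f g k \<omega>\<^sub>0 W \<Phi>"
    and "\<And>t. t \<ge> 0 \<Longrightarrow> W t differentiable (at 0 within {0..1})"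
    and "\<And>t. t \<ge> 0 \<Longrightarrow> W t differentiable (at 1 within {0..1})"
    and "((\<lambda>t. of_real (f 0) * vector_derivative (W t) (at 0 within {0..1})) \<longlongrightarrow> l\<^sub>0) at_top"
    and "((\<lambda>t. of_real (f 1) * vector_derivative (W t) (at 1 within {0..1})) \<longlongrightarrow> l\<^sub>1) at_top"
    and "\<not> (l\<^sub>0 = 0 \<and> l\<^sub>1 = 0)"
    and "s > 5 / 2"
  shows "(SUP t\<in>{0..}. Hs_norm s (W t)) = \<infinity>"
proof (rule ccontr)
  assume fin: "(SUP t\<in>{0..}. Hs_norm s (W t)) \<noteq> \<infinity>"
  note L = assms(1) and m = assms(2) and k_eq = assms(3) and mono = assms(5) and range = assms(6)
    and U = assms(7) and U' = assms(8) and f_eq = assms(9) and g_eq = assms(10) and f_Winf = assms(11)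
    and c = assms(13) and g_c = assms(14) and \<omega>0 = assms(15) and \<omega>1 = assms(16) and sol = assms(17)
    and diff0 = assms(18) and diff1 = assms(19) and lim0 = assms(20) and lim1 = assms(21)
    and nontrivial = assms(22) and s = assms(23)
  have k: "k \<noteq> 0" using L m k_eq by simp
  have g_nz: "g y \<noteq> 0" if "y \<in> {0..1}" for y using g_c[OF that] c by auto
  have g_deriv: "(g has_real_derivative f y / g y) (at y within {0..1})" if "y \<in> {0..1}" for y
    using shear_profile_deriv[OF mono range U U' f_eq g_eq g_nz that] .
  obtain f1 where f1_cont: "continuous_on {0..1} f1"
    and f_deriv: "\<And>y. y \<in> {0..1} \<Longrightarrow> (f has_real_derivative f1 y) (at y within {0..1})"
    using Winf_quotient_imp_C1[OF f_Winf g_nz g_deriv] by blast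
  have f_cont: "continuous_on {0..1} f" and g_cont: "continuous_on {0..1} g"
    by (rule DERIV_continuous_on[OF f_deriv] DERIV_continuous_on[OF g_deriv], assumption)+
  obtain M where M: "M \<ge> 0" "(SUP t\<in>{0..}. Hs_norm s (W t)) = ennreal M"
    using fin by (cases "SUP t\<in>{0..}. Hs_norm s (W t)") auto
  have sob: "sobolev_norm_sq (nat \<lfloor>s\<rfloor>) (frac s) (W t) < ennreal (M\<^sup>2 + 1)" if "t \<ge> 0" for t
  proof (rule Hs_norm_le_imp_sobolev_less[OF _ M(1)])
    show "Hs_norm s (W t) \<le> ennreal M" unfolding M(2)[symmetric] using that by (intro SUP_upper) auto
  qed
  \<comment> \<open>One pair \<open>N\<close>, \<open>\<alpha>\<close> serves all functions within
    the norm bound, hence all times; equicontinuity in time rests on this.\<close>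
  obtain N \<alpha> where \<alpha>: "\<alpha> > 0" and "\<forall>u. sobolev_norm_sq (nat \<lfloor>s\<rfloor>) (frac s) u < ennreal (M\<^sup>2 + 1) \<longrightarrow>
    (\<exists>w w1 w2. (AE x in \<M>. u x = w x) \<and> C2_bounded N \<alpha> w w1 w2)"
    using sobolev_imp_C2_bounded[OF s, of "M\<^sup>2 + 1"] by auto
  then have "\<forall>t. t \<ge> 0 \<longrightarrow> (\<exists>w w1 w2. (AE x in \<M>. W t x = w x) \<and> C2_bounded N \<alpha> w w1 w2)"
    using sob by blast
  then obtain w w1 w2 where w_AE: "\<And>t. t \<ge> 0 \<Longrightarrow> AE x in \<M>. W t x = w t x"
    and C2: "\<And>t. t \<ge> 0 \<Longrightarrow> C2_bounded N \<alpha> (w t) (w1 t) (w2 t)" by metis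
  have w_deriv: "(w t has_vector_derivative w1 t y) (at y within {0..1})"
    and w1_deriv: "(w1 t has_vector_derivative w2 t y) (at y within {0..1})"
    and w_le: "norm (w t y) \<le> N" "norm (w1 t y) \<le> N" if "t \<ge> 0" "y \<in> {0..1}" for t y
    using C2[OF that(1)] that(2) unfolding C2_bounded_def by blast+
  have w_cont: "continuous_on {0..1} (w t)" if "t \<ge> 0" for t
    by (rule continuous_on_vector_derivative[OF w_deriv[OF that]])
  have sol_t: "stream_function g k t (W t) (\<Phi> t)"
      "has_L2_time_derivative W (\<lambda>y. \<i> * of_real (f y) / of_real k * \<Phi> t y) t" if "t \<ge> 0" for t
    using sol that unfolding euler_solution_def by blast+
  have "\<forall>t\<in>{0..}. \<exists>\<Psi>. \<forall>y\<in>{0..1}.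
      (\<Phi> t has_vector_derivative of_real k * (\<Psi> y / of_real (g y) + \<i> * of_real t * \<Phi> t y)) (at y within {0..1}) \<and>
      (\<Psi> has_vector_derivative of_real k * ((\<Phi> t y + w t y) / of_real (g y) + \<i> * of_real t * \<Psi> y)) (at y within {0..1})"
    (is "\<forall>t\<in>_. \<exists>\<Psi>. ?S t \<Psi>")
  proof
    fix t :: real assume "t \<in> {0..}"
    then have t: "t \<ge> 0" by simp
    show "\<exists>\<Psi>. ?S t \<Psi>"
      by (rule stream_function_classical[OF sol_t(1)[OF t] k g_cont g_nz w_AE[OF t] w_cont[OF t]])
        (assumption, intro exI ballI conjI, assumption+)
  qed
  from bchoice[OF this] obtain \<Psi> where \<Psi>: "\<forall>t\<in>{0..}. ?S t (\<Psi> t)" by (elim exE)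
  have \<Phi>\<Psi>_deriv:
    "(\<Phi> t has_vector_derivative of_real k * (\<Psi> t y / of_real (g y) + \<i> * of_real t * \<Phi> t y)) (at y within {0..1})"
    "(\<Psi> t has_vector_derivative of_real k * ((\<Phi> t y + w t y) / of_real (g y) + \<i> * of_real t * \<Psi> t y)) (at y within {0..1})"
    if "t \<ge> 0" "y \<in> {0..1}" for t y
    using bspec[OF bspec[OF \<Psi>, of t] that(2)] that(1) by (simp_all only: atLeast_iff)
  \<comment> \<open>\<open>W t\<close> and \<open>w t\<close> agree almost everywhere, and at a
    point where \<open>W t\<close> is differentiable so do their values and derivatives. This
    transfers the initial condition and the two limits to \<open>w\<close>.\<close>
  have end_deriv: "W t y = w t y \<and> vector_derivative (W t) (at y within {0..1}) = w1 t y"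
    if t: "t \<ge> 0" and y: "y \<in> {0..1}" and diff: "W t differentiable (at y within {0..1})" for t y
  proof -
    have W': "(W t has_vector_derivative vector_derivative (W t) (at y within {0..1})) (at y within {0..1})"
      using diff by (simp add: vector_derivative_works)
    have d: "((\<lambda>x. W t x - w t x) has_vector_derivative vector_derivative (W t) (at y within {0..1}) - w1 t y) (at y within {0..1})"
      by (intro has_vector_derivative_diff W' w_deriv t y)
    have AE: "AE x in \<M>. W t x - w t x = 0" using w_AE[OF t] by eventually_elim simp
    from AE_zero_imp_value_zero[OF AE y has_vector_derivative_continuous[OF d]] AE_zero_imp_derivative_zero[OF AE y d]
    show ?thesis by simp
  qed
  interpret euler_channel k f f1 g w w1 w2 \<Phi> \<Psi>
  proof
    show "bdd_equicontinuous {0..} w2"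
      by (rule C2_bounded_family_equicontinuous[OF \<alpha>]) (use C2 in auto)
    show "w 0 0 = 0" using end_deriv[of 0 0] diff0[of 0] sol \<omega>0 by (auto simp: euler_solution_def)
    show "w 0 1 = 0" using end_deriv[of 0 1] diff1[of 0] sol \<omega>1 by (auto simp: euler_solution_def)
    show "\<Phi> t 0 = 0" "\<Phi> t 1 = 0" if "t \<ge> 0" for t
      using sol_t(1)[OF that] by (auto simp: stream_function_def)
    fix t c d :: real and \<rho> :: "real \<Rightarrow> real"
    assume t: "t \<ge> 0" and cd: "0 \<le> c" "c \<le> d" "d \<le> 1" and \<rho>: "continuous_on UNIV \<rho>"
    have \<Phi>_cont: "continuous_on {0..1} (\<Phi> t)" using sol_t(1)[OF t] by (simp add: stream_function_def)
    have "((\<lambda>\<tau>. integral {c..d} (\<lambda>y. of_real (\<rho> y) * w \<tau> y)) has_vector_derivative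
        integral {c..d} (\<lambda>y. of_real (\<rho> y) * (\<i> * of_real (f y) / of_real k * \<Phi> t y))) (at t within {0..})"
      by (rule L2_time_derivative_weighted[OF sol_t(2)[OF t] t w_AE w_cont _ cd \<rho>])
        (use k in \<open>auto intro!: continuous_intros f_cont \<Phi>_cont\<close>)
    moreover have "(\<lambda>y. of_real (\<rho> y) * (\<i> * of_real (f y) / of_real k * \<Phi> t y))
        = (\<lambda>y. \<i> / of_real k * (of_real (\<rho> y) * (of_real (f y) * \<Phi> t y)))"
      by (simp add: fun_eq_iff)
    ultimately show "((\<lambda>\<tau>. integral {c..d} (\<lambda>y. of_real (\<rho> y) * w \<tau> y)) has_vector_derivative
        \<i> / of_real k * integral {c..d} (\<lambda>y. of_real (\<rho> y) * (of_real (f y) * \<Phi> t y))) (at t within {0..})"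
      by (simp only: integral_mult_right)
  next
    show "\<exists>M. \<forall>t\<ge>0. \<forall>y\<in>{0..1}. norm (w t y) \<le> M" "\<exists>M. \<forall>t\<ge>0. \<forall>y\<in>{0..1}. norm (w1 t y) \<le> M"
      using w_le by blast+
  qed (rule k f_deriv f1_cont g_nz g_deriv w_deriv w1_deriv \<Phi>\<Psi>_deriv; assumption)+
  have "((\<lambda>t. of_real (f 0) * w1 t 0) \<longlongrightarrow> l\<^sub>0) at_top"
    by (rule Lim_transform_eventually[OF lim0])
      (use eventually_ge_at_top[of 0] in \<open>eventually_elim, use end_deriv diff0 in auto\<close>)
  then have "l\<^sub>0 = 0" by (rule boundary_limits_zero(1))
  have "((\<lambda>t. of_real (f 1) * w1 t 1) \<longlongrightarrow> l\<^sub>1) at_top"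
    by (rule Lim_transform_eventually[OF lim1])
      (use eventually_ge_at_top[of 0] in \<open>eventually_elim, use end_deriv diff1 in auto\<close>)
  then have "l\<^sub>1 = 0" by (rule boundary_limits_zero(2))
  with \<open>l\<^sub>0 = 0\<close> nontrivial show False by simp
qed

end
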